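(* Let $d\ge 2$ and let $\mathbb{T}^d=(V,E)$ be the Cayley tree of order $d$ with root $\rho$. Let $Q:\mathbb{Z}\to(0,\infty)$ be symmetric ($Q(-j)=Q(j)$) with $\sum_{j\in\mathbb{N}}j^2Q(j)<\infty$. Let $\bar\mu$ be any (not necessarily spatially homogeneous) tree-indexed Markov chain Gibbs measure on $\mathbb{Z}_2^V$ for the Ising model with interaction described by $\bar Q$, and let $\nu^{\bar\mu}$ be the gradient Gibbs measure of height-period $2$ associated with $\bar\mu$. Let $H_r(\omega)=\frac{1}{|W_r|}\sum_{v\in W_r}\omega_v$ for $\omega\in\Omega=\mathbb{Z}^V$, $r\in\mathbb{N}$. Then the following hold. (a) (Existence.) The limit $H:=\lim_{r\to\infty}H_r$ exists almost surely and in $\mathcal{L}^2$ with respect to the measure $\nu^{\bar\mu}\circ(\sigma^{\rho,0})^{-1}$, and $H$ (set equal to $\limsup_{r\to\infty}H_r$ at those $\omega$ where the limit does not exist) is a height-offset variable for $\nu^{\bar\mu}$. In particular, the measure $\mu^H=\nu^{\bar\mu}\circ G_H^{-1}$ is a Gibbs measure on $(\Omega,\mathcal{F})$ for the specification $\gamma$ associated with $Q$. (b1) (Regularity of the density.) The distribution of $H^{\rho,0}$ under $\nu^{\bar\mu}$ has an infinitely often differentiable Lebesgue density $f_{H^{\rho,0}}$. Moreover, $f_{H^{\rho,0}}$ is strictly positive on $\mathbb{R}$. (b2) (Localization.) Assume furthermore that there is some $R>0$ such that $\sum_{j\in\mathbb{Z}}e^{tj}\frac{Q(j)}{\Vert Q\Vert_1}<\infty$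 for all $t\in(-R,R)$. Then for every $A<(d+1)R$ there exists $B(A)\in(0,\infty)$ such that $$\mu^H(|\sigma_\rho|\ge s)\le B(A)e^{-As}\quad\text{for every } s\in\mathbb{N}.$$ (c1) The measure $\mu^H$ is not invariant under the translations of the tree. (c2) The measure $\mu^H$ is not extreme in the set of all Gibbs measures for the specification $\gamma$ associated with $Q$.
   Context: Tree. $\mathbb{T}^d=(V,E)$ is the infinite tree in which every vertex has exactly $d+1$ nearest neighbors, with root $\rho\in V$ and graph distance $\mathrm{d}(\cdot,\cdot)$. $\vec E$ is the set of oriented edges $(x,y)$ with $\{x,y\}\in E$. $W_r=\{v\in V: \mathrm{d}(\rho,v)=r\}$. $\Gamma(x,y)\subset\vec E$ is the set of oriented edges of the directed self-avoiding path from $x$ to $y$. For $\Lambda\subset V$, $\partial\Lambda$ is the set of vertices outside $\Lambda$ adjacent to a vertex of $\Lambda$. Translations: $V$ is identified with the group generated by $d+1$ generators subject only to the relations that each generator squares to the identity (the free product of $d+1$ copies of $\mathbb{Z}/2\mathbb{Z}$), $\rho$ being the identity and $\mathbb{T}^d$ its Cayley graph; the translations of the tree are the left multiplications $l_v:u\mapsto vu$, $v\in V$, which are graph automorphisms and act on $\Omega$ by permuting coordinates. Configurations. $\Omega=\mathbb{Z}^V$ with product $\sigma$-algebra $\mathcal{F}$ and coordinate maps $\sigma_x(\omega)=\omega_x$; $\mathcal{F}_\Lambda=\sigma(\sigma_x:x\in\Lambda)$; the tail $\sigma$-algebra is $\mathcal{T}=\bigcap_{\Lambda\Subset V}\mathcal{F}_{V\setminus\Lambda}$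 ($\Lambda\Subset V$ means finite subset). $\Omega^\nabla=\{\zeta\in\mathbb{Z}^{\vec E}:\zeta_{(u,v)}=-\zeta_{(v,u)}\}$ with product $\sigma$-algebra $\mathcal{F}^\nabla$ and coordinate maps $\eta_b(\zeta)=\zeta_b$. For $x\in V$, $s\in\mathbb{Z}$, the map $\sigma^{x,s}:\Omega^\nabla\to\Omega$ is $\sigma^{x,s}_v(\zeta)=s+\sum_{b\in\Gamma(x,v)}\zeta_b$. For $a\in\mathbb{Z}$, $\tau_a(\omega)=(\omega_x-a)_{x\in V}$. Gibbs measures. The specification $\gamma=(\gamma_\Lambda)_{\Lambda\Subset V}$ associated with $Q$ consists of the kernels under which the configuration outside $\Lambda$ is fixed to $\omega$ and $$\gamma_\Lambda(\sigma_\Lambda=\tilde\omega_\Lambda\mid\omega)=\frac{1}{Z_\Lambda(\omega_{\partial\Lambda})}\prod_{\{x,y\}\in E,\;x,y\in\Lambda}Q(\tilde\omega_x-\tilde\omega_y)\prod_{\{x,y\}\in E,\;x\in\partial\Lambda,\,y\in\Lambda}Q(\omega_x-\tilde\omega_y),$$ with $Z_\Lambda$ the (finite) normalizing constant. A probability measure $\mu$ on $(\Omega,\mathcal{F})$ is a Gibbs measure for $\gamma$ if $\int\gamma_\Lambda(A\mid\omega)\,\mu(d\omega)=\mu(A)$ for all $A\in\mathcal{F}$ and all $\Lambda\Subset V$. It is extreme if it is an extreme point of the convex set of all Gibbs measures for $\gamma$. Hidden Ising model. $\mathbb{Z}_2=\mathbb{Z}/2\mathbb{Z}=\{\bar0,\bar1\}$,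 and $\bar a=a+2\mathbb{Z}$ for $a\in\mathbb{Z}$. The fuzzy transfer operator $\bar Q:\mathbb{Z}_2\to(0,\infty)$ is $\bar Q(\bar0)=\sum_{l\in\mathbb{Z}}Q(2l)$, $\bar Q(\bar1)=\sum_{l\in\mathbb{Z}}Q(1+2l)$. Gibbs measures on $\mathbb{Z}_2^V$ (coordinate maps $\bar\sigma_x$) for the Ising model described by $\bar Q$ are those for the specification given by the same formula as $\gamma_\Lambda$ with $\mathbb{Z},Q$ replaced by $\mathbb{Z}_2,\bar Q$. Such a measure $\bar\mu$ is a tree-indexed Markov chain if for every $(u,v)\in\vec E$, with past $[-\infty,uv)=\{w\in V:\mathrm{d}(w,u)<\mathrm{d}(w,v)\}$, one has $\bar\mu(\bar\sigma_v=\cdot\mid\bar\sigma_w,\,w\in[-\infty,uv))=\bar\mu(\bar\sigma_v=\cdot\mid\bar\sigma_u)$ $\bar\mu$-a.s. Height-period-2 measure. For $s\in\mathbb{Z}$, $\bar a\in\mathbb{Z}_2$ let $\rho^Q(s\mid\bar a)=\mathbf{1}_{a+2\mathbb{Z}}(s)\,Q(s)/\bar Q(\bar a)$. Let $\bar\nu^{\bar\mu}$ be the law on $\mathbb{Z}_2^V\times\Omega^\nabla$ of $(\bar\sigma,\eta)$ where $\bar\sigma\sim\bar\mu$ and, given $\bar\sigma$, the variables $\eta_{(x,y)}$ over edges $(x,y)$ oriented away from the root are independent with $\eta_{(x,y)}\sim\rho^Q(\cdot\mid\bar\sigma_y-\bar\sigma_x)$. Then $\nu^{\bar\mu}$ is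 the marginal law of $\eta$ on $(\Omega^\nabla,\mathcal{F}^\nabla)$. Height-offset variable. A function $H:\Omega\to\mathbb{R}\cup\{\pm\infty\}$ is a height-offset variable for $\nu=\nu^{\bar\mu}$ if (i) $H(\tau_{-a}(\omega))=H(\omega)+a$ for all $a\in\mathbb{Z}$, $\omega\in\Omega$; (ii) $H$ is $\mathcal{T}$-measurable; (iii) $\nu(|H\circ\sigma^{x,s}|<\infty)=1$ for some $x\in V$ and $s\in\mathbb{Z}$ (equivalently for all). Given such $H$, on the $\nu$-full set where $|H\circ\sigma^{\rho,0}|<\infty$ put $G_H(\zeta)=\sigma^{x,s}(\zeta)-\lfloor H(\sigma^{x,s}(\zeta))\rfloor\in\Omega$ (subtraction of the same integer at each site); this does not depend on the choice of $x,s$. Set $\mu^H=\nu\circ G_H^{-1}$. Pinned averages. $H_r^{\rho,0}(\zeta)=\frac1{|W_r|}\sum_{v\in W_r}\sigma_v^{\rho,0}(\zeta)$ for $\zeta\in\Omega^\nabla$, and $H^{\rho,0}=\lim_{r\to\infty}H_r^{\rho,0}$ is its $\nu^{\bar\mu}$-a.s. limit, i.e. $H^{\rho,0}=H\circ\sigma^{\rho,0}$ a.s. $\Vert Q\Vert_1=\sum_{j\in\mathbb{Z}}Q(j)$. *)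

theory Defs
  imports "HOL-Probability.Probability" "HOL-Library.Z2"
begin

section \<open>The regular tree as a Cayley graph\<close>

text \<open>
  The free product of copies of the two-element group, one copy for each element of \<^typ>\<open>'g\<close>,
  is represented by its reduced words: lists without equal neighbouring letters.
  For \<open>CARD('g) = d + 1\<close> its Cayley graph is the tree in which every vertex has
  \<open>d + 1\<close> neighbours.
\<close>

typedef 'g vertex = "{w :: 'g list. distinct_adj w}"
  by (rule exI[of _ "[]"]) simp

setup_lifting type_definition_vertex

fun gen_act :: "'g \<Rightarrow> 'g list \<Rightarrow> 'g list" where
  "gen_act i [] = [i]"
| "gen_act i (j # w) = (if i = j then w else i # j # w)"

lemma distinct_adj_gen_act: "distinct_adj w \<Longrightarrow> distinct_adj (gen_act i w)"
  by (cases w; cases "tl w") auto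

lemma gen_act_invol: "distinct_adj w \<Longrightarrow> gen_act i (gen_act i w) = w"
  by (cases w; cases "tl w") auto

lemma distinct_adj_foldr: "distinct_adj w \<Longrightarrow> distinct_adj (foldr gen_act u w)"
  by (induction u) (auto intro: distinct_adj_gen_act)

lemma foldr_gen_act:
  assumes "distinct_adj w"
  shows "foldr gen_act (gen_act i x) w = gen_act i (foldr gen_act x w)"
proof (cases x)
  case (Cons j y)
  then show ?thesis
    using gen_act_invol[OF distinct_adj_foldr[OF assms]] by auto
qed simp

lemma foldr_gen_act_assoc:
  "distinct_adj w \<Longrightarrow>
   foldr gen_act (foldr gen_act u v) w = foldr gen_act u (foldr gen_act v w)"
  by (induction u) (simp_all add: foldr_gen_act)

lemma foldr_gen_act_Nil: "distinct_adj u \<Longrightarrow> foldr gen_act u [] = u"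
proof (induction u)
  case (Cons i u)
  then show ?case by (cases u) auto
qed simp

lemma foldr_gen_act_rev:
  "distinct_adj w \<Longrightarrow> foldr gen_act (rev u) (foldr gen_act u w) = w"
  by (induction u) (simp_all add: gen_act_invol distinct_adj_foldr)

instantiation vertex :: (type) "{monoid_mult, inverse}"
begin

lift_definition one_vertex :: "'a vertex" is "[]" by simp

lift_definition times_vertex :: "'a vertex \<Rightarrow> 'a vertex \<Rightarrow> 'a vertex" is
  "\<lambda>u v. foldr gen_act u v"
  by (rule distinct_adj_foldr)

lift_definition inverse_vertex :: "'a vertex \<Rightarrow> 'a vertex" is rev
  by simp

definition divide_vertex :: "'a vertex \<Rightarrow> 'a vertex \<Rightarrow> 'a vertex" where
  "divide_vertex u v = u * inverse v"

instance
proof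
  fix a b c :: "'a vertex"
  show "a * b * c = a * (b * c)"
    by transfer (rule foldr_gen_act_assoc)
  show "1 * a = a"
    by transfer simp
  show "a * 1 = a"
    by transfer (rule foldr_gen_act_Nil)
qed

end

lift_definition generator :: "'g \<Rightarrow> 'g vertex" is "\<lambda>i. [i]" by simp

lemma generator_square: "generator i * generator i = 1"
  by transfer simp

lemma vertex_left_inverse: "inverse u * u = (1 :: 'g vertex)"
  by transfer (metis foldr_gen_act_Nil foldr_gen_act_rev distinct_adj_Nil)

abbreviation root_vertex :: "'g vertex" where
  "root_vertex \<equiv> 1"

definition edges :: "('g vertex \<times> 'g vertex) set" where
  "edges = {(u, u * generator i) | u i. True}"

lemma edges_left_mult:
  assumes "(u, v) \<in> edges"
  shows "(x * u, x * v) \<in> edges"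
  using assms unfolding edges_def by (auto simp: mult.assoc)

lemma edges_sym:
  assumes "(u, v) \<in> edges"
  shows "(v, u) \<in> edges"
proof -
  obtain i where "v = u * generator i"
    using assms by (auto simp: edges_def)
  then have "u = v * generator i"
    by (simp add: mult.assoc generator_square)
  then show ?thesis
    unfolding edges_def by blast
qed

lemma card_neighbours: "card {v. (u, v) \<in> edges} = CARD('g)"
  for u :: "'g::finite vertex"
proof -
  have eq: "{v. (u, v) \<in> edges} = range (\<lambda>i. u * generator i)"
    by (auto simp: edges_def)
  have "inj (\<lambda>i. u * generator i)"
  proof (rule injI)
    fix i j assume "u * generator i = u * generator j"
    then have "inverse u * u * generator i = inverse u * u * generator j"
      by (simp add: mult.assoc)
    then have "generator i = generator j"
      by (simp add: vertex_left_inverse)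
    then show "i = j" by transfer simp
  qed
  then show ?thesis
    unfolding eq by (simp add: card_image)
qed

definition gdist :: "'g vertex \<Rightarrow> 'g vertex \<Rightarrow> nat" where
  "gdist x y = (LEAST n. (x, y) \<in> edges ^^ n)"

definition sphere_at :: "nat \<Rightarrow> 'g vertex set" where
  "sphere_at r = {v. gdist root_vertex v = r}"

definition outward_edges :: "('g vertex \<times> 'g vertex) set" where
  "outward_edges = {(x, y) \<in> edges. gdist root_vertex x < gdist root_vertex y}"

definition boundary :: "'g vertex set \<Rightarrow> 'g vertex set" where
  "boundary \<Lambda> = {x. x \<notin> \<Lambda> \<and> (\<exists>y\<in>\<Lambda>. (x, y) \<in> edges)}"

definition past :: "'g vertex \<Rightarrow> 'g vertex \<Rightarrow> 'g vertex set" where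
  "past u v = {w. gdist w u < gdist w v}"

definition self_avoiding_path :: "'g vertex \<Rightarrow> 'g vertex \<Rightarrow> 'g vertex list" where
  "self_avoiding_path x y =
     (THE p. p \<noteq> [] \<and> hd p = x \<and> last p = y \<and> distinct p \<and>
             successively (\<lambda>u v. (u, v) \<in> edges) p)"

definition path_edges :: "'g vertex \<Rightarrow> 'g vertex \<Rightarrow> ('g vertex \<times> 'g vertex) set" where
  "path_edges x y =
     set (zip (self_avoiding_path x y) (tl (self_avoiding_path x y)))"


section \<open>Configurations and Gibbs measures\<close>

text \<open>The spin type \<^typ>\<open>'s\<close> is \<^typ>\<open>int\<close> for heights and \<^typ>\<open>bit\<close> for the hidden Ising spins.\<close>

definition config_space :: "('g vertex \<Rightarrow> 's) measure" where
  "config_space = (\<Pi>\<^sub>M x\<in>UNIV. count_space UNIV)"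

definition coord_algebra :: "'g vertex set \<Rightarrow> ('g vertex \<Rightarrow> 's) measure" where
  "coord_algebra \<Lambda> = sigma UNIV {{\<omega>. \<omega> x \<in> A} | x A. x \<in> \<Lambda>}"

definition tail_sets :: "('g vertex \<Rightarrow> 's) set set" where
  "tail_sets = (\<Inter>\<Lambda>\<in>{\<Lambda>. finite \<Lambda>}. sets (coord_algebra (- \<Lambda>)))"

text \<open>
  In the first product every unoriented edge inside \<open>\<Lambda>\<close> is counted once, through its orientation
  away from the root; the choice is immaterial because \<open>Q\<close> is symmetric.
\<close>

definition gibbs_weight ::
  "('s::ab_group_add \<Rightarrow> real) \<Rightarrow> 'g vertex set \<Rightarrow>
   ('g vertex \<Rightarrow> 's) \<Rightarrow> ('g vertex \<Rightarrow> 's) \<Rightarrow> real" where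
  "gibbs_weight Q \<Lambda> \<omega> \<omega>' =
     (\<Prod>(x, y)\<in>{(x, y) \<in> outward_edges. x \<in> \<Lambda> \<and> y \<in> \<Lambda>}. Q (\<omega>' x - \<omega>' y)) *
     (\<Prod>(x, y)\<in>{(x, y) \<in> edges. x \<in> boundary \<Lambda> \<and> y \<in> \<Lambda>}. Q (\<omega> x - \<omega>' y))"

definition partition_function ::
  "('s::ab_group_add \<Rightarrow> real) \<Rightarrow> 'g vertex set \<Rightarrow> ('g vertex \<Rightarrow> 's) \<Rightarrow> real" where
  "partition_function Q \<Lambda> \<omega> = (\<Sum>\<^sub>\<infinity>\<omega>'\<in>(\<Pi>\<^sub>E x\<in>\<Lambda>. UNIV). gibbs_weight Q \<Lambda> \<omega> \<omega>')"

definition gibbs_kernel ::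
  "('s::ab_group_add \<Rightarrow> real) \<Rightarrow> 'g vertex set \<Rightarrow> ('g vertex \<Rightarrow> 's) \<Rightarrow>
   ('g vertex \<Rightarrow> 's) measure" where
  "gibbs_kernel Q \<Lambda> \<omega> =
     distr
       (density (count_space (\<Pi>\<^sub>E x\<in>\<Lambda>. UNIV))
          (\<lambda>\<omega>'. ennreal (gibbs_weight Q \<Lambda> \<omega> \<omega>' / partition_function Q \<Lambda> \<omega>)))
       config_space
       (\<lambda>\<omega>'. override_on \<omega> \<omega>' \<Lambda>)"

definition gibbs_measure ::
  "('s::ab_group_add \<Rightarrow> real) \<Rightarrow> ('g vertex \<Rightarrow> 's) measure \<Rightarrow> bool" where
  "gibbs_measure Q \<mu> \<longleftrightarrow>
     prob_space \<mu> \<and> sets \<mu> = sets config_space \<and>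
     (\<forall>\<Lambda>. finite \<Lambda> \<longrightarrow> (\<forall>A\<in>sets config_space.
        (\<integral>\<^sup>+\<omega>. emeasure (gibbs_kernel Q \<Lambda> \<omega>) A \<partial>\<mu>) = emeasure \<mu> A))"

definition extreme_gibbs_measure ::
  "('s::ab_group_add \<Rightarrow> real) \<Rightarrow> ('g vertex \<Rightarrow> 's) measure \<Rightarrow> bool" where
  "extreme_gibbs_measure Q \<mu> \<longleftrightarrow>
     gibbs_measure Q \<mu> \<and>
     (\<forall>\<mu>\<^sub>1 \<mu>\<^sub>2 t. gibbs_measure Q \<mu>\<^sub>1 \<and> gibbs_measure Q \<mu>\<^sub>2 \<and> 0 < t \<and> t < 1 \<and>
        (\<forall>A\<in>sets config_space. measure \<mu> A = t * measure \<mu>\<^sub>1 A + (1 - t) * measure \<mu>\<^sub>2 A)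
        \<longrightarrow> \<mu>\<^sub>1 = \<mu> \<and> \<mu>\<^sub>2 = \<mu>)"

definition translate :: "'g vertex \<Rightarrow> ('g vertex \<Rightarrow> 's) \<Rightarrow> ('g vertex \<Rightarrow> 's)" where
  "translate v \<omega> = (\<lambda>u. \<omega> (inverse v * u))"

definition translation_invariant :: "('g vertex \<Rightarrow> 's) measure \<Rightarrow> bool" where
  "translation_invariant \<mu> \<longleftrightarrow> (\<forall>v. distr \<mu> config_space (translate v) = \<mu>)"


section \<open>The hidden Ising model and the height-period-2 gradient measure\<close>

definition fuzzy :: "(int \<Rightarrow> real) \<Rightarrow> bit \<Rightarrow> real" where
  "fuzzy Q a = (if a = 0 then (\<Sum>\<^sub>\<infinity>l. Q (2 * l)) else (\<Sum>\<^sub>\<infinity>l. Q (1 + 2 * l)))"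

definition tree_markov_chain :: "('g vertex \<Rightarrow> 's) measure \<Rightarrow> bool" where
  "tree_markov_chain \<mu> \<longleftrightarrow>
     (\<forall>(u, v)\<in>edges. \<forall>a. AE \<omega> in \<mu>.
        real_cond_exp \<mu> (coord_algebra (past u v)) (indicator {\<omega>. \<omega> v = a}) \<omega> =
        real_cond_exp \<mu> (coord_algebra {u}) (indicator {\<omega>. \<omega> v = a}) \<omega>)"

definition gradient_space :: "('g vertex \<times> 'g vertex \<Rightarrow> int) measure" where
  "gradient_space =
     restrict_space (\<Pi>\<^sub>M b\<in>edges. count_space UNIV)
       {\<zeta>. \<forall>(u, v)\<in>edges. \<zeta> (u, v) = - \<zeta> (v, u)}"

text \<open>Residue classes modulo 2 are \<^typ>\<open>bit\<close>; the class of an integer \<open>s\<close> is \<open>of_int s\<close>.\<close>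

definition step_law :: "(int \<Rightarrow> real) \<Rightarrow> bit \<Rightarrow> int measure" where
  "step_law Q a =
     density (count_space UNIV) (\<lambda>s. ennreal (indicator {s. of_int s = a} s * Q s / fuzzy Q a))"

definition antisym_extension ::
  "('g vertex \<times> 'g vertex \<Rightarrow> int) \<Rightarrow> ('g vertex \<times> 'g vertex \<Rightarrow> int)" where
  "antisym_extension \<xi> =
     (\<lambda>(u, v)\<in>edges. if (u, v) \<in> outward_edges then \<xi> (u, v) else - \<xi> (v, u))"

definition gradient_kernel ::
  "(int \<Rightarrow> real) \<Rightarrow> ('g vertex \<Rightarrow> bit) \<Rightarrow> ('g vertex \<times> 'g vertex \<Rightarrow> int) measure" where
  "gradient_kernel Q \<sigma> =
     distr (\<Pi>\<^sub>M (x, y)\<in>outward_edges. step_law Q (\<sigma> y - \<sigma> x)) gradient_space antisym_extension"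

definition joint_measure ::
  "(int \<Rightarrow> real) \<Rightarrow> ('g vertex \<Rightarrow> bit) measure \<Rightarrow>
   (('g vertex \<Rightarrow> bit) \<times> ('g vertex \<times> 'g vertex \<Rightarrow> int)) measure" where
  "joint_measure Q \<mu> =
     \<mu> \<bind> (\<lambda>\<sigma>. distr (gradient_kernel Q \<sigma>) (config_space \<Otimes>\<^sub>M gradient_space) (Pair \<sigma>))"

definition gradient_measure ::
  "(int \<Rightarrow> real) \<Rightarrow> ('g vertex \<Rightarrow> bit) measure \<Rightarrow> ('g vertex \<times> 'g vertex \<Rightarrow> int) measure" where
  "gradient_measure Q \<mu> = distr (joint_measure Q \<mu>) gradient_space snd"


section \<open>Height-offset variables\<close>

definition pinned_height ::
  "'g vertex \<Rightarrow> int \<Rightarrow> ('g vertex \<times> 'g vertex \<Rightarrow> int) \<Rightarrow> ('g vertex \<Rightarrow> int)" where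
  "pinned_height x s \<zeta> = (\<lambda>v. s + (\<Sum>b\<in>path_edges x v. \<zeta> b))"

definition shift_height :: "int \<Rightarrow> ('g vertex \<Rightarrow> int) \<Rightarrow> ('g vertex \<Rightarrow> int)" where
  "shift_height a \<omega> = (\<lambda>x. \<omega> x - a)"

definition height_offset_variable ::
  "('g vertex \<times> 'g vertex \<Rightarrow> int) measure \<Rightarrow> (('g vertex \<Rightarrow> int) \<Rightarrow> ereal) \<Rightarrow> bool" where
  "height_offset_variable \<nu> H \<longleftrightarrow>
     (\<forall>a \<omega>. H (shift_height (- a) \<omega>) = H \<omega> + ereal (of_int a)) \<and>
     H \<in> borel_measurable (sigma UNIV tail_sets) \<and>
     (\<exists>x s. AE \<zeta> in \<nu>. \<bar>H (pinned_height x s \<zeta>)\<bar> < \<infinity>)"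

text \<open>
  Where \<open>H\<close> is finite the value of \<open>offset_map H\<close> does not depend on the pinning at height 0 in the
  root. Where \<open>H\<close> is infinite, \<^const>\<open>real_of_ereal\<close> makes it the pinned configuration itself;
  this is a null set for a height-offset variable.
\<close>

definition offset_map ::
  "(('g vertex \<Rightarrow> int) \<Rightarrow> ereal) \<Rightarrow> ('g vertex \<times> 'g vertex \<Rightarrow> int) \<Rightarrow> ('g vertex \<Rightarrow> int)" where
  "offset_map H \<zeta> =
     (\<lambda>v. pinned_height root_vertex 0 \<zeta> v - \<lfloor>real_of_ereal (H (pinned_height root_vertex 0 \<zeta>))\<rfloor>)"

definition offset_measure ::
  "('g vertex \<times> 'g vertex \<Rightarrow> int) measure \<Rightarrow> (('g vertex \<Rightarrow> int) \<Rightarrow> ereal) \<Rightarrow>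
   ('g vertex \<Rightarrow> int) measure" where
  "offset_measure \<nu> H = distr \<nu> config_space (offset_map H)"

definition avg_height :: "nat \<Rightarrow> ('g vertex \<Rightarrow> int) \<Rightarrow> real" where
  "avg_height r \<omega> = (\<Sum>v\<in>sphere_at r. real_of_int (\<omega> v)) / real (card (sphere_at r :: 'g vertex set))"

definition avg_offset :: "('g vertex \<Rightarrow> int) \<Rightarrow> ereal" where
  "avg_offset \<omega> =
     (if convergent (\<lambda>r. ereal (avg_height r \<omega>)) then lim (\<lambda>r. ereal (avg_height r \<omega>))
      else limsup (\<lambda>r. ereal (avg_height r \<omega>)))"

definition pinned_avg_limit :: "('g vertex \<times> 'g vertex \<Rightarrow> int) \<Rightarrow> real" where
  "pinned_avg_limit \<zeta> = lim (\<lambda>r. avg_height r (pinned_height root_vertex 0 \<zeta>))"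

end

theory Submission imports Defs begin

text \<open>
  Given the hidden Ising spins, the increments along the outward edges are independent, symmetric and
  square integrable. Hence the level averages of the increments, whose partial sums are the pinned
  averages, have geometrically decaying second moments, so the averages converge almost surely and in
  \<open>L\<^sup>2\<close>. A level of \<open>n\<close> edges contributes a factor \<open>q ^ n\<close> with \<open>q < 1\<close> to the characteristic
  function of the limit at frequencies comparable to \<open>n\<close>. It therefore decreases rapidly, uniformly
  in the spins, and yields a smooth density; splitting off a single edge shows that the density has no
  zero. The exponential moments of the limit are controlled by \<open>edge_weight\<close>, which is at most
  \<open>1 / (d + 1)\<close>.

  Placing counting measure on the height of the root turns the gradient measure into a sigma-finite
  measure on configurations that solves the DLR equations: on cylinders it is the Gibbs weight times a
  factor coming from the hidden spins outside the region. The offset measure is this infinite measure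
  conditioned on the tail event \<open>0 \<le> H < 1\<close>, so it is a Gibbs measure, and splitting the event at
  \<open>1/2\<close> writes it as a nontrivial mixture. It is not translation invariant because raising the heights
  on one subtree of the root moves the averages around the root and around its neighbour by different
  amounts.
\<close>

section \<open>Depth and parents\<close>

text \<open>The offset map subtracts an integer that depends on the whole configuration, so the DLR
  equations of its image cannot be checked directly on finite sets. The infinite height measure
  avoids this: its cylinder masses are explicit, and normalising it means conditioning on a tail
  event, which every Gibbs kernel respects. An increment field fixes the hidden spins only up to a
  global flip, hence the two terms in those masses.

  The hidden measure is arbitrary, so estimates on increments are made for fixed spins, with
  constants that do not depend on them, and are integrated afterwards.

  In the Fourier bounds, successive spheres grow by the factor \<open>d\<close>: on a suitable level
  a large frequency becomes, for every edge, a parameter between \<open>1/d\<close> and 1. This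
  keeps away from 0 and pi, where the step characteristic functions have modulus 1. Steps are
  confined to parity classes, so increments may only be altered by even amounts; this is the origin
  of the factors 2 in the positivity proof and in the proof that translation invariance
  fails.\<close>

lemma foldr_gen_act_singleton:
  assumes "distinct_adj u"
  shows "foldr gen_act u [i] = (if u \<noteq> [] \<and> last u = i then butlast u else u @ [i])"
  using assms
proof (induction u)
  case (Cons j u)
  then show ?case by (cases u; cases "tl u") auto
qed simp

text \<open>\<open>gen_act\<close> acts at the left end of a word, whereas the neighbours of
  \<open>u\<close> are \<open>u * generator i\<close>. For a reduced word, right multiplication
  touches only the last letter: it cancels it or appends a new one.\<close>

lemma Rep_vertex_times_generator:
  "Rep_vertex (u * generator i) =
     (if Rep_vertex u \<noteq> [] \<and> last (Rep_vertex u) = i then butlast (Rep_vertex u)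
      else Rep_vertex u @ [i])"
  using Rep_vertex[of u] unfolding times_vertex.rep_eq generator.rep_eq
  by (simp add: foldr_gen_act_singleton)

text \<open>Word length gives a recursion along the tree; \<open>gdist_root\<close> identifies it
  with the distance from the root.\<close>

definition depth :: "'g vertex \<Rightarrow> nat" where
  "depth v = length (Rep_vertex v)"

text \<open>Since \<open>butlast [] = []\<close>, the root is its own parent; hence the recurring
  side condition \<open>v \<noteq> 1\<close>.\<close>

definition parent :: "'g vertex \<Rightarrow> 'g vertex" where
  "parent v = Abs_vertex (butlast (Rep_vertex v))"

lemma Rep_vertex_parent: "Rep_vertex (parent v) = butlast (Rep_vertex v)"
proof -
  have "distinct_adj (butlast (Rep_vertex v))"
    using Rep_vertex[of v] by (cases "Rep_vertex v" rule: rev_cases) (auto simp: distinct_adj_append_iff)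
  then show ?thesis
    unfolding parent_def by (simp add: Abs_vertex_inverse)
qed

lemma Rep_vertex_eq_Nil_iff: "Rep_vertex v = [] \<longleftrightarrow> v = 1"
  by (metis Rep_vertex_inject one_vertex.rep_eq)

lemma depth_one [simp]: "depth 1 = 0"
  by (simp add: depth_def one_vertex.rep_eq)

lemma depth_eq_0_iff [simp]: "depth v = 0 \<longleftrightarrow> v = 1"
  by (simp add: depth_def Rep_vertex_eq_Nil_iff)

lemma depth_parent: "v \<noteq> 1 \<Longrightarrow> Suc (depth (parent v)) = depth v"
  by (simp add: depth_def Rep_vertex_parent flip: Rep_vertex_eq_Nil_iff)

lemma times_generator_cases:
  obtains "u \<noteq> 1" "u * generator i = parent u" "last (Rep_vertex u) = i"
  | "u * generator i \<noteq> 1" "parent (u * generator i) = u" "Rep_vertex (u * generator i) = Rep_vertex u @ [i]"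
      "u = 1 \<or> last (Rep_vertex u) \<noteq> i"
proof (cases "Rep_vertex u \<noteq> [] \<and> last (Rep_vertex u) = i")
  case True
  then have "Rep_vertex (u * generator i) = Rep_vertex (parent u)"
    by (simp add: Rep_vertex_times_generator Rep_vertex_parent)
  with True that(1) show ?thesis
    by (simp add: Rep_vertex_inject Rep_vertex_eq_Nil_iff)
next
  case False
  then have *: "Rep_vertex (u * generator i) = Rep_vertex u @ [i]"
    by (auto simp add: Rep_vertex_times_generator)
  moreover from * have "u * generator i \<noteq> 1"
    by (metis Rep_vertex_eq_Nil_iff snoc_eq_iff_butlast)
  moreover from * have "parent (u * generator i) = u"
    by (metis Rep_vertex_inject Rep_vertex_parent butlast_snoc)
  ultimately show ?thesis using that(2) False by (auto simp: Rep_vertex_eq_Nil_iff)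
qed

lemma parent_times_last:
  assumes "v \<noteq> 1"
  shows "parent v * generator (last (Rep_vertex v)) = v"
proof -
  let ?w = "Rep_vertex v"
  from assms have ne: "?w \<noteq> []" by (simp add: Rep_vertex_eq_Nil_iff)
  have "distinct_adj (butlast ?w @ [last ?w])"
    using Rep_vertex[of v] ne by simp
  then have "butlast ?w = [] \<or> last (butlast ?w) \<noteq> last ?w"
    by (auto simp: distinct_adj_append_iff)
  then have "Rep_vertex (parent v * generator (last ?w)) = ?w"
    using ne by (auto simp: Rep_vertex_times_generator Rep_vertex_parent)
  then show ?thesis by (simp add: Rep_vertex_inject)
qed

lemma parent_edge: "v \<noteq> 1 \<Longrightarrow> (parent v, v) \<in> edges"
  unfolding edges_def using parent_times_last[of v] by (smt (verit) mem_Collect_eq)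

text \<open>This passes from the Cayley graph to the rooted tree; adjacency is used in this form
  from here on.\<close>

lemma edges_iff: "(u, v) \<in> edges \<longleftrightarrow> v \<noteq> 1 \<and> u = parent v \<or> u \<noteq> 1 \<and> v = parent u"
proof
  assume "(u, v) \<in> edges"
  then obtain i where "v = u * generator i" by (auto simp: edges_def)
  then show "v \<noteq> 1 \<and> u = parent v \<or> u \<noteq> 1 \<and> v = parent u"
    by (cases rule: times_generator_cases[of u i]) auto
qed (auto intro: parent_edge edges_sym)

lemma depth_relpow: "(1, v) \<in> edges ^^ n \<Longrightarrow> depth v \<le> n"
proof (induction n arbitrary: v)
  case (Suc n)
  then obtain u where "(1, u) \<in> edges ^^ n" "(u, v) \<in> edges" by auto
  then show ?case
    using Suc.IH[of u] depth_parent[of v] depth_parent[of u] unfolding edges_iff by auto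
qed simp

lemma relpow_depth: "(1, v) \<in> edges ^^ depth v"
proof (induction "depth v" arbitrary: v)
  case (Suc n)
  then have "v \<noteq> 1" by auto
  then have *: "Suc (depth (parent v)) = depth v" by (rule depth_parent)
  with Suc have "(1, parent v) \<in> edges ^^ depth (parent v)" by auto
  with \<open>v \<noteq> 1\<close> show ?case
    unfolding *[symmetric] by (auto intro: parent_edge)
qed auto

lemma gdist_root [simp]: "gdist 1 v = depth v"
  unfolding gdist_def by (rule Least_equality) (auto intro: relpow_depth depth_relpow)

lemma outward_edges_iff: "(x, y) \<in> outward_edges \<longleftrightarrow> y \<noteq> 1 \<and> x = parent y"
  unfolding outward_edges_def edges_iff
  using depth_parent[of x] depth_parent[of y] by auto

lemma outward_edges_eq: "outward_edges = (\<lambda>y. (parent y, y)) ` (- {1})"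
  by (auto simp: outward_edges_iff image_iff)

lemma edges_orient: "(x, y) \<in> edges \<longleftrightarrow> (x, y) \<in> outward_edges \<or> (y, x) \<in> outward_edges"
  by (auto simp: edges_iff outward_edges_iff)

lemma outward_edges_antisym: "(x, y) \<in> outward_edges \<Longrightarrow> (y, x) \<notin> outward_edges"
  by (auto simp: outward_edges_def)

lemma sphere_at_eq: "sphere_at r = {v. depth v = r}"
  by (simp add: sphere_at_def)

lemma finite_depth_le: "finite {v :: 'g::finite vertex. depth v \<le> n}"
proof -
  have "finite {w :: 'g list. set w \<subseteq> UNIV \<and> length w \<le> n}"
    by (rule finite_lists_length_le) simp
  then have "finite (Rep_vertex -` {w :: 'g list. length w \<le> n})"
    by (intro finite_vimageI) (auto intro: injI simp: Rep_vertex_inject)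
  then show ?thesis by (simp add: depth_def vimage_def)
qed

lemma finite_sphere_at [simp]: "finite (sphere_at r :: 'g::finite vertex set)"
  by (rule finite_subset[OF _ finite_depth_le[of r]]) (auto simp: sphere_at_eq)

lemma finite_subset_ball:
  assumes "finite (S :: 'g::finite vertex set)"
  obtains n where "S \<subseteq> {v. depth v \<le> n}"
proof -
  have "S \<subseteq> {v. depth v \<le> Max (depth ` S)}" using assms by auto
  then show ?thesis by (rule that)
qed

section \<open>Children and the sizes of spheres\<close>

definition children :: "'g vertex \<Rightarrow> 'g vertex set" where
  "children x = {y. y \<noteq> 1 \<and> parent y = x}"

lemma children_eq:
  "children x = (\<lambda>i. x * generator i) ` {i. x = 1 \<or> last (Rep_vertex x) \<noteq> i}" (is "_ = ?R")
proof (intro equalityI subsetI)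
  fix y assume "y \<in> children x"
  then have y: "y \<noteq> 1" "parent y = x" by (auto simp: children_def)
  then have "y = x * generator (last (Rep_vertex y))" using parent_times_last[of y] by simp
  moreover have "x = 1 \<or> last (Rep_vertex x) \<noteq> last (Rep_vertex y)"
  proof (rule ccontr)
    assume *: "\<not> ?thesis"
    then have "y = parent x"
      using times_generator_cases[of x "last (Rep_vertex y)"] calculation by metis
    with y * show False using depth_parent[of x] depth_parent[of y] by auto
  qed
  ultimately show "y \<in> ?R" by blast
next
  fix y assume "y \<in> ?R"
  then obtain i where "y = x * generator i" "x = 1 \<or> last (Rep_vertex x) \<noteq> i" by auto
  then show "y \<in> children x"
    using times_generator_cases[of x i] unfolding children_def by (smt (verit) mem_Collect_eq)
qed

lemma inj_times_generator: "inj (\<lambda>i. u * generator i)"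
proof (rule injI)
  fix i j assume "u * generator i = u * generator j"
  then have "inverse u * u * generator i = inverse u * u * generator j"
    by (simp add: mult.assoc)
  then have "generator i = generator j" by (simp add: vertex_left_inverse)
  then show "i = j" by transfer simp
qed

lemma card_children:
  "card (children x) = (if x = 1 then CARD('g) else CARD('g) - 1)" for x :: "'g::finite vertex"
proof -
  have "card (children x) = card {i. x = 1 \<or> last (Rep_vertex x) \<noteq> i}"
    unfolding children_eq using inj_times_generator by (intro card_image) (auto intro: inj_on_subset)
  moreover have "{i. last (Rep_vertex x) \<noteq> i} = - {last (Rep_vertex x)}" by auto
  ultimately show ?thesis by (auto simp: Compl_eq_Diff_UNIV)
qed

text \<open>Group the vertices by their parent. Constant \<open>F\<close> counts spheres; heights as
  \<open>F\<close> give the recursion \<open>avg_height_Suc\<close>.\<close>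

lemma sum_over_children:
  fixes F :: "'g::finite vertex \<Rightarrow> real"
  assumes "finite S"
  shows "(\<Sum>y | y \<noteq> 1 \<and> parent y \<in> S. F (parent y)) = (\<Sum>x\<in>S. real (card (children x)) * F x)"
proof -
  obtain n where n: "S \<subseteq> {v. depth v \<le> n}" using finite_subset_ball[OF assms] .
  have "{y. y \<noteq> 1 \<and> parent y \<in> S} \<subseteq> {v. depth v \<le> Suc n}"
  proof
    fix y assume y: "y \<in> {y. y \<noteq> 1 \<and> parent y \<in> S}"
    then have "depth (parent y) \<le> n" using n by auto
    with y show "y \<in> {v. depth v \<le> Suc n}" using depth_parent[of y] by auto
  qed
  then have fin: "finite {y. y \<noteq> 1 \<and> parent y \<in> S}" by (rule finite_subset) (rule finite_depth_le)
  have "(\<Sum>y | y \<noteq> 1 \<and> parent y \<in> S. F (parent y)) =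
        (\<Sum>x\<in>S. \<Sum>y | y \<in> {y. y \<noteq> 1 \<and> parent y \<in> S} \<and> parent y = x. F (parent y))"
    by (rule sum.group[symmetric]) (use fin assms in auto)
  also have "\<dots> = (\<Sum>x\<in>S. \<Sum>y\<in>children x. F x)"
    by (intro sum.cong) (auto simp: children_def)
  finally show ?thesis by simp
qed

lemma sphere_at_Suc: "sphere_at (Suc r) = {y. y \<noteq> 1 \<and> parent y \<in> sphere_at r}"
  unfolding sphere_at_eq
proof (intro Collect_cong iffI)
  fix v :: "'g vertex" assume "depth v = Suc r"
  then have "v \<noteq> 1" by auto
  with \<open>depth v = Suc r\<close> show "v \<noteq> 1 \<and> parent v \<in> {v. depth v = r}" using depth_parent[of v] by auto
qed (use depth_parent in fastforce)

lemma sphere_at_0 [simp]: "sphere_at 0 = {1}"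
  by (auto simp: sphere_at_eq)

lemma card_children_sphere:
  fixes x :: "'g::finite vertex"
  assumes "x \<in> sphere_at r"
  shows "card (children x) = (if r = 0 then CARD('g) else CARD('g) - 1)"
  using assms by (auto simp: card_children sphere_at_eq)

lemma card_sphere_at:
  "card (sphere_at (Suc r) :: 'g::finite vertex set) = CARD('g) * (CARD('g) - 1) ^ r"
proof (induction r)
  case 0
  have "sphere_at (Suc 0) = children (1 :: 'g vertex)"
    by (simp add: sphere_at_Suc children_def)
  then show ?case by (simp add: card_children)
next
  case (Suc r)
  have "real (card (sphere_at (Suc (Suc r)) :: 'g vertex set)) =
        (\<Sum>x\<in>(sphere_at (Suc r) :: 'g vertex set). real (card (children x)))"
    using sum_over_children[of "sphere_at (Suc r) :: 'g vertex set" "\<lambda>_. 1"]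
    by (simp add: sphere_at_Suc[of "Suc r"])
  also have "\<dots> = real (card (sphere_at (Suc r) :: 'g vertex set) * (CARD('g) - 1))"
    by (simp add: card_children_sphere)
  finally have "card (sphere_at (Suc (Suc r)) :: 'g vertex set) =
    card (sphere_at (Suc r) :: 'g vertex set) * (CARD('g) - 1)"
    using of_nat_eq_iff by blast
  then show ?case unfolding Suc.IH by simp
qed

section \<open>Heights along the path from the root\<close>

text \<open>The predicate under \<open>THE\<close> in \<open>self_avoiding_path\<close>, for paths
  that start at the root.\<close>

definition sap :: "'g vertex list \<Rightarrow> 'g vertex \<Rightarrow> bool" where
  "sap p v \<longleftrightarrow> p \<noteq> [] \<and> hd p = 1 \<and> last p = v \<and> distinct p \<and>
     successively (\<lambda>u v. (u, v) \<in> edges) p"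

text \<open>A last step into \<open>v\<close> from one of its children is impossible: by induction
  the path to that child came through its parent, which is \<open>v\<close>, so \<open>v\<close>
  would be visited twice.\<close>

lemma sap_last_step:
  assumes "sap p v"
  shows "v = 1 \<and> p = [1] \<or> v \<noteq> 1 \<and> (\<exists>q. p = q @ [v] \<and> v \<notin> set q \<and> sap q (parent v))"
  using assms
proof (induction p arbitrary: v rule: rev_induct)
  case (snoc y q)
  then have y: "y = v" by (simp add: sap_def)
  show ?case
  proof (cases "q = []")
    case True
    with snoc.prems y show ?thesis by (simp add: sap_def)
  next
    case False
    have q: "sap q (last q)" "(last q, v) \<in> edges" "v \<notin> set q"
      using snoc.prems False y by (auto simp: sap_def successively_append_iff)
    have "1 \<in> set q" using q(1) hd_in_set[OF False] by (simp add: sap_def)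
    then have "v \<noteq> 1" using q(3) by auto
    have "last q = parent v"
    proof (rule ccontr)
      assume "last q \<noteq> parent v"
      then have 1: "last q \<noteq> 1" "v = parent (last q)" using q(2) by (auto simp: edges_iff)
      with snoc.IH[OF q(1)] obtain q' where "q = q' @ [last q]" "sap q' (parent (last q))" by auto
      then have "v \<in> set q" using 1 by (metis UnCI last_in_set sap_def set_append)
      with q(3) show False by simp
    qed
    then show ?thesis using q y \<open>v \<noteq> 1\<close> by auto
  qed
qed (simp add: sap_def)

lemma sap_unique: "sap p v \<Longrightarrow> sap q v \<Longrightarrow> p = q"
proof (induction p arbitrary: v q rule: rev_induct)
  case (snoc y p)
  show ?case
    using sap_last_step[OF snoc.prems(1)] sap_last_step[OF snoc.prems(2)] snoc.IH by auto
qed (simp add: sap_def)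

lemma sap_one: "sap [1] 1"
  by (simp add: sap_def)

text \<open>The depth bound is carried along because \<open>v\<close>, being deeper than every
  vertex on the path to \<open>parent v\<close>, can then be appended without repetition.\<close>

lemma sap_exists: "\<exists>p. sap p v \<and> (\<forall>u\<in>set p. depth u \<le> depth v)"
proof (induction "depth v" arbitrary: v)
  case 0
  then show ?case by (intro exI[of _ "[1]"]) (auto simp: sap_one)
next
  case (Suc n)
  then have v: "v \<noteq> 1" by auto
  then have *: "Suc (depth (parent v)) = depth v" by (rule depth_parent)
  with Suc obtain p where p: "sap p (parent v)" "\<forall>u\<in>set p. depth u \<le> depth (parent v)"
    by (metis nat.inject)
  have "v \<notin> set p" using p(2) * by auto
  then have "sap (p @ [v]) v"
    using p(1) parent_edge[OF v] by (auto simp: sap_def successively_append_iff)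
  then show ?case using p(2) * by (intro exI[of _ "p @ [v]"]) auto
qed

lemma self_avoiding_path_root: "sap p v \<Longrightarrow> self_avoiding_path 1 v = p"
  unfolding self_avoiding_path_def sap_def[symmetric] conj_assoc[symmetric]
  by (rule the_equality) (auto simp: sap_def intro: sap_unique[of _ v, unfolded sap_def])

lemma set_zip_tl_snoc:
  "q \<noteq> [] \<Longrightarrow> set (zip (q @ [v]) (tl (q @ [v]))) = insert (last q, v) (set (zip q (tl q)))"
proof (induction q)
  case (Cons a q)
  then show ?case by (cases q) auto
qed simp

lemma path_edges_root: "path_edges 1 1 = {}"
  by (simp add: path_edges_def self_avoiding_path_root[OF sap_one])

lemma finite_path_edges: "finite (path_edges x v)"
  by (simp add: path_edges_def)

lemma path_edges_parent:
  assumes "v \<noteq> 1"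
  shows "path_edges 1 v = insert (parent v, v) (path_edges 1 (parent v))"
    and "(parent v, v) \<notin> path_edges 1 (parent v)"
proof -
  obtain p where p: "sap p v" using sap_exists by auto
  from sap_last_step[OF p] assms obtain q where q: "p = q @ [v]" "v \<notin> set q" "sap q (parent v)"
    by auto
  have "last q = parent v" "q \<noteq> []" using q(3) by (auto simp: sap_def)
  then show "path_edges 1 v = insert (parent v, v) (path_edges 1 (parent v))"
    unfolding path_edges_def self_avoiding_path_root[OF p] self_avoiding_path_root[OF q(3)] q(1)
    using set_zip_tl_snoc by metis
  show "(parent v, v) \<notin> path_edges 1 (parent v)"
    unfolding path_edges_def self_avoiding_path_root[OF q(3)]
    using q(2) by (auto dest!: set_zip_rightD list.set_sel(2)[OF \<open>q \<noteq> []\<close>])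
qed

lemma pinned_height_root [simp]: "pinned_height 1 s \<zeta> 1 = s"
  by (simp add: pinned_height_def path_edges_root)

text \<open>Through this recursion and \<open>pinned_height_shift\<close>, heights pinned at the
  root are handled without further mention of paths.\<close>

lemma pinned_height_parent:
  "v \<noteq> 1 \<Longrightarrow> pinned_height 1 s \<zeta> v = pinned_height 1 s \<zeta> (parent v) + \<zeta> (parent v, v)"
  by (simp add: pinned_height_def path_edges_parent finite_path_edges)

lemma vertex_induct [case_names root step]:
  assumes "P 1" "\<And>v. v \<noteq> 1 \<Longrightarrow> P (parent v) \<Longrightarrow> P v"
  shows "P v"
proof (induction "depth v" arbitrary: v)
  case (Suc n)
  then have "v \<noteq> 1" by auto
  with Suc depth_parent[of v] show ?case by (auto intro: assms(2))
qed (auto intro: assms(1))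

lemma pinned_height_shift: "pinned_height 1 s \<zeta> v = s + pinned_height 1 0 \<zeta> v"
  by (simp add: pinned_height_def)

definition edge_average :: "nat \<Rightarrow> ('g vertex \<times> 'g vertex \<Rightarrow> int) \<Rightarrow> real" where
  "edge_average r \<xi> = (\<Sum>y\<in>sphere_at r. real_of_int (\<xi> (parent y, y))) / real (card (sphere_at r :: 'g vertex set))"

text \<open>All vertices of one sphere have the same number of children, so averaging the parents'
  heights over the next sphere reproduces the previous average. This includes the root, whose number
  of children is different; \<open>k\<close> covers both cases.\<close>

lemma avg_height_Suc:
  fixes \<zeta> :: "'g::finite vertex \<times> 'g vertex \<Rightarrow> int"
  assumes "CARD('g) > 1"
  shows "avg_height (Suc r) (pinned_height 1 s \<zeta>) =
         avg_height r (pinned_height 1 s \<zeta>) + edge_average (Suc r) \<zeta>"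
proof -
  let ?h = "\<lambda>v. real_of_int (pinned_height 1 s \<zeta> v)"
  define k where "k = (if r = 0 then CARD('g) else CARD('g) - 1)"
  let ?S = "\<lambda>r. sphere_at r :: 'g vertex set"
  have k: "k > 0" using assms by (simp add: k_def)
  have sum_parent: "(\<Sum>y\<in>?S (Suc r). F (parent y)) = k * (\<Sum>x\<in>?S r. F x)" for F :: "'g vertex \<Rightarrow> real"
    unfolding sphere_at_Suc
    by (subst sum_over_children) (simp_all add: card_children_sphere k_def sum_distrib_left)
  from sum_parent[of "\<lambda>_. 1"] have card: "real (card (?S (Suc r))) = real k * real (card (?S r))" by simp
  have "(\<Sum>y\<in>?S (Suc r). ?h y) = (\<Sum>y\<in>?S (Suc r). ?h (parent y) + real_of_int (\<zeta> (parent y, y)))"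
    by (intro sum.cong) (auto simp: pinned_height_parent sphere_at_Suc)
  also have "\<dots> = k * (\<Sum>x\<in>?S r. ?h x) + (\<Sum>y\<in>?S (Suc r). real_of_int (\<zeta> (parent y, y)))"
    by (simp add: sum.distrib sum_parent[of ?h])
  finally have "(\<Sum>y\<in>?S (Suc r). ?h y) =
    k * (\<Sum>x\<in>?S r. ?h x) + (\<Sum>y\<in>?S (Suc r). real_of_int (\<zeta> (parent y, y)))" .
  then show ?thesis
    using k unfolding avg_height_def edge_average_def card
    by (simp add: add_divide_distrib)
qed

lemma avg_height_pinned:
  fixes \<zeta> :: "'g::finite vertex \<times> 'g vertex \<Rightarrow> int"
  assumes "CARD('g) > 1"
  shows "avg_height r (pinned_height 1 s \<zeta>) = s + (\<Sum>k<r. edge_average (Suc k) \<zeta>)"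
  by (induction r) (auto simp: avg_height_Suc[OF assms], simp add: avg_height_def)

section \<open>Densities from rapidly decreasing characteristic functions\<close>

definition rapidly_decreasing :: "(real \<Rightarrow> complex) \<Rightarrow> bool" where
  "rapidly_decreasing \<phi> \<longleftrightarrow>
     \<phi> \<in> borel_measurable borel \<and> (\<forall>n::nat. \<exists>K. \<forall>t. \<bar>t\<bar> ^ n * cmod (\<phi> t) \<le> K)"

text \<open>The real part of the inverse Fourier integral of
  \<open>exp (- i t x) * \<phi> t\<close>, divided by \<open>2 * pi\<close>; the result is real by
  construction.\<close>

definition inv_fourier :: "(real \<Rightarrow> complex) \<Rightarrow> real \<Rightarrow> real" where
  "inv_fourier \<phi> x = (\<integral>t. (cos (t * x) * Re (\<phi> t) + sin (t * x) * Im (\<phi> t)) \<partial>lborel) / (2 * pi)"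

lemma integrable_inverse_1_plus_square': "integrable lborel (\<lambda>x::real. inverse (1 + x\<^sup>2))"
  using integrable_inverse_1_plus_square
  by (simp add: set_integrable_def einterval_def)

lemma rapidly_decreasing_measurable [measurable_dest]:
  "rapidly_decreasing \<phi> \<Longrightarrow> \<phi> \<in> borel_measurable borel"
  by (simp add: rapidly_decreasing_def)

lemma rapidly_decreasing_integrable:
  assumes "rapidly_decreasing \<phi>"
  shows "integrable lborel \<phi>"
proof -
  have [measurable]: "\<phi> \<in> borel_measurable borel" using assms by measurable
  obtain K where K: "\<And>t. \<bar>t\<bar> ^ 0 * cmod (\<phi> t) \<le> K"
    using assms unfolding rapidly_decreasing_def by blast
  obtain L where L: "\<And>t. \<bar>t\<bar> ^ 2 * cmod (\<phi> t) \<le> L"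
    using assms unfolding rapidly_decreasing_def by blast
  have "integrable lborel (\<lambda>t::real. (K + L) * inverse (1 + t\<^sup>2))"
    using integrable_inverse_1_plus_square' by simp
  then show ?thesis
  proof (rule Bochner_Integration.integrable_bound)
    show "AE t in lborel. norm (\<phi> t) \<le> norm ((K + L) * inverse (1 + t\<^sup>2))"
    proof (rule AE_I2)
      fix t :: real
      have "(1 + t\<^sup>2) * cmod (\<phi> t) \<le> K + L"
        using K[of t] L[of t] by (simp add: algebra_simps)
      moreover have "0 < 1 + t\<^sup>2" by (simp add: add_pos_nonneg)
      ultimately have "cmod (\<phi> t) \<le> (K + L) * inverse (1 + t\<^sup>2)"
        by (simp add: field_simps)
      then show "norm (\<phi> t) \<le> norm ((K + L) * inverse (1 + t\<^sup>2))" by simp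
    qed
  qed simp
qed

text \<open>Differentiating \<open>inv_fourier \<phi>\<close> multiplies \<phi> by
  \<open>- i t\<close>. Closure under this factor is what lets derivatives be taken
  repeatedly.\<close>

lemma rapidly_decreasing_times_t:
  assumes "rapidly_decreasing \<phi>"
  shows "rapidly_decreasing (\<lambda>t. - (\<i> * of_real t) * \<phi> t)"
proof -
  have [measurable]: "\<phi> \<in> borel_measurable borel" using assms by measurable
  have "\<exists>K. \<forall>t. \<bar>t\<bar> ^ n * cmod (- (\<i> * of_real t) * \<phi> t) \<le> K" for n
  proof -
    obtain K where "\<forall>t. \<bar>t\<bar> ^ (Suc n) * cmod (\<phi> t) \<le> K"
      using assms unfolding rapidly_decreasing_def by blast
    then show ?thesis
      by (intro exI[of _ K]) (auto simp: norm_mult mult_ac)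
  qed
  then show ?thesis unfolding rapidly_decreasing_def by simp
qed

lemma cos_sin_combination_bound: "\<bar>cos s * Re z + sin s * Im z\<bar> \<le> 2 * cmod z"
proof -
  have "\<bar>cos s * Re z\<bar> \<le> 1 * cmod z" "\<bar>sin s * Im z\<bar> \<le> 1 * cmod z"
    unfolding abs_mult by (intro mult_mono abs_cos_le_one abs_sin_le_one abs_Re_le_cmod abs_Im_le_cmod; simp)+
  then show ?thesis by linarith
qed

lemma inv_fourier_integrand_integrable:
  assumes "rapidly_decreasing \<phi>"
  shows "integrable lborel (\<lambda>t. cos (t * x) * Re (\<phi> t) + sin (t * x) * Im (\<phi> t))"
proof (rule Bochner_Integration.integrable_bound)
  have [measurable]: "\<phi> \<in> borel_measurable borel" using assms by measurable
  show "integrable lborel (\<lambda>t. 2 * cmod (\<phi> t))"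
    using rapidly_decreasing_integrable[OF assms] by simp
  show "AE t in lborel. norm (cos (t * x) * Re (\<phi> t) + sin (t * x) * Im (\<phi> t)) \<le> norm (2 * cmod (\<phi> t))"
    using cos_sin_combination_bound by (intro AE_I2) simp
  show "(\<lambda>t. cos (t * x) * Re (\<phi> t) + sin (t * x) * Im (\<phi> t)) \<in> borel_measurable lborel"
    by measurable
qed

text \<open>Differentiation under the integral: by the mean value inequality the difference
  quotients are dominated by \<open>2 * \<bar>t\<bar> * cmod (\<phi> t)\<close>, which is integrable
  by rapid decrease.\<close>

lemma inv_fourier_DERIV:
  assumes \<phi>: "rapidly_decreasing \<phi>"
  shows "DERIV (inv_fourier \<phi>) x :> inv_fourier (\<lambda>t. - (\<i> * of_real t) * \<phi> t) x"
proof -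
  let ?\<psi> = "\<lambda>t. - (\<i> * of_real t) * \<phi> t"
  let ?g = "\<lambda>y t. cos (t * y) * Re (\<phi> t) + sin (t * y) * Im (\<phi> t)"
  let ?h = "\<lambda>y t. cos (t * y) * Re (?\<psi> t) + sin (t * y) * Im (?\<psi> t)"
  have [measurable]: "\<phi> \<in> borel_measurable borel" using \<phi> by measurable
  have deriv: "((\<lambda>y. ?g y t) has_field_derivative ?h y t) (at y)" for t y
    by (auto intro!: derivative_eq_intros simp: algebra_simps)
  have bound: "\<bar>?g y t - ?g x t\<bar> \<le> 2 * cmod (?\<psi> t) * \<bar>y - x\<bar>" for y t
  proof -
    have "norm (?g y t - ?g x t) \<le> (2 * cmod (?\<psi> t)) * norm (y - x)"
    proof (rule field_differentiable_bound[where S=UNIV and f' = "\<lambda>y. ?h y t"])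
      fix z :: real
      show "((\<lambda>y. ?g y t) has_field_derivative ?h z t) (at z within UNIV)"
        using deriv[of t z] by simp
      show "norm (?h z t) \<le> 2 * cmod (?\<psi> t)"
        unfolding real_norm_def by (rule cos_sin_combination_bound)
    qed auto
    then show ?thesis by simp
  qed
  have *: "((\<lambda>y. ((\<integral>t. ?g y t \<partial>lborel) - (\<integral>t. ?g x t \<partial>lborel)) / (y - x)) \<longlongrightarrow> (\<integral>t. ?h x t \<partial>lborel)) (at x)"
    unfolding tendsto_at_iff_sequentially comp_def
  proof (intro allI impI)
    fix X :: "nat \<Rightarrow> real" assume "\<forall>i. X i \<in> UNIV - {x}" and X: "X \<longlonglongrightarrow> x"
    then have ne: "X i \<noteq> x" for i by auto
    have "(\<lambda>i. (\<integral>t. (?g (X i) t - ?g x t) / (X i - x) \<partial>lborel)) \<longlonglongrightarrow> (\<integral>t. ?h x t \<partial>lborel)"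
    proof (rule integral_dominated_convergence[where w="\<lambda>t. 2 * cmod (?\<psi> t)"])
      show "integrable lborel (\<lambda>t. 2 * cmod (?\<psi> t))"
        using rapidly_decreasing_integrable[OF rapidly_decreasing_times_t[OF \<phi>]]
        by (intro integrable_mult_right integrable_norm)
      show "AE t in lborel. (\<lambda>i. (?g (X i) t - ?g x t) / (X i - x)) \<longlonglongrightarrow> ?h x t"
      proof (rule AE_I2)
        fix t
        have "((\<lambda>y. (?g y t - ?g x t) / (y - x)) \<longlongrightarrow> ?h x t) (at x)"
          using deriv[of t x] unfolding has_field_derivative_iff by simp
        then show "(\<lambda>i. (?g (X i) t - ?g x t) / (X i - x)) \<longlonglongrightarrow> ?h x t"
          using X ne unfolding tendsto_at_iff_sequentially comp_def by auto
      qed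
      show "AE t in lborel. norm ((?g (X i) t - ?g x t) / (X i - x)) \<le> 2 * cmod (?\<psi> t)" for i
      proof (rule AE_I2)
        fix t show "norm ((?g (X i) t - ?g x t) / (X i - x)) \<le> 2 * cmod (?\<psi> t)"
          using bound[where y="X i" and t=t] ne[of i] unfolding real_norm_def abs_divide
          by (subst pos_divide_le_eq) auto
      qed
    qed measurable
    then show "(\<lambda>i. ((\<integral>t. ?g (X i) t \<partial>lborel) - (\<integral>t. ?g x t \<partial>lborel)) / (X i - x)) \<longlonglongrightarrow> (\<integral>t. ?h x t \<partial>lborel)"
      by (subst (asm) integral_divide_zero)
         (subst (asm) Bochner_Integration.integral_diff; (intro inv_fourier_integrand_integrable \<phi>)?; simp)
  qed
  show ?thesis
    unfolding has_field_derivative_iff inv_fourier_def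
    using tendsto_divide[OF * tendsto_const[of "2 * pi"]]
    by (simp add: diff_divide_distrib[symmetric] mult.commute)
qed

lemma inv_fourier_smooth:
  assumes "rapidly_decreasing \<phi>"
  shows "(deriv ^^ n) (inv_fourier \<phi>) differentiable_on UNIV"
proof -
  have "\<exists>\<psi>. rapidly_decreasing \<psi> \<and> (deriv ^^ n) (inv_fourier \<phi>) = inv_fourier \<psi>"
  proof (induction n)
    case (Suc n)
    then obtain \<psi> where "rapidly_decreasing \<psi>" "(deriv ^^ n) (inv_fourier \<phi>) = inv_fourier \<psi>" by blast
    then show ?case
      using inv_fourier_DERIV[THEN DERIV_imp_deriv] rapidly_decreasing_times_t
      by (intro exI[of _ "\<lambda>t. - (\<i> * of_real t) * \<psi> t"]) auto
  qed (use assms in auto)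
  then obtain \<psi> where \<psi>: "rapidly_decreasing \<psi>" "(deriv ^^ n) (inv_fourier \<phi>) = inv_fourier \<psi>" by blast
  show ?thesis
    unfolding \<psi>(2) differentiable_on_def
    using inv_fourier_DERIV[OF \<psi>(1)]
    by (meson differentiable_at_withinI real_differentiable_def)
qed

lemma inv_fourier_continuous:
  assumes "rapidly_decreasing \<phi>"
  shows "continuous_on S (inv_fourier \<phi>)"
  using inv_fourier_DERIV[OF assms] by (intro continuous_at_imp_continuous_on) (blast intro: DERIV_isCont)

lemma inv_fourier_measurable [measurable]:
  assumes "rapidly_decreasing \<phi>"
  shows "inv_fourier \<phi> \<in> borel_measurable borel"
  by (intro borel_measurable_continuous_onI inv_fourier_continuous assms)

lemma inv_fourier_bounded:
  assumes "rapidly_decreasing \<phi>"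
  shows "\<bar>inv_fourier \<phi> x\<bar> \<le> (\<integral>t. 2 * cmod (\<phi> t) \<partial>lborel) / (2 * pi)"
proof -
  have "norm (\<integral>t. (cos (t * x) * Re (\<phi> t) + sin (t * x) * Im (\<phi> t)) \<partial>lborel) \<le> (\<integral>t. 2 * cmod (\<phi> t) \<partial>lborel)"
    using rapidly_decreasing_integrable[OF assms] cos_sin_combination_bound
    by (intro Bochner_Integration.integral_norm_bound_integral inv_fourier_integrand_integrable assms) auto
  then show ?thesis
    unfolding inv_fourier_def real_norm_def abs_divide using pi_gt_zero
    by (simp only: abs_mult abs_numeral abs_of_pos divide_right_mono)
qed

text \<open>In Levy's inversion formula the truncated integrals converge to the full one because the
  characteristic function is integrable and the kernel is bounded by \<open>b - a\<close>. The
  kernel is the integral of \<open>exp (- i t x)\<close> over \<open>x\<close> in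
  \<open>{a..b}\<close>, so Fubini turns the formula into an integral of \<open>inv_fourier\<close>.
  The conditions on the end points are removed by \<open>rapid_char_no_atoms\<close>.\<close>

lemma (in real_distribution) Levy_density_aux:
  assumes \<phi>: "rapidly_decreasing (char M)" and ab: "a \<le> b" "measure M {a} = 0" "measure M {b} = 0"
  shows "measure M {a<..b} = (\<integral>x. indicator {a..b} x * inv_fourier (char M) x \<partial>lborel)"
proof -
  let ?\<phi> = "char M"
  let ?F = "\<lambda>t::real. (iexp (-(t * a)) - iexp (-(t * b))) / (\<i> * t)"
  let ?g = "\<lambda>t x. cos (t * x) * Re (?\<phi> t) + sin (t * x) * Im (?\<phi> t)"
  have int\<phi>: "integrable lborel ?\<phi>" by (rule rapidly_decreasing_integrable[OF \<phi>])
  have Fb: "cmod (?F t) \<le> b - a" if "t \<noteq> 0" for t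
    using Levy_Inversion_aux2[of "-b" "-a" t] ab(1) that by (simp add: mult.commute)
  have Fb': "AE t in lborel. norm (?F t * ?\<phi> t) \<le> (b - a) * cmod (?\<phi> t)"
  proof (rule AE_mp[OF AE_lborel_singleton[of 0]], rule AE_I2, rule impI)
    fix t :: real assume "t \<noteq> 0"
    then show "norm (?F t * ?\<phi> t) \<le> (b - a) * cmod (?\<phi> t)"
      unfolding norm_mult by (intro mult_right_mono Fb) auto
  qed
  have bnd: "integrable lborel (\<lambda>t. (b - a) * cmod (?\<phi> t))"
    using int\<phi> by (intro integrable_mult_right integrable_norm)
  have intF: "integrable lborel (\<lambda>t. ?F t * ?\<phi> t)"
    by (rule Bochner_Integration.integrable_bound[OF bnd]) (use Fb' in \<open>auto elim!: eventually_mono\<close>)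
  have "(\<lambda>T::nat. (CLBINT t=-real T..real T. ?F t * ?\<phi> t)) \<longlonglongrightarrow> (\<integral>t. ?F t * ?\<phi> t \<partial>lborel)"
  proof -
    have eq: "(CLBINT t=-real T..real T. ?F t * ?\<phi> t) =
      (\<integral>t. indicator {-real T<..<real T} t *\<^sub>R (?F t * ?\<phi> t) \<partial>lborel)" for T
      by (simp add: interval_lebesgue_integral_def set_lebesgue_integral_def)
    show ?thesis unfolding eq
    proof (rule integral_dominated_convergence[where w="\<lambda>t. (b - a) * cmod (?\<phi> t)"])
      show "AE t in lborel. (\<lambda>T. indicator {-real T<..<real T} t *\<^sub>R (?F t * ?\<phi> t)) \<longlonglongrightarrow> ?F t * ?\<phi> t"
      proof (rule AE_I2, rule tendsto_eventually)
        fix t :: real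
        obtain N :: nat where "\<bar>t\<bar> < real N" using reals_Archimedean2 by blast
        then show "\<forall>\<^sub>F T in sequentially. indicator {-real T<..<real T} t *\<^sub>R (?F t * ?\<phi> t) = ?F t * ?\<phi> t"
          by (intro eventually_sequentiallyI[of N]) (auto simp: indicator_def)
      qed
      show "AE t in lborel. norm (indicator {-real T<..<real T} t *\<^sub>R (?F t * ?\<phi> t)) \<le> (b - a) * cmod (?\<phi> t)" for T
        using Fb' ab(1) by (auto elim!: eventually_mono simp: indicator_def)
    qed (use bnd in measurable)
  qed
  then have "(\<lambda>T::nat. 1 / (2 * pi) * (CLBINT t=-real T..real T. ?F t * ?\<phi> t)) \<longlonglongrightarrow>
      complex_of_real (1 / (2 * pi)) * (\<integral>t. ?F t * ?\<phi> t \<partial>lborel)"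
    by (intro tendsto_mult) auto
  moreover have "(\<lambda>T::nat. 1 / (2 * pi) * (CLBINT t=-real T..real T. ?F t * ?\<phi> t)) \<longlonglongrightarrow>
      complex_of_real (measure M {a<..b})"
    using Levy_Inversion[OF ab] by simp
  ultimately have "complex_of_real (measure M {a<..b}) = complex_of_real (1 / (2 * pi)) * (\<integral>t. ?F t * ?\<phi> t \<partial>lborel)"
    by (rule LIMSEQ_unique[rotated])
  then have "measure M {a<..b} = 1 / (2 * pi) * Re (\<integral>t. ?F t * ?\<phi> t \<partial>lborel)"
    by (simp add: complex_eq_iff)
  also have "Re (\<integral>t. ?F t * ?\<phi> t \<partial>lborel) = (\<integral>t. Re (?F t * ?\<phi> t) \<partial>lborel)"
    using integral_Re[OF intF] by simp
  also have "\<dots> = (\<integral>t. (\<integral>x. indicator {a..b} x *\<^sub>R ?g t x \<partial>lborel) \<partial>lborel)"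
  proof (rule integral_cong_AE)
    \<comment> \<open>At \<open>t = 0\<close> the quotient \<open>?F\<close> evaluates to 0 instead
      of \<open>b - a\<close>, so this point is discarded as a null set.\<close>
    show "AE t in lborel. Re (?F t * ?\<phi> t) = (\<integral>x. indicator {a..b} x *\<^sub>R ?g t x \<partial>lborel)"
    proof (rule AE_mp[OF AE_lborel_singleton[of 0]], rule AE_I2, rule impI)
      fix t :: real assume t: "t \<noteq> 0"
      let ?G = "\<lambda>x. (sin (t * x) * Re (?\<phi> t) - cos (t * x) * Im (?\<phi> t)) / t"
      have "(\<integral>x. indicator {a..b} x *\<^sub>R ?g t x \<partial>lborel) = ?G b - ?G a"
      proof (rule integral_FTC_Icc[OF ab(1)])
        show "(?G has_vector_derivative ?g t x) (at x within {a..b})" for x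
          using t by (auto intro!: derivative_eq_intros simp: has_real_derivative_iff_has_vector_derivative[symmetric] field_simps)
        show "continuous_on {a..b} (?g t)" by (intro continuous_intros)
      qed
      moreover have "?F t = Complex ((sin (t * b) - sin (t * a)) / t) (- ((cos (t * a) - cos (t * b)) / t))"
        using t by (simp add: complex_eq_iff Re_exp Im_exp Re_divide Im_divide field_simps power2_eq_square)
      ultimately show "Re (?F t * ?\<phi> t) = (\<integral>x. indicator {a..b} x *\<^sub>R ?g t x \<partial>lborel)"
        using t by (simp add: field_simps)
    qed
  qed measurable
  also have "\<dots> = (\<integral>x. (\<integral>t. indicator {a..b} x *\<^sub>R ?g t x \<partial>lborel) \<partial>lborel)"
  proof (rule lborel_pair.Fubini_integral)
    show "integrable (lborel \<Otimes>\<^sub>M lborel) (\<lambda>(x, t). indicator {a..b} x *\<^sub>R ?g t x)"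
    proof (rule lborel_pair.Fubini_integrable)
      show "AE x in lborel. integrable lborel (\<lambda>t. case (x, t) of (x, t) \<Rightarrow> indicator {a..b} x *\<^sub>R ?g t x)"
        using inv_fourier_integrand_integrable[OF \<phi>] by (intro AE_I2) auto
      show "integrable lborel (\<lambda>x. \<integral>t. norm (case (x, t) of (x, t) \<Rightarrow> indicator {a..b} x *\<^sub>R ?g t x) \<partial>lborel)"
      proof (rule Bochner_Integration.integrable_bound)
        show "integrable lborel (\<lambda>x. indicator {a..b} x * (\<integral>t. 2 * cmod (?\<phi> t) \<partial>lborel))"
          using ab(1) by (intro integrable_mult_left integrable_real_indicator) auto
        show "AE x in lborel. norm (\<integral>t. norm (case (x, t) of (x, t) \<Rightarrow> indicator {a..b} x *\<^sub>R ?g t x) \<partial>lborel)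
           \<le> norm (indicator {a..b} x * (\<integral>t. 2 * cmod (?\<phi> t) \<partial>lborel))"
        proof (rule AE_I2)
          fix x :: real
          have "(\<integral>t. \<bar>?g t x\<bar> \<partial>lborel) \<le> (\<integral>t. 2 * cmod (?\<phi> t) \<partial>lborel)"
            using inv_fourier_integrand_integrable[OF \<phi>, of x] int\<phi> cos_sin_combination_bound
            by (intro integral_mono) auto
          then show "norm (\<integral>t. norm (case (x, t) of (x, t) \<Rightarrow> indicator {a..b} x *\<^sub>R ?g t x) \<partial>lborel)
           \<le> norm (indicator {a..b} x * (\<integral>t. 2 * cmod (?\<phi> t) \<partial>lborel))"
            by (auto simp: indicator_def intro!: order_trans[OF _ abs_ge_self])
        qed
      qed measurable
    qed measurable
  qed
  finally show ?thesis
    unfolding inv_fourier_def by simp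
qed

text \<open>Only countably many points carry mass, so \<open>x\<close> can be enclosed in a short
  interval with massless ends. There \<open>Levy_density_aux\<close> bounds the mass by the length
  times a bound of \<open>inv_fourier\<close>, too little for an atom.\<close>

lemma (in real_distribution) rapid_char_no_atoms:
  assumes \<phi>: "rapidly_decreasing (char M)"
  shows "measure M {x} = 0"
proof (rule ccontr)
  assume ne: "measure M {x} \<noteq> 0"
  define K where "K = (\<integral>t. 2 * cmod (char M t) \<partial>lborel) / (2 * pi) + 1"
  have K: "\<bar>inv_fourier (char M) y\<bar> \<le> K" for y
    using inv_fourier_bounded[OF \<phi>, of y] by (simp add: K_def)
  have K0: "K > 0" unfolding K_def by (intro add_nonneg_pos divide_nonneg_pos) auto
  \<comment> \<open>The enclosing interval is shorter than \<open>2 * e\<close>, so its mass is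
    below \<open>K * (2 * e)\<close>, half of the supposed atom.\<close>
  define e where "e = measure M {x} / (4 * K)"
  have pos: "measure M {x} > 0" using ne by (simp add: zero_less_measure_iff)
  with K0 have e: "e > 0" by (simp add: e_def)
  obtain a where a: "x - e < a" "a < x" "measure M {a} = 0"
    using open_minus_countable[OF countable_support, of "{x - e<..<x}"] e by auto
  obtain b where b: "x < b" "b < x + e" "measure M {b} = 0"
    using open_minus_countable[OF countable_support, of "{x<..<x+e}"] e by auto
  have "measure M {x} \<le> measure M {a<..b}"
    using a b by (intro finite_measure_mono) auto
  also have "\<dots> = (\<integral>y. indicator {a..b} y * inv_fourier (char M) y \<partial>lborel)"
    using a b by (intro Levy_density_aux \<phi>) auto
  also have "\<dots> \<le> (\<integral>y. indicator {a..b} y * K \<partial>lborel)"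
  proof (rule integral_mono)
    show bi: "integrable lborel (\<lambda>y. indicator {a..b} y * K)"
      using a b by (intro integrable_mult_left integrable_real_indicator) auto
    show "integrable lborel (\<lambda>y. indicator {a..b} y * inv_fourier (char M) y)"
      by (rule Bochner_Integration.integrable_bound[OF bi])
         (use K K0 inv_fourier_measurable[OF \<phi>] in \<open>auto simp: indicator_def\<close>)
    show "indicator {a..b} y * inv_fourier (char M) y \<le> indicator {a..b} y * K" for y
      using K[of y] by (auto simp: indicator_def)
  qed
  also have "\<dots> = K * (b - a)" using a b by simp
  also have "\<dots> < K * (2 * e)" using a b K0 by (intro mult_strict_left_mono) auto
  also have "\<dots> = measure M {x} / 2" using K0 by (simp add: e_def)
  finally show False using pos by simp
qed

lemma (in real_distribution) rapid_char_Ioc: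
  assumes "rapidly_decreasing (char M)" "a \<le> b"
  shows "measure M {a<..b} = (\<integral>x. indicator {a..b} x * inv_fourier (char M) x \<partial>lborel)"
  by (intro Levy_density_aux rapid_char_no_atoms assms)

text \<open>This form of the density yields its sign and, in \<open>total_density_pos\<close>,
  allows Fatou's lemma to compare the densities of the mixture and of its components.\<close>

lemma (in real_distribution) rapid_char_density_limit:
  assumes \<phi>: "rapidly_decreasing (char M)"
  shows "(\<lambda>n. real (Suc n) * measure M {x<..x + 1 / real (Suc n)}) \<longlonglongrightarrow> inv_fourier (char M) x"
proof -
  let ?f = "inv_fourier (char M)"
  have eq: "measure M {x<..b} = integral {x..b} ?f" if "x \<le> b" for b
  proof -
    have "set_integrable lborel {x..b} ?f"
      by (intro borel_integrable_atLeastAtMost' inv_fourier_continuous \<phi>)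
    from set_borel_integral_eq_integral(2)[OF this] show ?thesis
      unfolding rapid_char_Ioc[OF \<phi> that] by (simp add: set_lebesgue_integral_def)
  qed
  have "((\<lambda>u. integral {x..u} ?f) has_real_derivative ?f x) (at x within {x..x+1})"
    by (rule integral_has_real_derivative) (auto intro: inv_fourier_continuous \<phi>)
  then have "((\<lambda>y. (integral {x..y} ?f - integral {x..x} ?f) / (y - x)) \<longlongrightarrow> ?f x) (at x within {x..x+1})"
    unfolding has_field_derivative_iff .
  moreover have "(\<lambda>n. x + 1 / real (Suc n)) \<longlonglongrightarrow> x + 0"
    by (intro tendsto_add tendsto_const LIMSEQ_Suc[OF lim_1_over_n])
  ultimately have "(\<lambda>n. (integral {x..x + 1 / real (Suc n)} ?f - integral {x..x} ?f) / (x + 1 / real (Suc n) - x)) \<longlonglongrightarrow> ?f x"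
    unfolding tendsto_at_iff_sequentially comp_def
    by (elim allE[of _ "\<lambda>n. x + 1 / real (Suc n)"]) auto
  then show ?thesis
    by (subst (asm) eq[symmetric]) (auto simp: field_simps)
qed

lemma (in real_distribution) rapid_char_density_nonneg:
  assumes \<phi>: "rapidly_decreasing (char M)"
  shows "inv_fourier (char M) x \<ge> 0"
  using rapid_char_density_limit[OF \<phi>, of x] by (rule LIMSEQ_le_const) auto

lemma (in real_distribution) rapid_char_density:
  assumes \<phi>: "rapidly_decreasing (char M)"
  shows "M = density lborel (\<lambda>x. ennreal (inv_fourier (char M) x))"
proof (rule measure_eqI_generator_eq[where E="range (\<lambda>(a, b). {a<..b::real})" and \<Omega>=UNIV
      and A="\<lambda>n. {-real n<..real n}"])
  let ?f = "inv_fourier (char M)"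
  have [measurable]: "?f \<in> borel_measurable borel" by (rule inv_fourier_measurable[OF \<phi>])
  show "Int_stable (range (\<lambda>(a, b). {a<..b::real}))"
    by (auto simp: Int_stable_def)
  show "sets M = sigma_sets UNIV (range (\<lambda>(a, b). {a<..b::real}))"
    by (simp add: borel_sigma_sets_Ioc)
  show "sets (density lborel (\<lambda>x. ennreal (?f x))) = sigma_sets UNIV (range (\<lambda>(a, b). {a<..b::real}))"
    by (simp add: borel_sigma_sets_Ioc)
  show "emeasure M X = emeasure (density lborel (\<lambda>x. ennreal (?f x))) X"
    if "X \<in> range (\<lambda>(a, b). {a<..b::real})" for X
  proof -
    from that obtain a b where X: "X = {a<..b}" by auto
    show ?thesis
    proof (cases "a \<le> b")
      case True
      have "integrable lborel (\<lambda>x. indicator {a..b} x *\<^sub>R ?f x)"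
        using borel_integrable_atLeastAtMost'[OF inv_fourier_continuous[OF \<phi>, of "{a..b}"]]
        by (simp add: set_integrable_def)
      then have int: "integrable lborel (\<lambda>x. indicator {a..b} x * ?f x)" by simp
      have "emeasure (density lborel (\<lambda>x. ennreal (?f x))) X =
          (\<integral>\<^sup>+x. ennreal (?f x) * indicator {a<..b} x \<partial>lborel)"
        unfolding X by (rule emeasure_density) auto
      also have "\<dots> = (\<integral>\<^sup>+x. ennreal (indicator {a..b} x * ?f x) \<partial>lborel)"
        by (rule nn_integral_cong_AE, rule AE_mp[OF AE_lborel_singleton[of a]])
           (auto simp: indicator_def)
      also have "\<dots> = ennreal (\<integral>x. indicator {a..b} x * ?f x \<partial>lborel)"
        using int rapid_char_density_nonneg[OF \<phi>] by (intro nn_integral_eq_integral) auto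
      also have "\<dots> = emeasure M X"
        using rapid_char_Ioc[OF \<phi> True] by (simp add: X emeasure_eq_measure)
      finally show ?thesis ..
    qed (simp add: X)
  qed
  show "(\<Union>i. {-real i<..real i}) = UNIV"
  proof (intro equalityI subsetI UNIV_I)
    fix x :: real obtain n :: nat where "\<bar>x\<bar> < real n" using reals_Archimedean2 by blast
    then show "x \<in> (\<Union>i. {-real i<..real i})" by (auto intro!: exI[of _ n])
  qed
qed (auto simp: emeasure_eq_measure)

section \<open>Series with geometrically decaying second moments\<close>

text \<open>The weight \<open>3/4\<close> lies strictly between the decay rate \<open>1/2\<close> of
  the second moments and 1: \<open>(4/3) * (1/2) = 2/3\<close> leaves a convergent series, and the
  weights themselves sum to at most \<open>4 * (3/4)^r\<close>.\<close>

lemma weighted_Cauchy_Schwarz: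
  fixes x :: "nat \<Rightarrow> real"
  shows "(\<Sum>k\<in>{r..<s}. x k)\<^sup>2 \<le> 4 * (3/4)^r * (\<Sum>k\<in>{r..<s}. (4/3)^k * (x k)\<^sup>2)"
proof -
  define q :: real where "q = sqrt (3/4)"
  have q: "q > 0" "q^2 = 3/4" by (simp_all add: q_def)
  have q2: "(q^k)^2 = (3/4)^k" for k by (metis q(2) power_mult mult.commute)
  have "(\<Sum>k\<in>{r..<s}. x k)\<^sup>2 = (\<Sum>k\<in>{r..<s}. q^k * (x k / q^k))\<^sup>2" using q by simp
  also have "\<dots> \<le> (\<Sum>k\<in>{r..<s}. (q^k)\<^sup>2) * (\<Sum>k\<in>{r..<s}. (x k / q^k)\<^sup>2)"
    by (rule Cauchy_Schwarz_ineq_sum)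
  also have "(\<Sum>k\<in>{r..<s}. (x k / q^k)\<^sup>2) = (\<Sum>k\<in>{r..<s}. (4/3)^k * (x k)\<^sup>2)"
    by (simp add: power_divide q2 divide_simps mult.commute flip: power_mult_distrib)
  also have "(\<Sum>k\<in>{r..<s}. (q^k)\<^sup>2) \<le> 4 * (3/4)^r"
  proof -
    have "(\<Sum>k\<in>{r..<s}. (3/4::real)^k) = 4 * ((3/4)^r - (3/4)^s)" if "r \<le> s"
      using that by (induction s rule: dec_induct) (simp_all add: algebra_simps)
    then show ?thesis by (cases "r \<le> s") (auto simp: q2)
  qed
  finally show ?thesis by (simp add: mult_right_mono sum_nonneg)
qed

text \<open>One integrable \<open>Y\<close>, the sum of the squares weighted by
  \<open>(4/3)^k\<close>, controls all partial sums and all remainders. Almost sure and mean square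
  convergence follow together, from second moments alone.\<close>

lemma series_L2_convergence:
  fixes X :: "nat \<Rightarrow> 'a \<Rightarrow> real"
  assumes X[measurable]: "\<And>k. X k \<in> borel_measurable M" and "V \<ge> 0"
    and second_moment: "\<And>k. (\<integral>\<^sup>+\<omega>. ennreal ((X k \<omega>)\<^sup>2) \<partial>M) \<le> ennreal (V * (1/2)^k)"
  obtains Y where "integrable M Y"
    "AE \<omega> in M. summable (\<lambda>k. X k \<omega>) \<and>
      (\<forall>r. (\<Sum>k<r. X k \<omega>)\<^sup>2 \<le> 4 * Y \<omega> \<and> (suminf (\<lambda>k. X k \<omega>) - (\<Sum>k<r. X k \<omega>))\<^sup>2 \<le> 4 * (3/4)^r * Y \<omega>)"
proof -
  let ?y = "\<lambda>k \<omega>. (4/3)^k * (X k \<omega>)\<^sup>2"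
  define Y where "Y \<omega> = enn2real (\<Sum>k. ennreal (?y k \<omega>))" for \<omega>
  have "(\<integral>\<^sup>+\<omega>. (\<Sum>k. ennreal (?y k \<omega>)) \<partial>M) = (\<Sum>k. \<integral>\<^sup>+\<omega>. ennreal (?y k \<omega>) \<partial>M)"
    by (rule nn_integral_suminf) measurable
  also have "\<dots> \<le> (\<Sum>k. ennreal (V * (2/3)^k))"
  proof (intro suminf_le)
    fix k
    have "(\<integral>\<^sup>+\<omega>. ennreal (?y k \<omega>) \<partial>M) = ennreal ((4/3)^k) * (\<integral>\<^sup>+\<omega>. ennreal ((X k \<omega>)\<^sup>2) \<partial>M)"
      by (simp add: ennreal_mult nn_integral_cmult)
    also have "\<dots> \<le> ennreal ((4/3)^k) * ennreal (V * (1/2)^k)"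
      by (intro mult_left_mono second_moment) simp
    also have "\<dots> = ennreal (V * (2/3)^k)"
      using \<open>V \<ge> 0\<close> by (simp add: ennreal_mult[symmetric] power_mult_distrib[symmetric] mult.left_commute)
    finally show "(\<integral>\<^sup>+\<omega>. ennreal (?y k \<omega>) \<partial>M) \<le> ennreal (V * (2/3)^k)" .
  qed auto
  also have "\<dots> = ennreal (\<Sum>k. V * (2/3)^k)"
    using \<open>V \<ge> 0\<close> by (intro suminf_ennreal2 summable_mult summable_geometric) auto
  finally have fin: "(\<integral>\<^sup>+\<omega>. (\<Sum>k. ennreal (?y k \<omega>)) \<partial>M) < \<infinity>"
    by (rule order.strict_trans1) simp
  have ae: "AE \<omega> in M. (\<Sum>k. ennreal (?y k \<omega>)) \<noteq> \<infinity>"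
    by (rule nn_integral_PInf_AE) (use fin in auto)
  have meas[measurable]: "Y \<in> borel_measurable M" unfolding Y_def by measurable
  have "integrable M Y"
  proof (rule integrableI_bounded[OF meas])
    have "(\<integral>\<^sup>+\<omega>. norm (Y \<omega>) \<partial>M) = (\<integral>\<^sup>+\<omega>. (\<Sum>k. ennreal (?y k \<omega>)) \<partial>M)"
      by (rule nn_integral_cong_AE)
         (use ae in \<open>auto elim!: eventually_mono simp: Y_def less_top ennreal_enn2real\<close>)
    with fin show "(\<integral>\<^sup>+\<omega>. norm (Y \<omega>) \<partial>M) < \<infinity>" by simp
  qed
  moreover have "AE \<omega> in M. summable (\<lambda>k. X k \<omega>) \<and>
      (\<forall>r. (\<Sum>k<r. X k \<omega>)\<^sup>2 \<le> 4 * Y \<omega> \<and> (suminf (\<lambda>k. X k \<omega>) - (\<Sum>k<r. X k \<omega>))\<^sup>2 \<le> 4 * (3/4)^r * Y \<omega>)"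
    using ae
  proof eventually_elim
    fix \<omega> assume fin: "(\<Sum>k. ennreal (?y k \<omega>)) \<noteq> \<infinity>"
    then have sy: "summable (\<lambda>k. ?y k \<omega>)" by (intro summable_suminf_not_top) auto
    then have Y: "Y \<omega> = (\<Sum>k. ?y k \<omega>)"
      unfolding Y_def by (subst suminf_ennreal2) (auto intro!: enn2real_ennreal suminf_nonneg)
    have part: "(\<Sum>k\<in>{r..<s}. X k \<omega>)\<^sup>2 \<le> 4 * (3/4)^r * Y \<omega>" for r s
    proof -
      have "(\<Sum>k\<in>{r..<s}. ?y k \<omega>) \<le> Y \<omega>"
        unfolding Y by (intro sum_le_suminf sy) auto
      then show ?thesis
        using weighted_Cauchy_Schwarz[of "\<lambda>k. X k \<omega>" r s]
        by (meson mult_left_mono order_trans zero_le_mult_iff zero_le_numeral zero_le_power zero_le_divide_iff)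
    qed
    \<comment> \<open>Absolute convergence: with \<open>q = (3/4)^k\<close>, the inequality
      \<open>2 * \<bar>a\<bar> * q \<le> q^2 + a^2\<close> divided by \<open>q\<close> bounds
      \<open>\<bar>a\<bar>\<close> by a summable term.\<close>
    have sX: "summable (\<lambda>k. X k \<omega>)"
    proof (rule summable_comparison_test')
      show "summable (\<lambda>k. (3/4)^k + ?y k \<omega>)" by (intro summable_add sy summable_geometric) auto
      fix k :: nat
      let ?a = "X k \<omega>" and ?q = "(3/4::real)^k"
      have q: "?q > 0" "?q * (4/3)^k = 1" by (simp_all flip: power_mult_distrib)
      have "0 \<le> (?q - \<bar>?a\<bar>)\<^sup>2" by simp
      then have "2 * \<bar>?a\<bar> * ?q \<le> ?q * (?q + (4/3)^k * ?a\<^sup>2)"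
        using q(2) by (simp add: power2_eq_square algebra_simps)
      then have "2 * \<bar>?a\<bar> \<le> ?q + (4/3)^k * ?a\<^sup>2" using q(1)
        by (metis mult.commute mult_le_cancel_left_pos)
      then show "norm ?a \<le> ?q + (4/3)^k * ?a\<^sup>2" using abs_ge_zero[of ?a] unfolding real_norm_def by linarith
    qed
    have "(suminf (\<lambda>k. X k \<omega>) - (\<Sum>k<r. X k \<omega>))\<^sup>2 \<le> 4 * (3/4)^r * Y \<omega>" for r
    proof (rule LIMSEQ_le_const2)
      show "(\<lambda>s. ((\<Sum>k<s. X k \<omega>) - (\<Sum>k<r. X k \<omega>))\<^sup>2) \<longlonglongrightarrow> (suminf (\<lambda>k. X k \<omega>) - (\<Sum>k<r. X k \<omega>))\<^sup>2"
        by (intro tendsto_intros summable_LIMSEQ sX)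
      show "\<exists>N. \<forall>s\<ge>N. ((\<Sum>k<s. X k \<omega>) - (\<Sum>k<r. X k \<omega>))\<^sup>2 \<le> 4 * (3/4)^r * Y \<omega>"
      proof (intro exI[of _ r] allI impI)
        fix s assume "r \<le> s"
        then have "(\<Sum>k<s. X k \<omega>) - (\<Sum>k<r. X k \<omega>) = (\<Sum>k\<in>{r..<s}. X k \<omega>)"
          by (simp add: sum_diff_nat_ivl[of 0 r s, simplified atLeast0LessThan])
        then show "((\<Sum>k<s. X k \<omega>) - (\<Sum>k<r. X k \<omega>))\<^sup>2 \<le> 4 * (3/4)^r * Y \<omega>"
          using part[of r s] by simp
      qed
    qed
    moreover have "(\<Sum>k<r. X k \<omega>)\<^sup>2 \<le> 4 * Y \<omega>" for r
      using part[of 0 r] by (simp add: atLeast0LessThan)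
    ultimately show "summable (\<lambda>k. X k \<omega>) \<and>
      (\<forall>r. (\<Sum>k<r. X k \<omega>)\<^sup>2 \<le> 4 * Y \<omega> \<and> (suminf (\<lambda>k. X k \<omega>) - (\<Sum>k<r. X k \<omega>))\<^sup>2 \<le> 4 * (3/4)^r * Y \<omega>)"
      using sX by blast
  qed
  ultimately show ?thesis by (rule that)
qed

section \<open>The step laws\<close>

lemma nn_integral_count_space_infsum:
  assumes "\<And>x. x \<in> A \<Longrightarrow> f x \<ge> (0::real)" "f summable_on A"
  shows "(\<integral>\<^sup>+x. ennreal (f x) \<partial>count_space A) = ennreal (infsum f A)"
proof -
  have "(\<lambda>x. norm (f x)) summable_on A"
    using assms by (subst summable_on_cong[of _ _ f]) auto
  then have abs: "Infinite_Set_Sum.abs_summable_on f A"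
    unfolding abs_summable_equivalent[symmetric] .
  show ?thesis
    using nn_integral_conv_infsetsum[OF abs] infsetsum_infsum[OF abs] assms(1) by simp
qed

lemma summable_on_if_nn_integral_finite:
  assumes "\<And>x. x \<in> A \<Longrightarrow> f x \<ge> (0::real)" "(\<integral>\<^sup>+x. ennreal (f x) \<partial>count_space A) < \<infinity>"
  shows "f summable_on A"
proof -
  have "Infinite_Set_Sum.abs_summable_on f A"
    unfolding abs_summable_on_def
  proof (rule integrableI_bounded)
    have "(\<integral>\<^sup>+x. ennreal (norm (f x)) \<partial>count_space A) = (\<integral>\<^sup>+x. ennreal (f x) \<partial>count_space A)"
      using assms(1) by (intro nn_integral_cong) auto
    with assms(2) show "(\<integral>\<^sup>+x. ennreal (norm (f x)) \<partial>count_space A) < \<infinity>" by simp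
  qed simp
  then show ?thesis
    unfolding abs_summable_equivalent[symmetric] by (rule abs_summable_summable)
qed

lemma even_function_summable_on_int:
  fixes f :: "int \<Rightarrow> real"
  assumes "\<And>j. f (- j) = f j" "\<And>j. f j \<ge> 0" "summable (\<lambda>j::nat. f (int j))"
  shows "f summable_on UNIV"
proof -
  have nat: "(\<lambda>j::nat. f (int j)) summable_on UNIV"
    using assms(2,3) by (intro norm_summable_imp_summable_on) simp
  have 1: "f summable_on (range int)"
    using nat by (subst summable_on_reindex) (simp_all add: o_def inj_on_def)
  have 2: "f summable_on (range (\<lambda>j. - int j))"
    using nat by (subst summable_on_reindex) (simp_all add: o_def inj_on_def assms(1))
  have "UNIV = range int \<union> range (\<lambda>j. - int j)"
  proof (rule UNIV_eq_I)
    fix x :: int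
    show "x \<in> range int \<union> range (\<lambda>j. - int j)"
      by (rule int_cases2[of x]) blast+
  qed
  with summable_on_union[OF 1 2] show ?thesis by simp
qed

lemma of_int_bit_eq_of_bool: "of_int s = (of_bool (odd s) :: bit)"
proof (cases "even s")
  case True
  then obtain k where "s = 2 * k" by (elim evenE)
  then show ?thesis by (simp only: of_int_mult of_int_numeral bit_numeral_even) simp
next
  case False
  then obtain k where "s = 2 * k + 1" by (elim oddE)
  then show ?thesis by (simp only: of_int_mult of_int_add of_int_1 of_int_numeral bit_numeral_even) simp
qed

lemma of_int_bit_eq_0_iff: "of_int s = (0::bit) \<longleftrightarrow> even s"
  unfolding of_int_bit_eq_of_bool by simp

lemma of_int_bit_eq_1_iff: "of_int s = (1::bit) \<longleftrightarrow> odd s"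
  unfolding of_int_bit_eq_of_bool by simp

lemma of_int_bit_uminus: "of_int (- s) = (of_int s :: bit)"
  unfolding of_int_bit_eq_of_bool by simp

locale height_weight =
  fixes Q :: "int \<Rightarrow> real"
  assumes Q_pos: "\<And>j. Q j > 0"
    and Q_sym: "\<And>j. Q (- j) = Q j"
    and Q_moment: "summable (\<lambda>j::nat. (real j)\<^sup>2 * Q (int j))"
begin

lemma Q_moment_summable_on: "(\<lambda>j. (real_of_int j)\<^sup>2 * Q j) summable_on UNIV"
  by (rule even_function_summable_on_int) (use Q_sym Q_pos Q_moment in \<open>auto simp: less_imp_le\<close>)

lemma Q_summable_on: "Q summable_on A"
proof -
  have "summable (\<lambda>j::nat. Q (int j))"
  proof (rule summable_comparison_test'[where N=1])
    show "summable (\<lambda>j::nat. (real j)\<^sup>2 * Q (int j))" by (rule Q_moment)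
    fix j :: nat assume "1 \<le> j"
    then have "1 \<le> (real j)\<^sup>2" by simp
    then show "norm (Q (int j)) \<le> (real j)\<^sup>2 * Q (int j)"
      using Q_pos[of "int j"] mult_right_mono[of 1 "(real j)\<^sup>2" "Q (int j)"] by simp
  qed
  then have "Q summable_on UNIV"
    using Q_sym Q_pos by (intro even_function_summable_on_int) (auto simp: less_imp_le)
  then show ?thesis by (rule summable_on_subset_banach) simp
qed

lemma fuzzy_eq: "fuzzy Q a = infsum Q {s. of_int s = a}"
proof (cases "a = 0")
  case True
  have "{s. of_int s = a} = range (\<lambda>l. 2 * l)"
    unfolding True of_int_bit_eq_0_iff by (auto elim!: evenE)
  then show ?thesis
    using True by (simp add: fuzzy_def infsum_reindex inj_on_def o_def)
next
  case False
  then have "a = 1" by (cases a) auto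
  have "{s. of_int s = a} = range (\<lambda>l. 1 + 2 * l)"
    unfolding \<open>a = 1\<close> of_int_bit_eq_1_iff by (auto elim!: oddE)
  then show ?thesis
    using False by (simp add: fuzzy_def infsum_reindex inj_on_def o_def)
qed

lemma coset_nonempty: "\<exists>s. of_int s = (a :: bit)"
  by (cases a) (metis of_int_0, metis of_int_1)

lemma fuzzy_pos: "fuzzy Q a > 0"
proof -
  obtain s where s: "of_int s = a" using coset_nonempty by blast
  have "0 < Q s" by (rule Q_pos)
  also have "Q s = infsum Q {s}" by simp
  also have "\<dots> \<le> infsum Q {s. of_int s = a}"
    using s Q_pos by (intro infsum_mono_neutral Q_summable_on) (auto simp: less_imp_le)
  finally show ?thesis by (simp add: fuzzy_eq)
qed

definition step_weight :: "bit \<Rightarrow> int \<Rightarrow> real" where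
  "step_weight a s = indicator {s. of_int s = a} s * Q s / fuzzy Q a"

lemma step_weight_nonneg: "step_weight a s \<ge> 0"
  using Q_pos fuzzy_pos by (simp add: step_weight_def less_imp_le)

lemma step_weight_pos_iff: "step_weight a s > 0 \<longleftrightarrow> of_int s = a"
  using Q_pos[of s] fuzzy_pos[of a] by (auto simp: step_weight_def indicator_def)

lemma step_weight_sym: "step_weight a (- s) = step_weight a s"
proof -
  have "(- of_int s :: bit) = of_int s" using of_int_bit_uminus[of s] by simp
  then show ?thesis by (simp add: step_weight_def Q_sym indicator_def)
qed

lemma step_law_eq: "step_law Q a = density (count_space UNIV) (\<lambda>s. ennreal (step_weight a s))"
  by (simp add: step_law_def step_weight_def)

lemma sets_step_law [simp]: "sets (step_law Q a) = UNIV"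
  by (simp add: step_law_eq)

lemma sets_step_law_count_space [measurable_cong]: "sets (step_law Q a) = sets (count_space UNIV)"
  by simp

lemma space_step_law [simp]: "space (step_law Q a) = UNIV"
  by (simp add: step_law_eq)

lemma nn_integral_step_law:
  "(\<integral>\<^sup>+s. f s \<partial>step_law Q a) = (\<integral>\<^sup>+s. ennreal (step_weight a s) * f s \<partial>count_space UNIV)"
  unfolding step_law_eq by (subst nn_integral_density) auto

lemma emeasure_step_law_singleton: "emeasure (step_law Q a) {s} = ennreal (step_weight a s)"
  unfolding step_law_eq by (subst emeasure_density) (auto simp: nn_integral_indicator_singleton)

lemma step_weight_summable_on: "step_weight a summable_on UNIV"
proof -
  have "(\<lambda>s. (1 / fuzzy Q a) * Q s) summable_on {s. of_int s = a}"
    by (intro summable_on_cmult_right Q_summable_on)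
  then show ?thesis
    by (rule summable_on_cong_neutral[THEN iffD1, rotated -1]) (auto simp: step_weight_def)
qed

lemma infsum_step_weight: "infsum (step_weight a) UNIV = 1"
proof -
  have "infsum (step_weight a) UNIV = infsum (\<lambda>s. (1 / fuzzy Q a) * Q s) {s. of_int s = a}"
    by (rule infsum_cong_neutral) (auto simp: step_weight_def)
  also have "\<dots> = 1"
    using fuzzy_pos[of a] by (subst infsum_cmult_right') (simp add: fuzzy_eq)
  finally show ?thesis .
qed

lemma prob_space_step_law: "prob_space (step_law Q a)"
proof (rule prob_spaceI)
  have "emeasure (step_law Q a) (space (step_law Q a)) = (\<integral>\<^sup>+s. ennreal (step_weight a s) \<partial>count_space UNIV)"
    unfolding step_law_eq by (subst emeasure_density) auto
  also have "\<dots> = 1"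
    by (subst nn_integral_count_space_infsum) (auto simp: step_weight_nonneg step_weight_summable_on infsum_step_weight)
  finally show "emeasure (step_law Q a) (space (step_law Q a)) = 1" .
qed

sublocale step: prob_space "step_law Q a" for a
  by (rule prob_space_step_law)

lemma measure_step_law_singleton: "measure (step_law Q a) {s} = step_weight a s"
  using emeasure_step_law_singleton[of a s] step_weight_nonneg[of a s]
  by (simp add: step.emeasure_eq_measure)

lemma AE_step_law: "(AE s in step_law Q a. P s) \<longleftrightarrow> (\<forall>s. of_int s = a \<longrightarrow> P s)"
  unfolding step_law_eq by (subst AE_density) (auto simp: AE_count_space step_weight_pos_iff)

lemma measurable_step_law [simp]: "f \<in> measurable (step_law Q a) N \<longleftrightarrow> f \<in> UNIV \<rightarrow> space N"
  by (auto simp: measurable_def)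

lemma distr_uminus_step_law: "distr (step_law Q a) (count_space UNIV) uminus = step_law Q a"
proof (rule measure_eqI_countable[of _ UNIV])
  fix s :: int
  have "uminus -` {s} = {- s}" by auto
  then show "emeasure (distr (step_law Q a) (count_space UNIV) uminus) {s} = emeasure (step_law Q a) {s}"
    by (subst emeasure_distr) (auto simp: emeasure_step_law_singleton step_weight_sym)
qed auto

lemma nn_integral_step_law_uminus: "(\<integral>\<^sup>+s. f (- s) \<partial>step_law Q a) = (\<integral>\<^sup>+s. f s \<partial>step_law Q a)"
  by (subst (2) distr_uminus_step_law[symmetric], subst nn_integral_distr) auto

lemma integral_step_law_uminus:
  fixes f :: "int \<Rightarrow> 'b::{banach, second_countable_topology}"
  shows "(\<integral>s. f (- s) \<partial>step_law Q a) = (\<integral>s. f s \<partial>step_law Q a)"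
  by (subst (2) distr_uminus_step_law[symmetric], subst integral_distr) auto

text \<open>A common upper bound for the second moments of both step laws: the sum runs over both
  classes and the smaller normalisation is used.\<close>

definition step_variance :: real where
  "step_variance = (\<Sum>\<^sub>\<infinity>j. (real_of_int j)\<^sup>2 * Q j) / min (fuzzy Q 0) (fuzzy Q 1)"

lemma step_variance_nonneg: "step_variance \<ge> 0"
  using Q_pos fuzzy_pos[of 0] fuzzy_pos[of 1] unfolding step_variance_def
  by (intro divide_nonneg_nonneg infsum_nonneg) (auto simp: less_imp_le)

lemma nn_integral_step_law_square:
  "(\<integral>\<^sup>+s. ennreal ((real_of_int s)\<^sup>2) \<partial>step_law Q a) \<le> ennreal step_variance"
proof -
  define m where "m = min (fuzzy Q 0) (fuzzy Q 1)"
  have m: "m > 0" "m \<le> fuzzy Q a" using fuzzy_pos by (auto simp: m_def) (cases a, auto)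
  have "(\<integral>\<^sup>+s. ennreal ((real_of_int s)\<^sup>2) \<partial>step_law Q a) =
        (\<integral>\<^sup>+s. ennreal (step_weight a s * (real_of_int s)\<^sup>2) \<partial>count_space UNIV)"
    unfolding nn_integral_step_law by (simp add: ennreal_mult step_weight_nonneg)
  also have "\<dots> \<le> (\<integral>\<^sup>+s. ennreal ((real_of_int s)\<^sup>2 * Q s * (1 / m)) \<partial>count_space UNIV)"
  proof (intro nn_integral_mono ennreal_leI)
    fix s
    have "step_weight a s \<le> Q s * (1 / m)"
      using m Q_pos[of s] by (auto simp: step_weight_def indicator_def intro!: divide_left_mono)
    then show "step_weight a s * (real_of_int s)\<^sup>2 \<le> (real_of_int s)\<^sup>2 * Q s * (1 / m)"
      using mult_right_mono[of "step_weight a s" "Q s * (1 / m)" "(real_of_int s)\<^sup>2"] by (simp add: mult_ac)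
  qed
  also have "\<dots> = ennreal (\<Sum>\<^sub>\<infinity>s. (real_of_int s)\<^sup>2 * Q s * (1 / m))"
    using m(1) Q_pos
    by (intro nn_integral_count_space_infsum summable_on_cmult_left Q_moment_summable_on) (simp add: less_imp_le)
  also have "\<dots> = ennreal step_variance"
    unfolding step_variance_def m_def[symmetric] by (subst infsum_cmult_left') simp
  finally show ?thesis .
qed

lemma step_law_square_integrable: "integrable (step_law Q a) (\<lambda>s. (real_of_int s)\<^sup>2)"
  using nn_integral_step_law_square[of a] by (intro integrableI_bounded) (auto intro: order.strict_trans1)

lemma step_law_integrable: "integrable (step_law Q a) real_of_int"
proof (rule Bochner_Integration.integrable_bound[OF step_law_square_integrable])
  have "\<bar>real_of_int s\<bar> \<le> (real_of_int s)\<^sup>2" for s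
  proof -
    have "\<bar>s\<bar> \<le> \<bar>s\<bar> * \<bar>s\<bar>" unfolding mult_le_cancel_left1 by auto
    then have "\<bar>s\<bar> \<le> s\<^sup>2" by (simp add: power2_eq_square)
    then show ?thesis by (metis of_int_abs of_int_le_iff of_int_power)
  qed
  then show "AE s in step_law Q a. norm (real_of_int s) \<le> norm ((real_of_int s)\<^sup>2)" by simp
qed simp

lemma step_law_mean: "(\<integral>s. real_of_int s \<partial>step_law Q a) = 0"
  using integral_step_law_uminus[where f=real_of_int and a=a] by simp

lemma step_law_second_moment:
  "(\<integral>s. (real_of_int s)\<^sup>2 \<partial>step_law Q a) \<le> step_variance"
  using nn_integral_step_law_square[of a] step_variance_nonneg
  by (subst (asm) nn_integral_eq_integral[OF step_law_square_integrable]) auto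

section \<open>Characteristic functions and exponential moments of the step laws\<close>

definition step_char :: "bit \<Rightarrow> real \<Rightarrow> complex" where
  "step_char a u = (\<integral>s. iexp (u * real_of_int s) \<partial>step_law Q a)"

lemma step_char_le_1: "cmod (step_char a u) \<le> 1"
  unfolding step_char_def
  by (rule order_trans[OF integral_norm_bound]) (simp add: step.prob_space)

text \<open>The atoms \<open>j\<close> and \<open>- j\<close>, distinct because
  \<open>j \<noteq> 0\<close>, have the same weight \<open>p\<close> and together contribute the
  real number \<open>2 * p * cos (u * j)\<close>; the remaining mass contributes at most
  \<open>1 - 2 * p\<close>.\<close>

lemma step_char_bound:
  assumes "of_int j = a" "j \<noteq> 0"
  shows "cmod (step_char a u) \<le> 1 - 2 * step_weight a j * (1 - \<bar>cos (u * real_of_int j)\<bar>)"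
proof -
  let ?p = "step_weight a j" and ?e = "\<lambda>s. iexp (u * real_of_int s)"
  have ind: "integrable (step_law Q a) (\<lambda>s. indicator A s *\<^sub>R ?e s)" for A
    by (intro step.integrable_const_bound[where B=1]) (auto simp: indicator_def)
  have "step_char a u = (\<integral>s. indicator {j, -j} s *\<^sub>R ?e s + indicator (- {j, -j}) s *\<^sub>R ?e s \<partial>step_law Q a)"
    unfolding step_char_def by (intro Bochner_Integration.integral_cong) (auto simp: indicator_def)
  also have "\<dots> = (\<integral>s. indicator {j, -j} s *\<^sub>R ?e s \<partial>step_law Q a) + (\<integral>s. indicator (- {j, -j}) s *\<^sub>R ?e s \<partial>step_law Q a)"
    by (intro Bochner_Integration.integral_add ind)
  also have "(\<integral>s. indicator {j, -j} s *\<^sub>R ?e s \<partial>step_law Q a) =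
      (\<integral>s. indicator {j} s *\<^sub>R ?e j + indicator {-j} s *\<^sub>R ?e (- j) \<partial>step_law Q a)"
    using assms(2) by (intro Bochner_Integration.integral_cong) (auto simp: indicator_def)
  also have "\<dots> = ?p *\<^sub>R ?e j + ?p *\<^sub>R ?e (- j)"
  proof (subst Bochner_Integration.integral_add)
    have int: "integrable (step_law Q a) (\<lambda>s. indicator {k} s *\<^sub>R ?e l)" for k l
      by (intro step.integrable_const_bound[where B=1]) (auto simp: indicator_def)
    show "integrable (step_law Q a) (\<lambda>s. indicator {j} s *\<^sub>R ?e j)" by (rule int)
    show "integrable (step_law Q a) (\<lambda>s. indicator {-j} s *\<^sub>R ?e (-j))" by (rule int)
    show "(\<integral>s. indicator {j} s *\<^sub>R ?e j \<partial>step_law Q a) + (\<integral>s. indicator {- j} s *\<^sub>R ?e (- j) \<partial>step_law Q a) =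
        ?p *\<^sub>R ?e j + ?p *\<^sub>R ?e (- j)"
      using has_bochner_integral_integral_eq[OF has_bochner_integral_indicator, of "{j}" "step_law Q a" "?e j"]
        has_bochner_integral_integral_eq[OF has_bochner_integral_indicator, of "{-j}" "step_law Q a" "?e (- j)"]
      by (simp add: measure_step_law_singleton step_weight_sym step.emeasure_eq_measure)
  qed
  also have "\<dots> = complex_of_real (2 * ?p * cos (u * real_of_int j))"
    by (simp add: complex_eq_iff Re_exp Im_exp)
  finally have eq: "step_char a u = complex_of_real (2 * ?p * cos (u * real_of_int j)) +
      (\<integral>s. indicator (- {j, -j}) s *\<^sub>R ?e s \<partial>step_law Q a)" .
  have "cmod (\<integral>s. indicator (- {j, -j}) s *\<^sub>R ?e s \<partial>step_law Q a) \<le>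
      (\<integral>s. indicator (- {j, -j}) s \<partial>step_law Q a)"
    by (rule order_trans[OF integral_norm_bound]) (simp add: indicator_def)
  also have "\<dots> = 1 - measure (step_law Q a) {j, -j}"
    using step.prob_compl[of "{j, -j}" a] by (simp add: Compl_eq_Diff_UNIV)
  also have "measure (step_law Q a) {j, -j} = 2 * ?p"
    using assms(2) step.finite_measure_Union[of "{j}" a "{-j}"]
    by (simp add: measure_step_law_singleton step_weight_sym insert_commute)
  finally have "cmod (step_char a u) \<le> \<bar>2 * ?p * cos (u * real_of_int j)\<bar> + (1 - 2 * ?p)"
    unfolding eq by (intro norm_triangle_mono) (simp_all only: norm_of_real order_refl)
  also have "\<dots> = 1 - 2 * ?p * (1 - \<bar>cos (u * real_of_int j)\<bar>)"
    using step_weight_nonneg[of a j] by (simp add: abs_mult algebra_simps)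
  finally show ?thesis .
qed

lemma step_char_uniform_bound:
  fixes \<delta> :: real
  assumes \<delta>: "0 < \<delta>"
  obtains q where "0 < q" "q < 1" "\<And>a u. \<delta> \<le> \<bar>u\<bar> \<Longrightarrow> \<bar>u\<bar> \<le> 1 \<Longrightarrow> cmod (step_char a u) \<le> q"
proof -
  \<comment> \<open>The even class requires a nonzero representative, hence 2. As
    \<open>\<bar>u\<bar> \<le> 1\<close>, the angle \<open>\<bar>u\<bar> * j a\<close> stays between
    \<delta> and 2, strictly inside the interval from 0 to pi.\<close>
  define j :: "bit \<Rightarrow> int" where "j a = (if a = 0 then 2 else 1)" for a
  have j: "of_int (j a) = a" "j a \<noteq> 0" for a
    by (cases a; simp add: j_def)+
  \<comment> \<open>The cosine decreases on \<open>[0, pi]\<close>, so its modulus on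
    \<open>[\<delta>, 2]\<close> is controlled by the two ends; \<open>min \<delta> 1\<close> keeps
    the left end below pi for every \<delta>.\<close>
  define \<kappa> where "\<kappa> = max (\<bar>cos (min \<delta> 1)\<bar>) (\<bar>cos 2\<bar>)"
  have cos_lt: "\<bar>cos x\<bar> < 1" if "0 < x" "x < pi" for x :: real
  proof -
    have "sin x > 0" using that by (rule sin_gt_zero)
    then have "(cos x)\<^sup>2 < 1" by (simp add: cos_squared_eq)
    then show ?thesis by (simp add: abs_square_less_1)
  qed
  have "2 < pi" using pi_gt3 by simp
  have \<kappa>1: "\<kappa> < 1"
    unfolding \<kappa>_def using cos_lt[of "min \<delta> 1"] cos_lt[of 2] \<delta> \<open>2 < pi\<close> by simp
  have \<kappa>: "\<bar>cos x\<bar> \<le> \<kappa>" if "\<delta> \<le> x" "x \<le> 2" for x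
  proof -
    have "cos x \<le> cos (min \<delta> 1)" using that \<delta> \<open>2 < pi\<close> by (intro cos_monotone_0_pi_le) auto
    moreover have "cos 2 \<le> cos x" using that \<delta> \<open>2 < pi\<close> by (intro cos_monotone_0_pi_le) auto
    ultimately show ?thesis unfolding \<kappa>_def by linarith
  qed
  define p where "p = min (step_weight 0 (j 0)) (step_weight 1 (j 1))"
  have "step_weight a (j a) > 0" for a unfolding step_weight_pos_iff by (rule j)
  then have p: "p > 0" "p \<le> step_weight a (j a)" for a
    unfolding p_def by (simp, cases a) auto
  \<comment> \<open>The maximum with \<open>1/2\<close> secures \<open>0 < q\<close>, which
    \<open>power_times_geometric_bound\<close> uses for its logarithm.\<close>
  define q where "q = max (1/2) (1 - 2 * p * (1 - \<kappa>))"
  show ?thesis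
  proof (rule that[of q])
    show "0 < q" "q < 1" using p \<kappa>1 by (auto simp: q_def)
    fix a :: bit and u :: real
    assume u: "\<delta> \<le> \<bar>u\<bar>" "\<bar>u\<bar> \<le> 1"
    have "\<bar>cos (u * real_of_int (j a))\<bar> = \<bar>cos (\<bar>u\<bar> * real_of_int (j a))\<bar>"
      by (cases "u \<ge> 0") auto
    also have "\<dots> \<le> \<kappa>" using u by (intro \<kappa>) (auto simp: j_def)
    finally have c: "\<bar>cos (u * real_of_int (j a))\<bar> \<le> \<kappa>" .
    have "p * (1 - \<kappa>) \<le> step_weight a (j a) * (1 - \<bar>cos (u * real_of_int (j a))\<bar>)"
      using p c \<kappa>1 by (intro mult_mono) (auto simp: step_weight_nonneg)
    then have "cmod (step_char a u) \<le> 1 - 2 * p * (1 - \<kappa>)"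
      using step_char_bound[OF j[of a], of u] by linarith
    then show "cmod (step_char a u) \<le> q" by (simp add: q_def)
  qed
qed

text \<open>The quadratic factor makes the product over all edges converge later: \<open>u\<close>
  will be proportional to \<open>edge_weight\<close>, whose squares are summable while the weights
  themselves sum to 1 on every level. It comes from \<open>cosh (2 * z) = 1 + 2 * (sinh z)^2\<close>
  and \<open>sinh (l * y) \<le> l * sinh y\<close> for \<open>l\<close> between 0 and 1.\<close>

lemma cosh_le_of_scaling:
  fixes u t x :: real
  assumes "t > 0" "\<bar>u\<bar> \<le> t"
  shows "cosh (u * x) \<le> 1 + (u / t)\<^sup>2 * cosh (t * x)"
proof -
  have sinh_le: "sinh (l * y) \<le> l * sinh y" if "0 \<le> l" "l \<le> 1" "0 \<le> y" for l y :: real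
  proof -
    have "(\<lambda>y. l * sinh y - sinh (l * y)) 0 \<le> (\<lambda>y. l * sinh y - sinh (l * y)) y"
    proof (rule DERIV_nonneg_imp_nondecreasing[OF that(3)])
      fix z :: real assume z: "0 \<le> z" "z \<le> y"
      have "DERIV (\<lambda>y. l * sinh y - sinh (l * y)) z :> l * cosh z - l * cosh (l * z)"
        by (auto intro!: derivative_eq_intros)
      moreover have "cosh (l * z) \<le> cosh z"
        using that z by (subst cosh_real_nonneg_le_iff) (auto simp: mult_left_le_one_le)
      ultimately show "\<exists>y. DERIV (\<lambda>y. l * sinh y - sinh (l * y)) z :> y \<and> 0 \<le> y"
        using that by (intro exI[of _ "l * cosh z - l * cosh (l * z)"]) (auto simp: mult_left_mono)
    qed
    then show ?thesis by simp
  qed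
  define l where "l = \<bar>u\<bar> / t"
  define y where "y = t * \<bar>x\<bar> / 2"
  have l: "0 \<le> l" "l \<le> 1" "0 \<le> y" using assms by (auto simp: l_def y_def)
  have cosh_half: "cosh (2 * z) = 1 + 2 * (sinh z)\<^sup>2" for z :: real
    by (simp add: cosh_double cosh_square_eq)
  have "cosh (u * x) = cosh (2 * (l * y))"
    using assms by (simp add: l_def y_def field_simps abs_mult[symmetric])
  also have "\<dots> \<le> 1 + 2 * (l * sinh y)\<^sup>2"
    unfolding cosh_half using sinh_le[OF l] l by (simp add: power_mono)
  also have "\<dots> = 1 + l\<^sup>2 * (2 * (sinh y)\<^sup>2)" by (simp add: power_mult_distrib)
  also have "\<dots> \<le> 1 + l\<^sup>2 * cosh (2 * y)"
    unfolding cosh_half by (intro add_left_mono mult_left_mono) auto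
  also have "cosh (2 * y) = cosh (t * x)"
    using assms by (simp add: y_def abs_mult flip: cosh_real_abs[of "t * x"])
  also have "l\<^sup>2 = (u / t)\<^sup>2" by (simp add: l_def power_divide)
  finally show ?thesis by simp
qed

text \<open>By symmetry of the step laws \<open>exp\<close> may be replaced by \<open>cosh\<close>,
  to which \<open>cosh_le_of_scaling\<close> applies; \<open>1 + x \<le> exp x\<close> then gives a
  Gaussian form that multiplies well over edges. The constant is \<open>D / t^2\<close>, where
  \<open>D\<close> bounds the exponential moments at \<open>t\<close> of both classes.\<close>

lemma step_law_mgf_bound:
  assumes t: "t > 0" "(\<lambda>j. exp (t * real_of_int j) * Q j) summable_on UNIV"
  obtains K where "K \<ge> 0" "\<And>a u. \<bar>u\<bar> \<le> t \<Longrightarrow>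
     (\<integral>\<^sup>+s. ennreal (exp (u * real_of_int s)) \<partial>step_law Q a) \<le> ennreal (exp (K * u\<^sup>2))"
proof -
  have cosh: "(\<integral>\<^sup>+s. ennreal (exp (u * real_of_int s)) \<partial>step_law Q a) =
              (\<integral>\<^sup>+s. ennreal (cosh (u * real_of_int s)) \<partial>step_law Q a)" for u a
  proof -
    let ?I = "\<lambda>f. (\<integral>\<^sup>+s. ennreal (f (real_of_int s)) \<partial>step_law Q a)"
    have "?I (\<lambda>s. exp (- u * s)) = ?I (\<lambda>s. exp (u * s))"
      using nn_integral_step_law_uminus[where f="\<lambda>s. ennreal (exp (u * real_of_int s))" and a=a] by simp
    then have "2 * ?I (\<lambda>s. exp (u * s)) = ?I (\<lambda>s. exp (u * s)) + ?I (\<lambda>s. exp (- u * s))"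
      by (simp add: mult_2)
    also have "\<dots> = ?I (\<lambda>s. 2 * cosh (u * s))"
    proof (subst nn_integral_add[symmetric])
      have "ennreal (exp (u * z)) + ennreal (exp (- u * z)) = ennreal (2 * cosh (u * z))" for z
        by (subst ennreal_plus[symmetric]) (simp_all add: cosh_def field_simps del: ennreal_plus)
      then show "(\<integral>\<^sup>+s. ennreal (exp (u * real_of_int s)) + ennreal (exp (- u * real_of_int s)) \<partial>step_law Q a) =
          ?I (\<lambda>s. 2 * cosh (u * s))" by simp
    qed auto
    also have "\<dots> = 2 * ?I (\<lambda>s. cosh (u * s))"
      by (simp add: ennreal_mult nn_integral_cmult)
    finally show ?thesis by (simp add: ennreal_mult_cancel_left)
  qed
  define C where "C a = (\<integral>\<^sup>+s. ennreal (exp (t * real_of_int s)) \<partial>step_law Q a)" for a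
  have Cfin: "C a < \<infinity>" for a
  proof -
    have "C a = (\<integral>\<^sup>+s. ennreal (step_weight a s * exp (t * real_of_int s)) \<partial>count_space UNIV)"
      unfolding C_def nn_integral_step_law by (simp add: ennreal_mult step_weight_nonneg)
    also have "\<dots> \<le> (\<integral>\<^sup>+s. ennreal (exp (t * real_of_int s) * Q s * (1 / fuzzy Q a)) \<partial>count_space UNIV)"
      using Q_pos fuzzy_pos[of a]
      by (intro nn_integral_mono ennreal_leI) (auto simp: step_weight_def indicator_def less_imp_le mult.commute)
    also have "\<dots> = ennreal (\<Sum>\<^sub>\<infinity>s. exp (t * real_of_int s) * Q s * (1 / fuzzy Q a))"
      using t(2) Q_pos fuzzy_pos[of a]
      by (intro nn_integral_count_space_infsum summable_on_cmult_left) (auto simp: less_imp_le)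
    finally show ?thesis by (auto simp: less_top[symmetric] top_unique)
  qed
  define D where "D = max (enn2real (C 0)) (enn2real (C 1))"
  have D: "C a \<le> ennreal D" for a
  proof -
    have "C a = ennreal (enn2real (C a))" using Cfin[of a] by (simp add: ennreal_enn2real)
    also have "\<dots> \<le> ennreal D" unfolding D_def by (intro ennreal_leI) (cases a, auto)
    finally show ?thesis .
  qed
  have D0: "D \<ge> 0" by (simp add: D_def le_max_iff_disj)
  show ?thesis
  proof (rule that[of "D / t\<^sup>2"])
    show "D / t\<^sup>2 \<ge> 0" using D0 by simp
    fix a and u :: real assume u: "\<bar>u\<bar> \<le> t"
    have "(\<integral>\<^sup>+s. ennreal (exp (u * real_of_int s)) \<partial>step_law Q a) =
       (\<integral>\<^sup>+s. ennreal (cosh (u * real_of_int s)) \<partial>step_law Q a)" by (rule cosh)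
    also have "\<dots> \<le> (\<integral>\<^sup>+s. ennreal 1 + ennreal ((u / t)\<^sup>2) * ennreal (cosh (t * real_of_int s)) \<partial>step_law Q a)"
      using cosh_le_of_scaling[OF t(1) u]
      by (intro nn_integral_mono)
         (auto simp: ennreal_mult[symmetric] ennreal_plus[symmetric] ennreal_leI cosh_real_nonneg simp del: ennreal_plus ennreal_1)
    also have "\<dots> = ennreal 1 + ennreal ((u / t)\<^sup>2) * C a"
      unfolding C_def cosh by (subst nn_integral_add) (auto simp: nn_integral_cmult step.emeasure_space_1[simplified])
    also have "\<dots> \<le> ennreal 1 + ennreal ((u / t)\<^sup>2) * ennreal D"
      by (intro add_left_mono mult_left_mono D) auto
    also have "\<dots> = ennreal (1 + D / t\<^sup>2 * u\<^sup>2)"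
      using D0 by (simp add: ennreal_mult[symmetric] ennreal_plus[symmetric] power_divide mult.commute del: ennreal_plus ennreal_1)
    also have "\<dots> \<le> ennreal (exp (D / t\<^sup>2 * u\<^sup>2))"
      by (intro ennreal_leI) (metis exp_ge_add_one_self)
    finally show "(\<integral>\<^sup>+s. ennreal (exp (u * real_of_int s)) \<partial>step_law Q a) \<le> ennreal (exp (D / t\<^sup>2 * u\<^sup>2))" .
  qed
qed

end

section \<open>Independent steps along the edges\<close>

lemma indep_vars_PiM_coordinates:
  assumes "\<And>i. i \<in> I \<Longrightarrow> prob_space (M i)" "I \<noteq> {}"
  shows "prob_space.indep_vars (PiM I M) M (\<lambda>i \<omega>. \<omega> i) I"
proof -
  interpret prob_space "PiM I M" using assms(1) by (rule prob_space_PiM)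
  have "distr (PiM I M) (PiM I M) (\<lambda>x. \<lambda>i\<in>I. x i) = distr (PiM I M) (PiM I M) (\<lambda>x. x)"
    by (intro distr_cong) (auto simp: space_PiM PiE_def extensional_restrict)
  also have "\<dots> = PiM I M" by simp
  also have "\<dots> = (\<Pi>\<^sub>M i\<in>I. distr (PiM I M) (M i) (\<lambda>\<omega>. \<omega> i))"
    using assms(1) by (intro PiM_cong) (auto simp: distr_PiM_component)
  finally show ?thesis
    using assms(2) by (subst indep_vars_iff_distr_eq_PiM') auto
qed

text \<open>The inverse of \<open>q ^ n\<close> is \<open>exp (c * n)\<close>, which dominates each
  single term of its power series. The exponent \<open>n - 1\<close> allows one edge to be removed
  from a level in \<open>char_decay\<close>.\<close>

lemma power_times_geometric_bound:
  fixes q :: real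
  assumes "0 < q" "q < 1"
  obtains B where "\<And>n::nat. n \<ge> 1 \<Longrightarrow> real n ^ m * q ^ (n - 1) \<le> B"
proof (rule that)
  fix n :: nat assume n: "n \<ge> 1"
  define c where "c = - ln q"
  have c: "c > 0" using assms by (simp add: c_def)
  have "(c * real n) ^ m / fact m = (\<Sum>k\<in>{m}. inverse (fact k) *\<^sub>R (c * real n) ^ k)"
    by (simp add: field_simps)
  also have "\<dots> \<le> exp (c * real n)"
    unfolding exp_def using c by (intro sum_le_suminf summable_exp_generic) auto
  also have "\<dots> = inverse (q ^ n)"
    using assms by (simp add: c_def exp_minus exp_of_nat2_mult)
  finally have "real n ^ m * q ^ n \<le> fact m / c ^ m"
    using c assms by (simp add: field_simps power_mult_distrib)
  moreover have "q ^ n = q * q ^ (n - 1)" using n by (metis power_eq_if not_one_le_zero)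
  ultimately show "real n ^ m * q ^ (n - 1) \<le> fact m / c ^ m / q"
    using assms by (subst pos_le_divide_eq) (simp_all add: mult_ac)
qed

text \<open>The fraction of every later sphere that lies behind the edge, hence the coefficient of
  its increment in the limiting average.\<close>

definition edge_weight :: "'g::finite vertex \<times> 'g vertex \<Rightarrow> real" where
  "edge_weight e = 1 / real (card (sphere_at (depth (snd e)) :: 'g vertex set))"

text \<open>Level 0 would be the spurious loop at the root, so genuine levels appear as
  \<open>edge_level (Suc k)\<close>.\<close>

definition edge_level :: "nat \<Rightarrow> ('g vertex \<times> 'g vertex) set" where
  "edge_level k = (\<lambda>y. (parent y, y)) ` sphere_at k"

definition linear_form :: "('e \<Rightarrow> real) \<Rightarrow> 'e set \<Rightarrow> ('e \<Rightarrow> int) \<Rightarrow> real" where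
  "linear_form c F \<xi> = (\<Sum>e\<in>F. c e * real_of_int (\<xi> e))"

definition edges_upto :: "nat \<Rightarrow> ('g vertex \<times> 'g vertex) set" where
  "edges_upto r = (\<Union>k<r. edge_level (Suc k))"

lemma finite_edge_level [simp]: "finite (edge_level k :: ('g::finite vertex \<times> 'g vertex) set)"
  by (simp add: edge_level_def)

lemma finite_edges_upto [simp]: "finite (edges_upto r :: ('g::finite vertex \<times> 'g vertex) set)"
  by (simp add: edges_upto_def)

lemma edge_level_outward: "edge_level (Suc k) \<subseteq> outward_edges"
  by (auto simp: edge_level_def outward_edges_iff sphere_at_eq)

lemma edges_upto_outward: "edges_upto r \<subseteq> outward_edges"
  using edge_level_outward by (auto simp: edges_upto_def)

lemma outward_edges_nonempty: "outward_edges \<noteq> {}"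
proof -
  have "generator i \<noteq> 1" for i :: 'a
    by transfer simp
  then show ?thesis by (auto simp: outward_edges_eq)
qed

lemma outward_edge_level: "e \<in> outward_edges \<Longrightarrow> \<exists>k. e \<in> edge_level (Suc k)"
proof -
  assume "e \<in> outward_edges"
  then obtain y where y: "y \<noteq> 1" "e = (parent y, y)" by (auto simp: outward_edges_eq)
  then obtain k where "depth y = Suc k" by (metis depth_eq_0_iff not0_implies_Suc)
  then show ?thesis using y by (auto simp: edge_level_def sphere_at_eq)
qed

lemma edge_weight_level: "e \<in> edge_level k \<Longrightarrow> edge_weight e = 1 / real (card (sphere_at k :: 'g vertex set))"
  for e :: "'g::finite vertex \<times> 'g vertex"
  by (auto simp: edge_level_def edge_weight_def sphere_at_eq)

lemma card_edge_level: "card (edge_level k :: ('g::finite vertex \<times> 'g vertex) set) = card (sphere_at k :: 'g vertex set)"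
  unfolding edge_level_def by (rule card_image) (auto simp: inj_on_def)

lemma edge_average_linear_form: "edge_average k \<xi> = linear_form edge_weight (edge_level k) \<xi>"
proof -
  have "linear_form edge_weight (edge_level k) \<xi> =
      (\<Sum>e\<in>edge_level k. 1 / real (card (sphere_at k :: 'a vertex set)) * real_of_int (\<xi> e))"
    unfolding linear_form_def by (intro sum.cong) (auto simp: edge_weight_level)
  also have "\<dots> = edge_average k \<xi>"
    unfolding edge_level_def edge_average_def
    by (subst sum.reindex) (auto simp: inj_on_def sum_divide_distrib)
  finally show ?thesis ..
qed

lemma sum_edge_average: "(\<Sum>k<r. edge_average (Suc k) \<xi>) = linear_form edge_weight (edges_upto r) \<xi>"
  unfolding edge_average_linear_form linear_form_def edges_upto_def
  by (rule sum.UNION_disjoint[symmetric]) (simp, simp, auto simp: edge_level_def sphere_at_eq)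

text \<open>The limit of the averages pinned at 0 in the root, as a function of the outward
  increments only.\<close>

definition average_sum :: "('g::finite vertex \<times> 'g vertex \<Rightarrow> int) \<Rightarrow> real" where
  "average_sum \<xi> = (\<Sum>k. edge_average (Suc k) \<xi>)"

lemma card_sphere_at_pos:
  assumes "CARD('g::finite) \<ge> 3"
  shows "card (sphere_at k :: 'g vertex set) > 0"
  using assms by (cases k) (auto simp: card_sphere_at)

lemma card_sphere_at_ge:
  assumes "CARD('g::finite) \<ge> 3"
  shows "2 ^ k \<le> card (sphere_at (Suc k) :: 'g vertex set)"
proof -
  have "2 ^ k \<le> (CARD('g) - 1) ^ k" using assms by (intro power_mono) auto
  also have "\<dots> \<le> CARD('g) * (CARD('g) - 1) ^ k" by simp
  finally show ?thesis by (simp add: card_sphere_at)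
qed

lemma edge_weight_pos:
  assumes "CARD('g::finite) \<ge> 3"
  shows "edge_weight (e :: 'g vertex \<times> 'g vertex) > 0"
  using card_sphere_at_pos[OF assms] by (simp add: edge_weight_def)

lemma edge_weight_square_sum:
  assumes "CARD('g::finite) \<ge> 3"
  shows "(\<Sum>e\<in>(edge_level (Suc k) :: ('g vertex \<times> 'g vertex) set). (edge_weight e)\<^sup>2) \<le> (1/2)^k"
proof -
  let ?n = "real (card (sphere_at (Suc k) :: 'g vertex set))"
  have "(\<Sum>e\<in>(edge_level (Suc k) :: ('g vertex \<times> 'g vertex) set). (edge_weight e)\<^sup>2) = ?n * (1 / ?n)\<^sup>2"
    by (simp add: edge_weight_level card_edge_level)
  also have "\<dots> = 1 / ?n" by (simp add: power2_eq_square)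
  also have "\<dots> \<le> (1/2)^k"
  proof -
    have "2 ^ k \<le> ?n" using card_sphere_at_ge[OF assms, of k] by (metis numeral_power_le_of_nat_cancel_iff)
    then show ?thesis by (simp add: power_divide frac_le)
  qed
  finally show ?thesis .
qed

section \<open>Moments, characteristic functions and limits of weighted sums of steps\<close>

context height_weight
begin

text \<open>The conditional law of the outward increments. The classes \<open>a\<close> form an
  arbitrary function on edges, so a bound with a constant independent of \<open>a\<close> is uniform
  in the hidden spins.\<close>

definition step_product :: "('g::finite vertex \<times> 'g vertex \<Rightarrow> bit) \<Rightarrow> ('g vertex \<times> 'g vertex \<Rightarrow> int) measure" where
  "step_product a = PiM outward_edges (\<lambda>e. step_law Q (a e))"

lemma prob_space_step_product: "prob_space (step_product a)"
  unfolding step_product_def by (intro prob_space_PiM prob_space_step_law)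

sublocale product: prob_space "step_product a" for a
  by (rule prob_space_step_product)

lemma space_step_product: "space (step_product a) = outward_edges \<rightarrow>\<^sub>E UNIV"
  by (simp add: step_product_def space_PiM)

lemma sets_step_product: "sets (step_product a) = sets (PiM outward_edges (\<lambda>_. count_space UNIV))"
  unfolding step_product_def by (intro sets_PiM_cong) auto

lemma measurable_step_coordinate [measurable]: "(\<lambda>\<xi>. \<xi> e) \<in> measurable (step_product a) (count_space UNIV)"
proof (cases "e \<in> outward_edges")
  case True
  then show ?thesis
    unfolding measurable_cong_sets[OF sets_step_product refl] by measurable
next
  case False
  have "\<xi> e = undefined" if "\<xi> \<in> space (step_product a)" for \<xi>
    using that False unfolding space_step_product by (rule PiE_arb)
  then have "(\<lambda>\<xi>. \<xi> e) \<in> measurable (step_product a) (count_space UNIV) \<longleftrightarrow>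
      (\<lambda>\<xi>. undefined :: int) \<in> measurable (step_product a) (count_space UNIV)"
    by (rule measurable_cong)
  then show ?thesis by simp
qed

lemma linear_form_measurable [measurable]: "linear_form c F \<in> borel_measurable (step_product a)"
  unfolding linear_form_def by measurable

lemma edge_average_measurable [measurable]: "edge_average k \<in> borel_measurable (step_product a)"
  unfolding edge_average_def by measurable

lemma average_sum_measurable [measurable]: "average_sum \<in> borel_measurable (step_product a)"
  unfolding average_sum_def by measurable

lemma distr_step_coordinate:
  assumes "e \<in> outward_edges"
  shows "distr (step_product a) (step_law Q (a e)) (\<lambda>\<xi>. \<xi> e) = step_law Q (a e)"
  unfolding step_product_def using assms prob_space_step_law by (intro distr_PiM_component)

lemma nn_integral_step_coordinate:
  assumes "e \<in> outward_edges"
  shows "(\<integral>\<^sup>+\<xi>. f (\<xi> e) \<partial>step_product a) = (\<integral>\<^sup>+s. f s \<partial>step_law Q (a e))"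
  by (subst distr_step_coordinate[OF assms, symmetric], subst nn_integral_distr)
     auto

lemma integral_step_coordinate:
  fixes f :: "int \<Rightarrow> 'b::{banach, second_countable_topology}"
  assumes "e \<in> outward_edges"
  shows "(\<integral>\<xi>. f (\<xi> e) \<partial>step_product a) = (\<integral>s. f s \<partial>step_law Q (a e))"
  by (subst distr_step_coordinate[OF assms, symmetric], subst integral_distr)
     auto

lemma integrable_step_coordinate:
  fixes f :: "int \<Rightarrow> 'b::{banach, second_countable_topology}"
  assumes "e \<in> outward_edges" "integrable (step_law Q (a e)) f"
  shows "integrable (step_product a) (\<lambda>\<xi>. f (\<xi> e))"
  using assms(2)
  by (subst (asm) distr_step_coordinate[OF assms(1), symmetric], subst (asm) integrable_distr_eq)
     auto

lemma indep_steps: "product.indep_vars a (\<lambda>e. step_law Q (a e)) (\<lambda>e \<xi>. \<xi> e) outward_edges"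
  unfolding step_product_def
  by (intro indep_vars_PiM_coordinates prob_space_step_law outward_edges_nonempty)

lemma indep_step_functions:
  assumes "F \<subseteq> outward_edges" "\<And>e. g e \<in> UNIV \<rightarrow> space (N e)"
  shows "product.indep_vars a N (\<lambda>e \<xi>. g e (\<xi> e)) F"
  by (rule product.indep_vars_compose2[OF product.indep_vars_subset[OF indep_steps assms(1)]])
     (use assms(2) in auto)

lemma char_linear_form:
  assumes "F \<subseteq> outward_edges"
  shows "char (distr (step_product a) borel (linear_form c F)) t = (\<Prod>e\<in>F. step_char (a e) (t * c e))"
proof -
  have "char (distr (step_product a) borel (linear_form c F)) t =
      (\<Prod>e\<in>F. char (distr (step_product a) borel (\<lambda>\<xi>. c e * real_of_int (\<xi> e))) t)"
    unfolding linear_form_def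
    by (intro product.char_distr_sum indep_step_functions[OF assms, where g="\<lambda>e s. c e * real_of_int s"]) auto
  also have "\<dots> = (\<Prod>e\<in>F. step_char (a e) (t * c e))"
  proof (intro prod.cong refl)
    fix e assume "e \<in> F"
    then have e: "e \<in> outward_edges" using assms by auto
    have "char (distr (step_product a) borel (\<lambda>\<xi>. c e * real_of_int (\<xi> e))) t =
       (\<integral>\<xi>. iexp (t * (c e * real_of_int (\<xi> e))) \<partial>step_product a)"
      unfolding char_def by (subst integral_distr) auto
    also have "\<dots> = (\<integral>s. iexp (t * (c e * real_of_int s)) \<partial>step_law Q (a e))"
      by (rule integral_step_coordinate[OF e, where f="\<lambda>s. iexp (t * (c e * real_of_int s))"])
    finally show "char (distr (step_product a) borel (\<lambda>\<xi>. c e * real_of_int (\<xi> e))) t = step_char (a e) (t * c e)"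
      by (simp add: step_char_def mult.assoc)
  qed
  finally show ?thesis .
qed

text \<open>Independence and mean zero remove the cross terms.\<close>

lemma linear_form_second_moment:
  assumes "finite F" "F \<subseteq> outward_edges"
  shows "(\<integral>\<^sup>+\<xi>. ennreal ((linear_form c F \<xi>)\<^sup>2) \<partial>step_product a) \<le> ennreal (step_variance * (\<Sum>e\<in>F. (c e)\<^sup>2))"
proof -
  let ?N = "step_product a"
  let ?X = "\<lambda>e \<xi>. real_of_int (\<xi> e)"
  have intX: "integrable ?N (?X e)" if "e \<in> F" for e
    using that assms(2) by (intro integrable_step_coordinate step_law_integrable) auto
  have mean: "(\<integral>\<xi>. ?X e \<xi> \<partial>?N) = 0" if "e \<in> F" for e
    using that assms(2) step_law_mean by (subst integral_step_coordinate) auto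
  have intX2: "integrable ?N (\<lambda>\<xi>. (?X e \<xi>)\<^sup>2)" if "e \<in> F" for e
    using that assms(2) by (intro integrable_step_coordinate[where f="\<lambda>s. (real_of_int s)\<^sup>2"] step_law_square_integrable) auto
  have cross: "integrable ?N (\<lambda>\<xi>. ?X e \<xi> * ?X e' \<xi>) \<and>
     (\<integral>\<xi>. ?X e \<xi> * ?X e' \<xi> \<partial>?N) \<le> (if e = e' then step_variance else 0)" if "e \<in> F" "e' \<in> F" for e e'
  proof (cases "e = e'")
    case True
    have "(\<integral>\<xi>. (?X e \<xi>)\<^sup>2 \<partial>?N) = (\<integral>s. (real_of_int s)\<^sup>2 \<partial>step_law Q (a e))"
      using that assms(2) by (intro integral_step_coordinate[where f="\<lambda>s. (real_of_int s)\<^sup>2"]) auto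
    then show ?thesis using True that intX2[of e] step_law_second_moment[of "a e"]
      by (simp add: power2_eq_square)
  next
    case False
    have ind: "product.indep_vars a (\<lambda>_. borel) ?X {e, e'}"
      using that assms(2) by (intro indep_step_functions[where g="\<lambda>_. real_of_int"]) auto
    have "integrable ?N (\<lambda>\<xi>. \<Prod>i\<in>{e, e'}. ?X i \<xi>)"
      using that by (intro product.indep_vars_integrable ind) (auto intro: intX)
    moreover have "(\<integral>\<xi>. (\<Prod>i\<in>{e, e'}. ?X i \<xi>) \<partial>?N) = (\<Prod>i\<in>{e, e'}. \<integral>\<xi>. ?X i \<xi> \<partial>?N)"
      using that by (intro product.indep_vars_lebesgue_integral ind) (auto intro: intX)
    ultimately show ?thesis using False that mean by simp
  qed
  have sq: "(linear_form c F \<xi>)\<^sup>2 = (\<Sum>e\<in>F. \<Sum>e'\<in>F. (c e * c e') * (?X e \<xi> * ?X e' \<xi>))" for \<xi>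
    unfolding linear_form_def power2_eq_square sum_product by (intro sum.cong refl) (simp add: mult_ac)
  have int: "integrable ?N (\<lambda>\<xi>. (linear_form c F \<xi>)\<^sup>2)"
    unfolding sq using cross by (intro Bochner_Integration.integrable_sum integrable_mult_right) auto
  have "(\<integral>\<xi>. (linear_form c F \<xi>)\<^sup>2 \<partial>?N) = (\<Sum>e\<in>F. \<Sum>e'\<in>F. (c e * c e') * (\<integral>\<xi>. ?X e \<xi> * ?X e' \<xi> \<partial>?N))"
    unfolding sq using cross
    by (subst Bochner_Integration.integral_sum; (intro Bochner_Integration.integrable_sum integrable_mult_right)?; simp)+
  also have "\<dots> = (\<Sum>e\<in>F. (c e)\<^sup>2 * (\<integral>\<xi>. ?X e \<xi> * ?X e \<xi> \<partial>?N))"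
  proof (intro sum.cong refl)
    fix e assume e: "e \<in> F"
    have zero: "(\<integral>\<xi>. ?X e \<xi> * ?X e' \<xi> \<partial>?N) = 0" if "e' \<in> F" "e' \<noteq> e" for e'
    proof -
      have ind: "product.indep_vars a (\<lambda>_. borel) ?X {e, e'}"
        using that e assms(2) by (intro indep_step_functions[where g="\<lambda>_. real_of_int"]) auto
      have "(\<integral>\<xi>. (\<Prod>i\<in>{e, e'}. ?X i \<xi>) \<partial>?N) = (\<Prod>i\<in>{e, e'}. \<integral>\<xi>. ?X i \<xi> \<partial>?N)"
        using that e by (intro product.indep_vars_lebesgue_integral ind) (auto intro: intX)
      then show ?thesis using that e mean by simp
    qed
    have "(\<Sum>e'\<in>F. (c e * c e') * (\<integral>\<xi>. ?X e \<xi> * ?X e' \<xi> \<partial>?N)) = (\<Sum>e'\<in>{e}. (c e * c e') * (\<integral>\<xi>. ?X e \<xi> * ?X e' \<xi> \<partial>?N))"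
      using e assms(1) zero by (intro sum.mono_neutral_right) auto
    then show "(\<Sum>e'\<in>F. (c e * c e') * (\<integral>\<xi>. ?X e \<xi> * ?X e' \<xi> \<partial>?N)) = (c e)\<^sup>2 * (\<integral>\<xi>. ?X e \<xi> * ?X e \<xi> \<partial>?N)"
      by (simp add: power2_eq_square)
  qed
  also have "\<dots> \<le> (\<Sum>e\<in>F. (c e)\<^sup>2 * step_variance)"
  proof (intro sum_mono mult_left_mono)
    fix e assume "e \<in> F"
    from cross[OF this this] show "(\<integral>\<xi>. ?X e \<xi> * ?X e \<xi> \<partial>?N) \<le> step_variance" by simp
  qed simp
  also have "\<dots> = step_variance * (\<Sum>e\<in>F. (c e)\<^sup>2)"
    by (simp add: sum_distrib_left mult.commute)
  finally show ?thesis
    by (subst nn_integral_eq_integral[OF int]) (auto intro: ennreal_leI)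
qed

lemma linear_form_mgf:
  assumes "finite F" "F \<subseteq> outward_edges"
  shows "(\<integral>\<^sup>+\<xi>. ennreal (exp (l * linear_form c F \<xi>)) \<partial>step_product a) =
     (\<Prod>e\<in>F. \<integral>\<^sup>+s. ennreal (exp (l * c e * real_of_int s)) \<partial>step_law Q (a e))"
proof -
  have "(\<integral>\<^sup>+\<xi>. ennreal (exp (l * linear_form c F \<xi>)) \<partial>step_product a) =
      (\<integral>\<^sup>+\<xi>. (\<Prod>e\<in>F. ennreal (exp (l * c e * real_of_int (\<xi> e)))) \<partial>step_product a)"
    using assms(1)
    by (intro nn_integral_cong) (simp add: linear_form_def sum_distrib_left exp_sum prod_ennreal mult.assoc)
  also have "\<dots> = (\<Prod>e\<in>F. \<integral>\<^sup>+\<xi>. ennreal (exp (l * c e * real_of_int (\<xi> e))) \<partial>step_product a)"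
    using assms
    by (intro product.indep_vars_nn_integral indep_step_functions[where g="\<lambda>e s. ennreal (exp (l * c e * real_of_int s))"]) auto
  also have "\<dots> = (\<Prod>e\<in>F. \<integral>\<^sup>+s. ennreal (exp (l * c e * real_of_int s)) \<partial>step_law Q (a e))"
    using assms(2) by (intro prod.cong refl nn_integral_step_coordinate) auto
  finally show ?thesis .
qed

lemma edge_average_second_moment:
  fixes a :: "'g::finite vertex \<times> 'g vertex \<Rightarrow> bit"
  assumes "CARD('g) \<ge> 3"
  shows "(\<integral>\<^sup>+\<xi>. ennreal ((edge_average (Suc k) \<xi>)\<^sup>2) \<partial>step_product a) \<le> ennreal (step_variance * (1/2)^k)"
proof -
  have "step_variance * (\<Sum>e\<in>(edge_level (Suc k) :: ('g vertex \<times> 'g vertex) set). (edge_weight e)\<^sup>2) \<le> step_variance * (1/2)^k"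
    by (intro mult_left_mono step_variance_nonneg edge_weight_square_sum[OF assms])
  then show ?thesis
    unfolding edge_average_linear_form
    by (intro order_trans[OF linear_form_second_moment] ennreal_leI finite_edge_level edge_level_outward)
qed

lemma AE_edge_average_summable:
  fixes a :: "'g::finite vertex \<times> 'g vertex \<Rightarrow> bit"
  assumes "CARD('g) \<ge> 3"
  shows "AE \<xi> in step_product a. summable (\<lambda>k. edge_average (Suc k) \<xi>)"
proof -
  obtain Y where "AE \<xi> in step_product a. summable (\<lambda>k. edge_average (Suc k) \<xi>) \<and>
      (\<forall>r. (\<Sum>k<r. edge_average (Suc k) \<xi>)\<^sup>2 \<le> 4 * Y \<xi> \<and>
        (suminf (\<lambda>k. edge_average (Suc k) \<xi>) - (\<Sum>k<r. edge_average (Suc k) \<xi>))\<^sup>2 \<le> 4 * (3/4)^r * Y \<xi>)"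
    by (rule series_L2_convergence[of "\<lambda>k. edge_average (Suc k)" "step_product a" step_variance])
       (use edge_average_second_moment[OF assms] step_variance_nonneg in auto)
  then show ?thesis by (auto elim!: eventually_mono)
qed

lemma AE_average_sum_limit:
  fixes a :: "'g::finite vertex \<times> 'g vertex \<Rightarrow> bit"
  assumes "CARD('g) \<ge> 3"
  shows "AE \<xi> in step_product a. (\<lambda>r. linear_form edge_weight (edges_upto r) \<xi>) \<longlonglongrightarrow> average_sum \<xi>"
  using AE_edge_average_summable[OF assms]
  by eventually_elim (auto simp: average_sum_def sum_edge_average[symmetric] dest: summable_LIMSEQ)

end

lemma char_limit:
  fixes X :: "'a \<Rightarrow> real"
  assumes "prob_space M"
    and [measurable]: "X \<in> borel_measurable M" "\<And>r. Y r \<in> borel_measurable M"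
    and lim: "AE \<omega> in M. (\<lambda>r. Y r \<omega>) \<longlonglongrightarrow> X \<omega>"
  shows "(\<lambda>r::nat. char (distr M borel (Y r)) t) \<longlonglongrightarrow> char (distr M borel X) t"
proof -
  interpret prob_space M by fact
  have eq: "char (distr M borel Z) t = (\<integral>\<omega>. iexp (t * Z \<omega>) \<partial>M)" if "Z \<in> borel_measurable M" for Z
    unfolding char_def using that by (subst integral_distr) auto
  show ?thesis
    unfolding eq[OF assms(2)] eq[OF assms(3)]
  proof (rule integral_dominated_convergence[where w="\<lambda>_. 1"])
    show "AE \<omega> in M. (\<lambda>r. iexp (t * Y r \<omega>)) \<longlonglongrightarrow> iexp (t * X \<omega>)"
      using lim by eventually_elim (intro tendsto_intros)
  qed auto
qed

context height_weight
begin

text \<open>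
  Omitting one edge \<open>e0\<close> covers both the full average and the remainder after splitting off \<open>e0\<close>,
  with a decay rate that does not depend on \<open>e0\<close> or on the hidden spins.
\<close>

definition edge_series ::
  "('g::finite vertex \<times> 'g vertex \<Rightarrow> bit) \<Rightarrow> 'g vertex \<times> 'g vertex \<Rightarrow>
   (('g vertex \<times> 'g vertex \<Rightarrow> int) \<Rightarrow> real) \<Rightarrow> bool" where
  "edge_series a e0 X \<longleftrightarrow> X \<in> borel_measurable (step_product a) \<and>
     (\<exists>F. (AE \<xi> in step_product a. (\<lambda>r::nat. linear_form edge_weight (F r) \<xi>) \<longlonglongrightarrow> X \<xi>) \<and>
       (\<forall>r. finite (F r) \<and> F r \<subseteq> outward_edges) \<and>
       (\<forall>k. eventually (\<lambda>r. edge_level (Suc k) - {e0} \<subseteq> F r) sequentially))"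

text \<open>For large \<open>t\<close> choose \<open>k\<close> with
  \<open>n k \<le> \<bar>t\<bar> < n (Suc k) = D * n k\<close>. On the level with
  \<open>n (Suc k)\<close> edges every parameter \<open>t * edge_weight e\<close> then lies in the
  window of \<open>step_char_uniform_bound\<close>, so this level alone beats any power of
  \<open>t\<close>. The constant is chosen before \<open>a\<close>, \<open>e0\<close> and
  \<open>X\<close>, which is the uniformity needed for mixtures.\<close>

lemma char_decay:
  assumes card: "CARD('g::finite) \<ge> 3"
  shows "\<exists>K. \<forall>a e0 X t. edge_series (a :: 'g vertex \<times> 'g vertex \<Rightarrow> bit) e0 X \<longrightarrow>
      \<bar>t\<bar> ^ m * cmod (char (distr (step_product a) borel X) t) \<le> K"
proof -
  define n where "n k = card (sphere_at (Suc k) :: 'g vertex set)" for k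
  define D where "D = real (CARD('g) - 1)"
  have D: "D \<ge> 2" using card by (simp add: D_def)
  have nSuc: "real (n (Suc k)) = D * real (n k)" for k by (simp add: n_def card_sphere_at D_def mult_ac)
  have npos: "n k > 0" for k unfolding n_def using card_sphere_at_pos[OF card] .
  obtain q where q: "0 < q" "q < 1" "\<And>a u. 1 / D \<le> \<bar>u\<bar> \<Longrightarrow> \<bar>u\<bar> \<le> 1 \<Longrightarrow> cmod (step_char a u) \<le> q"
    using step_char_uniform_bound[of "1 / D"] D by auto
  obtain B where B: "\<And>j::nat. j \<ge> 1 \<Longrightarrow> real j ^ m * q ^ (j - 1) \<le> B"
    using power_times_geometric_bound[OF q(1,2)] by blast
  show ?thesis
  proof (intro exI[of _ "max B (real (n 0) ^ m)"] allI impI)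
    fix a :: "'g vertex \<times> 'g vertex \<Rightarrow> bit" and X and e0 :: "'g vertex \<times> 'g vertex" and t :: real
    assume "edge_series a e0 X"
    then obtain F where X[measurable]: "X \<in> borel_measurable (step_product a)"
      and lim: "AE \<xi> in step_product a. (\<lambda>r::nat. linear_form edge_weight (F r) \<xi>) \<longlonglongrightarrow> X \<xi>"
      and F: "\<And>r. finite (F r)" "\<And>r. F r \<subseteq> outward_edges"
        "\<And>k. eventually (\<lambda>r. edge_level (Suc k) - {e0} \<subseteq> F r) sequentially"
      unfolding edge_series_def by blast
    have conv: "(\<lambda>r. \<Prod>e\<in>F r. step_char (a e) (t * edge_weight e)) \<longlonglongrightarrow> char (distr (step_product a) borel X) t"
      using char_limit[OF prob_space_step_product X _ lim, where t=t]
      by (simp add: char_linear_form[OF F(2)])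
    show "\<bar>t\<bar> ^ m * cmod (char (distr (step_product a) borel X) t) \<le> max B (real (n 0) ^ m)"
    proof (cases "\<bar>t\<bar> < real (n 0)")
      case True
      have "cmod (char (distr (step_product a) borel X) t) \<le> 1"
        by (rule real_distribution.cmod_char_le_1) (auto intro: product.real_distribution_distr)
      then have "\<bar>t\<bar> ^ m * cmod (char (distr (step_product a) borel X) t) \<le> real (n 0) ^ m * 1"
        using True by (intro mult_mono power_mono) auto
      then show ?thesis by simp
    next
      case False
      have "\<exists>k. \<bar>t\<bar> < real (n k)"
      proof -
        obtain k :: nat where "\<bar>t\<bar> < real k" using reals_Archimedean2 by blast
        also have "real k \<le> real (2 ^ k)" using of_nat_le_iff less_exp[of k] less_imp_le by blast
        also have "\<dots> \<le> real (n k)" unfolding n_def using card_sphere_at_ge[OF card] of_nat_le_iff by blast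
        finally show ?thesis by blast
      qed
      then have "\<exists>k. \<bar>t\<bar> < real (n (Suc k)) \<and> \<not> \<bar>t\<bar> < real (n k)"
        using False ex_least_nat_less[of "\<lambda>k. \<bar>t\<bar> < real (n k)"] by blast
      then obtain k where k: "real (n k) \<le> \<bar>t\<bar>" "\<bar>t\<bar> < real (n (Suc k))" by (auto simp: not_less)
      \<comment> \<open>\<open>n k\<close> is the size of the sphere of radius \<open>Suc k\<close>;
        hence the level with \<open>n (Suc k)\<close> edges is \<open>Suc (Suc k)\<close>.\<close>
      let ?L = "edge_level (Suc (Suc k)) - {e0}"
      have bound: "cmod (\<Prod>e\<in>F r. step_char (a e) (t * edge_weight e)) \<le> q ^ (n (Suc k) - 1)" if "?L \<subseteq> F r" for r
      proof -
        have "cmod (\<Prod>e\<in>F r. step_char (a e) (t * edge_weight e)) = (\<Prod>e\<in>F r. cmod (step_char (a e) (t * edge_weight e)))"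
          by (simp add: prod_norm)
        also have "\<dots> \<le> (\<Prod>e\<in>F r. if e \<in> ?L then q else 1)"
        proof (intro prod_mono conjI norm_ge_zero)
          fix e assume "e \<in> F r"
          show "cmod (step_char (a e) (t * edge_weight e)) \<le> (if e \<in> ?L then q else 1)"
          proof (cases "e \<in> ?L")
            case True
            then have w: "edge_weight e = 1 / real (n (Suc k))"
              by (auto simp: edge_weight_level n_def)
            have "1 / D \<le> \<bar>t * edge_weight e\<bar>" "\<bar>t * edge_weight e\<bar> \<le> 1"
              unfolding w abs_mult using k D npos[of k] nSuc[of k] by (auto simp: field_simps)
            then show ?thesis using q(3) True by simp
          qed (auto simp: step_char_le_1)
        qed
        also have "\<dots> = q ^ card (F r \<inter> ?L)"
          by (simp only: prod.inter_restrict[OF F(1), symmetric] prod_constant)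
        also have "F r \<inter> ?L = ?L" using that by auto
        also have "q ^ card ?L \<le> q ^ (n (Suc k) - 1)"
          using q by (intro power_decreasing) (auto simp: n_def card_edge_level[symmetric] intro: order_trans[OF _ card_Diff1_le] diff_card_le_card_Diff[of "{e0}", simplified])
        finally show ?thesis .
      qed
      have "cmod (char (distr (step_product a) borel X) t) \<le> q ^ (n (Suc k) - 1)"
        by (rule LIMSEQ_le_const2[OF tendsto_norm[OF conv]])
           (use F(3)[of "Suc k"] bound in \<open>auto simp: eventually_sequentially\<close>)
      then have "\<bar>t\<bar> ^ m * cmod (char (distr (step_product a) borel X) t) \<le> real (n (Suc k)) ^ m * q ^ (n (Suc k) - 1)"
        using k by (intro mult_mono power_mono) auto
      also have "\<dots> \<le> B" using npos[of "Suc k"] by (intro B) simp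
      finally show ?thesis by simp
    qed
  qed
qed

end

section \<open>The law of the average for fixed hidden spins\<close>

lemma inv_fourier_integrand: "cos (t * x) * Re z + sin (t * x) * Im z = Re (iexp (- (t * x)) * z)"
  by (simp add: Re_exp Im_exp)

context height_weight
begin

text \<open>Convolution in Fourier form: adding an independent step scaled by \<open>w\<close>
  averages the translates of the density, by Fubini.\<close>

lemma inv_fourier_step_char:
  assumes \<psi>: "rapidly_decreasing \<psi>"
  shows "inv_fourier (\<lambda>t. step_char b (t * w) * \<psi> t) x = (\<integral>s. inv_fourier \<psi> (x - w * real_of_int s) \<partial>step_law Q b)"
proof -
  have [measurable]: "\<psi> \<in> borel_measurable borel" using \<psi> by measurable
  interpret pair_sigma_finite "step_law Q b" lborel
    by (intro pair_sigma_finite.intro step.sigma_finite_measure_axioms lborel.sigma_finite_measure_axioms)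
  let ?g = "\<lambda>s t. Re (iexp (- (t * (x - w * real_of_int s))) * \<psi> t)"
  have g_bound: "\<bar>?g s t\<bar> \<le> cmod (\<psi> t)" for s t
    by (rule order_trans[OF abs_Re_le_cmod]) (simp add: norm_mult)
  have g_int: "integrable lborel (?g s)" for s
    using inv_fourier_integrand_integrable[OF \<psi>, of "x - w * real_of_int s"]
    unfolding inv_fourier_integrand .
  have pointwise: "Re (iexp (- (t * x)) * (step_char b (t * w) * \<psi> t)) = (\<integral>s. ?g s t \<partial>step_law Q b)" for t
  proof -
    have "iexp (- (t * x)) * (step_char b (t * w) * \<psi> t) =
        (\<integral>s. iexp (- (t * x)) * \<psi> t * iexp (t * w * real_of_int s) \<partial>step_law Q b)"
      unfolding step_char_def by (simp add: mult_ac)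
    also have "\<dots> = (\<integral>s. iexp (- (t * (x - w * real_of_int s))) * \<psi> t \<partial>step_law Q b)"
    proof (intro Bochner_Integration.integral_cong refl)
      fix s
      have "iexp (- (t * x)) * iexp (t * w * real_of_int s) = iexp (- (t * (x - w * real_of_int s)))"
        unfolding exp_add[symmetric] by (rule arg_cong[where f=exp]) (simp add: algebra_simps)
      then show "iexp (- (t * x)) * \<psi> t * iexp (t * w * real_of_int s) = iexp (- (t * (x - w * real_of_int s))) * \<psi> t"
        by (metis mult.commute mult.left_commute)
    qed
    finally have "Re (iexp (- (t * x)) * (step_char b (t * w) * \<psi> t)) =
        Re (\<integral>s. iexp (- (t * (x - w * real_of_int s))) * \<psi> t \<partial>step_law Q b)" by (rule arg_cong)
    also have "\<dots> = (\<integral>s. ?g s t \<partial>step_law Q b)"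
      by (rule integral_Re[symmetric]) (auto intro!: step.integrable_const_bound[where B="cmod (\<psi> t)"] simp: norm_mult)
    finally show ?thesis .
  qed
  have "(\<integral>t. Re (iexp (- (t * x)) * (step_char b (t * w) * \<psi> t)) \<partial>lborel) = (\<integral>t. (\<integral>s. ?g s t \<partial>step_law Q b) \<partial>lborel)"
    unfolding pointwise ..
  also have "\<dots> = (\<integral>s. (\<integral>t. ?g s t \<partial>lborel) \<partial>step_law Q b)"
  proof (rule Fubini_integral, rule Fubini_integrable)
    show "case_prod ?g \<in> borel_measurable (step_law Q b \<Otimes>\<^sub>M lborel)" by measurable
    have "(\<integral>t. norm (case (s, t) of (s, t) \<Rightarrow> ?g s t) \<partial>lborel) \<le> (\<integral>t. cmod (\<psi> t) \<partial>lborel)" for s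
      using g_bound g_int[of s] rapidly_decreasing_integrable[OF \<psi>]
      by (intro integral_mono) auto
    then show "integrable (step_law Q b) (\<lambda>s. \<integral>t. norm (case (s, t) of (s, t) \<Rightarrow> ?g s t) \<partial>lborel)"
      by (intro step.integrable_const_bound[where B="\<integral>t. cmod (\<psi> t) \<partial>lborel"]) (auto simp: integral_nonneg_AE)
    show "AE s in step_law Q b. integrable lborel (\<lambda>t. case (s, t) of (s, t) \<Rightarrow> ?g s t)"
      using g_int by simp
  qed
  finally show ?thesis unfolding inv_fourier_def inv_fourier_integrand by simp
qed

definition average_law :: "('g::finite vertex \<times> 'g vertex \<Rightarrow> bit) \<Rightarrow> real measure" where
  "average_law a = distr (step_product a) borel average_sum"

lemma real_distribution_average_law: "real_distribution (average_law a)"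
  unfolding average_law_def by (intro product.real_distribution_distr) measurable

sublocale average: real_distribution "average_law a" for a
  by (rule real_distribution_average_law)

lemma edge_level_subset_upto: "eventually (\<lambda>r. edge_level (Suc k) \<subseteq> edges_upto r) sequentially"
  using eventually_gt_at_top[of k] by eventually_elim (auto simp: edges_upto_def)

lemma average_law_char_decay:
  assumes card: "CARD('g::finite) \<ge> 3"
  shows "\<exists>K. \<forall>(a :: 'g vertex \<times> 'g vertex \<Rightarrow> bit) t. \<bar>t\<bar> ^ m * cmod (char (average_law a) t) \<le> K"
proof -
  \<comment> \<open>\<open>edge_series\<close> asks only for the levels without \<open>e0\<close>;
    the partial sums here contain whole levels, so any value may stand for
    \<open>e0\<close>.\<close>
  have "edge_series a undefined average_sum" for a :: "'g vertex \<times> 'g vertex \<Rightarrow> bit"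
    unfolding edge_series_def
  proof (intro conjI exI[of _ edges_upto] allI average_sum_measurable AE_average_sum_limit[OF card]
      finite_edges_upto edges_upto_outward)
    show "eventually (\<lambda>r. edge_level (Suc k) - {undefined} \<subseteq> (edges_upto r :: ('g vertex \<times> 'g vertex) set)) sequentially" for k
      using edge_level_subset_upto by (rule eventually_mono) auto
  qed
  then show ?thesis
    using char_decay[OF card, of m] unfolding average_law_def by blast
qed

lemma average_law_rapid:
  assumes card: "CARD('g::finite) \<ge> 3"
  shows "rapidly_decreasing (char (average_law (a :: 'g vertex \<times> 'g vertex \<Rightarrow> bit)))"
  unfolding rapidly_decreasing_def using average_law_char_decay[OF card] average.char_measurable by blast

definition average_density :: "('g::finite vertex \<times> 'g vertex \<Rightarrow> bit) \<Rightarrow> real \<Rightarrow> real" where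
  "average_density a = inv_fourier (char (average_law a))"

text \<open>
  Splitting off one edge: the average is the sum of an independent lattice variable and a remainder,
  whose characteristic function still decreases rapidly.
\<close>

lemma average_density_split:
  fixes a :: "'g::finite vertex \<times> 'g vertex \<Rightarrow> bit"
  assumes card: "CARD('g) \<ge> 3" and e0: "e0 \<in> edge_level (Suc k)"
  obtains h :: "real \<Rightarrow> real" and C where "\<And>x. 0 \<le> h x" "\<And>x. h x \<le> C" "h \<in> borel_measurable borel"
    "\<And>x. average_density a x = (\<integral>s. h (x - edge_weight e0 * real_of_int s) \<partial>step_law Q (a e0))"
proof -
  let ?N = "step_product a"
  define X where "X \<xi> = average_sum \<xi> - edge_weight e0 * real_of_int (\<xi> e0)" for \<xi>
  \<comment> \<open>The shift by \<open>Suc k\<close> puts \<open>e0\<close> into every partial sum,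
    so it can be split off for each \<open>r\<close>.\<close>
  define F where "F r = edges_upto (r + Suc k) - {e0}" for r
  have [measurable]: "X \<in> borel_measurable ?N" unfolding X_def by measurable
  have in_upto: "e0 \<in> edges_upto (r + Suc k)" for r using e0 by (auto simp: edges_upto_def)
  have split: "linear_form edge_weight (edges_upto (r + Suc k)) \<xi> =
      edge_weight e0 * real_of_int (\<xi> e0) + linear_form edge_weight (F r) \<xi>" for r \<xi>
    unfolding linear_form_def F_def by (rule sum.remove[OF finite_edges_upto in_upto])
  have F: "finite (F r)" "F r \<subseteq> outward_edges" for r
    using edges_upto_outward by (auto simp: F_def)
  have lim: "AE \<xi> in ?N. (\<lambda>r. linear_form edge_weight (edges_upto (r + Suc k)) \<xi>) \<longlonglongrightarrow> average_sum \<xi>"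
    using AE_average_sum_limit[OF card, of a] by eventually_elim (rule LIMSEQ_ignore_initial_segment)
  then have limX: "AE \<xi> in ?N. (\<lambda>r. linear_form edge_weight (F r) \<xi>) \<longlonglongrightarrow> X \<xi>"
  proof eventually_elim
    fix \<xi> :: "'g vertex \<times> 'g vertex \<Rightarrow> int" assume "(\<lambda>r. linear_form edge_weight (edges_upto (r + Suc k)) \<xi>) \<longlonglongrightarrow> average_sum \<xi>"
    then have "(\<lambda>r. linear_form edge_weight (edges_upto (r + Suc k)) \<xi> - edge_weight e0 * real_of_int (\<xi> e0)) \<longlonglongrightarrow> X \<xi>"
      unfolding X_def by (intro tendsto_diff tendsto_const)
    then show "(\<lambda>r. linear_form edge_weight (F r) \<xi>) \<longlonglongrightarrow> X \<xi>" unfolding split by simp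
  qed
  let ?R = "distr ?N borel X"
  interpret R: real_distribution ?R by (rule product.real_distribution_distr) measurable
  have rapid: "rapidly_decreasing (char ?R)"
    unfolding rapidly_decreasing_def
  proof (intro conjI allI R.char_measurable)
    fix m
    have ev: "eventually (\<lambda>r. edge_level (Suc j) - {e0} \<subseteq> F r) sequentially" for j
    proof -
      have "eventually (\<lambda>r. edge_level (Suc j) \<subseteq> (edges_upto (r + Suc k) :: ('g vertex \<times> 'g vertex) set)) sequentially"
        using edge_level_subset_upto[of j] sequentially_offset by blast
      then show ?thesis by eventually_elim (auto simp: F_def)
    qed
    have "edge_series a e0 X"
      unfolding edge_series_def using limX F ev by (intro conjI exI[of _ F]) auto
    then show "\<exists>K. \<forall>t. \<bar>t\<bar> ^ m * cmod (char ?R t) \<le> K"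
      using char_decay[OF card, of m] by blast
  qed
  have char_eq: "char (average_law a) t = step_char (a e0) (t * edge_weight e0) * char ?R t" for t
  proof (rule LIMSEQ_unique)
    show "(\<lambda>r. char (distr ?N borel (linear_form edge_weight (edges_upto (r + Suc k)))) t) \<longlonglongrightarrow> char (average_law a) t"
      unfolding average_law_def by (rule char_limit[OF prob_space_step_product _ _ lim]) auto
    have "(\<lambda>r. step_char (a e0) (t * edge_weight e0) * char (distr ?N borel (linear_form edge_weight (F r))) t) \<longlonglongrightarrow>
        step_char (a e0) (t * edge_weight e0) * char ?R t"
      by (intro tendsto_mult tendsto_const char_limit[OF prob_space_step_product _ _ limX]) auto
    moreover have "char (distr ?N borel (linear_form edge_weight (edges_upto (r + Suc k)))) t =
        step_char (a e0) (t * edge_weight e0) * char (distr ?N borel (linear_form edge_weight (F r))) t" for r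
      unfolding char_linear_form[OF edges_upto_outward] char_linear_form[OF F(2)] unfolding F_def
      by (rule prod.remove[OF finite_edges_upto in_upto])
    ultimately show "(\<lambda>r. char (distr ?N borel (linear_form edge_weight (edges_upto (r + Suc k)))) t) \<longlonglongrightarrow>
        step_char (a e0) (t * edge_weight e0) * char ?R t"
      by simp
  qed
  show ?thesis
  proof (rule that[of "inv_fourier (char ?R)" "(\<integral>t. 2 * cmod (char ?R t) \<partial>lborel) / (2 * pi)"])
    show "0 \<le> inv_fourier (char ?R) x" for x by (rule R.rapid_char_density_nonneg[OF rapid])
    show "inv_fourier (char ?R) x \<le> (\<integral>t. 2 * cmod (char ?R t) \<partial>lborel) / (2 * pi)" for x
      using inv_fourier_bounded[OF rapid, of x] by linarith
    show "inv_fourier (char ?R) \<in> borel_measurable borel" by (rule inv_fourier_measurable[OF rapid])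
    show "average_density a x = (\<integral>s. inv_fourier (char ?R) (x - edge_weight e0 * real_of_int s) \<partial>step_law Q (a e0))" for x
    proof -
      have "char (average_law a) = (\<lambda>t. step_char (a e0) (t * edge_weight e0) * char ?R t)"
        using char_eq by (rule ext)
      then show ?thesis unfolding average_density_def by (simp add: inv_fourier_step_char[OF rapid])
    qed
  qed
qed

text \<open>
  The zero set of the density is invariant under the steps \<open>2 / |W\<^sub>k|\<close> for every \<open>k\<close>,
  hence it is empty or dense, and a continuous density cannot vanish on a dense set.
\<close>

lemma average_density_pos:
  fixes a :: "'g::finite vertex \<times> 'g vertex \<Rightarrow> bit"
  assumes card: "CARD('g) \<ge> 3"
  shows "average_density a x > 0"
proof (rule ccontr)
  assume "\<not> average_density a x > 0"
  moreover have nonneg: "average_density a y \<ge> 0" for y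
    unfolding average_density_def by (rule average.rapid_char_density_nonneg[OF average_law_rapid[OF card]])
  ultimately have zero: "average_density a x = 0" using order.antisym not_less by blast
  define w where "w k = 1 / real (card (sphere_at (Suc k) :: 'g vertex set))" for k
  have w: "w k > 0" for k using card_sphere_at_pos[OF card] by (simp add: w_def)
  have shift: "average_density a (x + 2 * w k * real_of_int j) = 0" for k j
  proof -
    have "edge_level (Suc k) \<noteq> ({} :: ('g vertex \<times> 'g vertex) set)"
      using card_edge_level[of "Suc k", where 'g='g] card_sphere_at_pos[OF card, of "Suc k"] by auto
    then obtain e0 :: "'g vertex \<times> 'g vertex" where e0: "e0 \<in> edge_level (Suc k)" by blast
    have we: "edge_weight e0 = w k" using edge_weight_level[OF e0] by (simp add: w_def)
    obtain h C where h: "\<And>x. 0 \<le> h x" "\<And>x. h x \<le> C" and [measurable]: "h \<in> borel_measurable borel"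
      and dens: "\<And>x. average_density a x = (\<integral>s. h (x - w k * real_of_int s) \<partial>step_law Q (a e0))"
      using average_density_split[OF card e0, of a] unfolding we by blast
    have int: "integrable (step_law Q (a e0)) (\<lambda>s. h (y - w k * real_of_int s))" for y
      using h by (intro step.integrable_const_bound[where B=C]) auto
    have "(AE s in step_law Q (a e0). h (x - w k * real_of_int s) = 0)"
      using zero h(1) unfolding dens by (subst (asm) integral_nonneg_eq_0_iff_AE[OF int]) auto
    then have h0: "h (x - w k * real_of_int s) = 0" if "of_int s = a e0" for s
      using that unfolding AE_step_law by blast
    \<comment> \<open>Moving \<open>x\<close> by \<open>2 * w k * j\<close> shifts the step by the
      even number \<open>2 * j\<close>, which preserves its class; so the values of \<open>h\<close>
      that occur were already seen to vanish.\<close>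
    have "(AE s in step_law Q (a e0). h (x + 2 * w k * real_of_int j - w k * real_of_int s) = 0)"
      unfolding AE_step_law
    proof (intro allI impI)
      fix s assume "of_int s = a e0"
      then have "of_int (s - 2 * j) = a e0" unfolding of_int_bit_eq_of_bool by simp
      from h0[OF this] show "h (x + 2 * w k * real_of_int j - w k * real_of_int s) = 0"
        by (simp add: algebra_simps)
    qed
    then show ?thesis unfolding dens using h(1) by (subst integral_nonneg_eq_0_iff_AE[OF int]) auto
  qed
  have w0: "w \<longlonglongrightarrow> 0"
  proof (rule tendsto_sandwich[OF _ _ tendsto_const])
    show "(\<lambda>k. (1/2)^k) \<longlonglongrightarrow> (0::real)" by (intro LIMSEQ_power_zero) simp
    have "w k \<le> (1/2)^k" for k
    proof -
      have "real (2 ^ k) \<le> real (card (sphere_at (Suc k) :: 'g vertex set))"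
        using card_sphere_at_ge[OF card, of k] of_nat_le_iff by blast
      then show ?thesis by (simp add: w_def power_divide frac_le)
    qed
    then show "\<forall>\<^sub>F k in sequentially. w k \<le> (1/2)^k" by simp
    show "\<forall>\<^sub>F k in sequentially. 0 \<le> w k" using w by (simp add: less_imp_le)
  qed
  have "average_density a y = 0" for y
  proof (rule LIMSEQ_unique)
    \<comment> \<open>The nearest point not above \<open>y\<close> in the lattice of known zeros
      with mesh \<open>2 * w k\<close>, which tends to 0.\<close>
    define z where "z k = x + 2 * w k * real_of_int \<lfloor>(y - x) / (2 * w k)\<rfloor>" for k
    have "\<bar>z k - y\<bar> \<le> 2 * w k" for k
    proof -
      define u where "u = (y - x) / (2 * w k)"
      have y: "y = x + 2 * w k * u" using w[of k] by (simp add: u_def)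
      have "z k - y = 2 * w k * (real_of_int \<lfloor>u\<rfloor> - u)"
        unfolding z_def u_def[symmetric] y by (simp add: algebra_simps)
      moreover have "\<bar>real_of_int \<lfloor>u\<rfloor> - u\<bar> \<le> 1" by linarith
      ultimately show ?thesis using w[of k] by (simp add: abs_mult mult_left_le)
    qed
    then have "\<forall>\<^sub>F k in sequentially. norm (z k - y) \<le> 2 * w k" by simp
    moreover have "(\<lambda>k. 2 * w k) \<longlonglongrightarrow> 0" using tendsto_mult[OF tendsto_const[of 2] w0] by simp
    ultimately have "(\<lambda>k. z k - y) \<longlonglongrightarrow> 0" by (rule Lim_null_comparison)
    then have "z \<longlonglongrightarrow> y" by (simp add: LIM_zero_iff)
    moreover have "isCont (average_density a) y"
      unfolding average_density_def using inv_fourier_DERIV[OF average_law_rapid[OF card]] DERIV_isCont by blast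
    ultimately show "(\<lambda>k. average_density a (z k)) \<longlonglongrightarrow> average_density a y"
      by (rule isCont_tendsto_compose[rotated])
    show "(\<lambda>k. average_density a (z k)) \<longlonglongrightarrow> 0" unfolding z_def shift by simp
  qed
  then have "average_law a = density lborel (\<lambda>_. 0)"
    using average.rapid_char_density[OF average_law_rapid[OF card], of a] by (simp add: average_density_def)
  then have "emeasure (average_law a) UNIV = 0" by (simp add: emeasure_density)
  then show False using average.emeasure_space_1[of a] by simp
qed

text \<open>Each edge sees the parameter \<open>l * edge_weight e\<close>, at most \<open>t\<close>
  in modulus. The bounds for single steps multiply to the exponential of \<open>K * l^2\<close>
  times the sum of the squared weights, which is at most the geometric sum 2; Fatou's lemma passes
  to the infinite average.\<close>

lemma average_mgf_bound:
  assumes card: "CARD('g::finite) \<ge> 3" and t: "t > 0" "(\<lambda>j. exp (t * real_of_int j) * Q j) summable_on UNIV"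
    and l: "\<bar>l\<bar> \<le> real CARD('g) * t"
  obtains B where "B \<ge> 0" "\<And>a :: 'g vertex \<times> 'g vertex \<Rightarrow> bit.
     (\<integral>\<^sup>+\<xi>. ennreal (exp (l * average_sum \<xi>)) \<partial>step_product a) \<le> ennreal B"
proof -
  obtain K where K: "K \<ge> 0" "\<And>a u. \<bar>u\<bar> \<le> t \<Longrightarrow>
     (\<integral>\<^sup>+s. ennreal (exp (u * real_of_int s)) \<partial>step_law Q a) \<le> ennreal (exp (K * u\<^sup>2))"
    using step_law_mgf_bound[OF t] by blast
  show ?thesis
  proof (rule that[of "exp (K * l\<^sup>2 * 2)"])
    fix a :: "'g vertex \<times> 'g vertex \<Rightarrow> bit"
    have weight_le: "edge_weight e \<le> 1 / real CARD('g)" if "e \<in> outward_edges" for e :: "'g vertex \<times> 'g vertex"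
    proof -
      obtain k where k: "e \<in> edge_level (Suc k)" using outward_edge_level[OF \<open>e \<in> _\<close>] by blast
      have "CARD('g) * 1 \<le> card (sphere_at (Suc k) :: 'g vertex set)"
        unfolding card_sphere_at using card by (intro mult_left_mono one_le_power) auto
      then show ?thesis using card unfolding edge_weight_level[OF k] by (intro divide_left_mono) auto
    qed
    have fin: "(\<integral>\<^sup>+\<xi>. ennreal (exp (l * linear_form edge_weight (edges_upto r) \<xi>)) \<partial>step_product a) \<le> ennreal (exp (K * l\<^sup>2 * 2))" for r
    proof -
      let ?E = "edges_upto r :: ('g vertex \<times> 'g vertex) set"
      have "(\<integral>\<^sup>+\<xi>. ennreal (exp (l * linear_form edge_weight ?E \<xi>)) \<partial>step_product a) \<le>
          (\<Prod>e\<in>?E. ennreal (exp (K * (l * edge_weight e)\<^sup>2)))"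
        unfolding linear_form_mgf[OF finite_edges_upto edges_upto_outward]
      proof (rule prod_mono_ennreal)
        fix e assume "e \<in> ?E"
        then have e: "e \<in> outward_edges" using edges_upto_outward by blast
        have "\<bar>l * edge_weight e\<bar> \<le> (real CARD('g) * t) * (1 / real CARD('g))"
          unfolding abs_mult using l weight_le[OF e] edge_weight_pos[OF card, of e] t by (intro mult_mono) auto
        then have "\<bar>l * edge_weight e\<bar> \<le> t" by simp
        then show "(\<integral>\<^sup>+s. ennreal (exp (l * edge_weight e * real_of_int s)) \<partial>step_law Q (a e)) \<le> ennreal (exp (K * (l * edge_weight e)\<^sup>2))"
          by (rule K(2))
      qed
      also have "\<dots> = ennreal (exp (K * l\<^sup>2 * (\<Sum>e\<in>?E. (edge_weight e)\<^sup>2)))"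
        by (subst prod_ennreal) (auto simp: exp_sum[symmetric] sum_distrib_left power_mult_distrib mult.assoc)
      also have "(\<Sum>e\<in>?E. (edge_weight e)\<^sup>2) = (\<Sum>k<r. \<Sum>e\<in>(edge_level (Suc k) :: ('g vertex \<times> 'g vertex) set). (edge_weight e)\<^sup>2)"
        unfolding edges_upto_def by (rule sum.UNION_disjoint) (simp, simp, auto simp: edge_level_def sphere_at_eq)
      also have "ennreal (exp (K * l\<^sup>2 * \<dots>)) \<le> ennreal (exp (K * l\<^sup>2 * 2))"
      proof (intro ennreal_leI, subst exp_le_cancel_iff, intro mult_left_mono)
        have "(\<Sum>k<r. \<Sum>e\<in>(edge_level (Suc k) :: ('g vertex \<times> 'g vertex) set). (edge_weight e)\<^sup>2) \<le> (\<Sum>k<r. (1/2)^k)"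
          by (intro sum_mono edge_weight_square_sum[OF card])
        also have "\<dots> \<le> (\<Sum>k. (1/2)^k)" by (intro sum_le_suminf summable_geometric) auto
        also have "\<dots> = (2::real)" by (subst suminf_geometric) auto
        finally show "(\<Sum>k<r. \<Sum>e\<in>(edge_level (Suc k) :: ('g vertex \<times> 'g vertex) set). (edge_weight e)\<^sup>2) \<le> 2" .
      qed (use K in auto)
      finally show ?thesis .
    qed
    have "(\<integral>\<^sup>+\<xi>. ennreal (exp (l * average_sum \<xi>)) \<partial>step_product a) =
       (\<integral>\<^sup>+\<xi>. liminf (\<lambda>r. ennreal (exp (l * linear_form edge_weight (edges_upto r) \<xi>))) \<partial>step_product a)"
    proof (rule nn_integral_cong_AE)
      show "AE \<xi> in step_product a. ennreal (exp (l * average_sum \<xi>)) =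
         liminf (\<lambda>r. ennreal (exp (l * linear_form edge_weight (edges_upto r) \<xi>)))"
        using AE_average_sum_limit[OF card, of a]
      proof eventually_elim
        fix \<xi> :: "'g vertex \<times> 'g vertex \<Rightarrow> int" assume "(\<lambda>r. linear_form edge_weight (edges_upto r) \<xi>) \<longlonglongrightarrow> average_sum \<xi>"
        then have "(\<lambda>r. ennreal (exp (l * linear_form edge_weight (edges_upto r) \<xi>))) \<longlonglongrightarrow> ennreal (exp (l * average_sum \<xi>))"
          by (intro tendsto_intros tendsto_ennrealI)
        then show "ennreal (exp (l * average_sum \<xi>)) =
         liminf (\<lambda>r. ennreal (exp (l * linear_form edge_weight (edges_upto r) \<xi>)))"
          by (intro lim_imp_Liminf[symmetric]) auto
      qed
    qed
    also have "\<dots> \<le> liminf (\<lambda>r. \<integral>\<^sup>+\<xi>. ennreal (exp (l * linear_form edge_weight (edges_upto r) \<xi>)) \<partial>step_product a)"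
      by (rule nn_integral_liminf) measurable
    also have "\<dots> \<le> liminf (\<lambda>r::nat. ennreal (exp (K * l\<^sup>2 * 2)))"
      using fin by (intro Liminf_mono) simp
    also have "\<dots> = ennreal (exp (K * l\<^sup>2 * 2))" by (simp add: Liminf_const)
    finally show "(\<integral>\<^sup>+\<xi>. ennreal (exp (l * average_sum \<xi>)) \<partial>step_product a) \<le> ennreal (exp (K * l\<^sup>2 * 2))" .
  qed auto
qed

end

section \<open>Functions of finitely many coordinates\<close>

instance bit :: finite
proof
  have "(UNIV :: bit set) = {0, 1}"
    by (rule UNIV_eq_I) (case_tac x; simp)
  then show "finite (UNIV :: bit set)" by (metis finite.emptyI finite_insert)
qed

lemma space_config_space [simp]: "space config_space = UNIV"
  by (simp add: config_space_def space_PiM)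

lemma coordinate_measurable [measurable]: "(\<lambda>\<omega>. \<omega> x) \<in> measurable config_space (count_space UNIV)"
  unfolding config_space_def by measurable

lemma measurable_config_space_iff:
  "f \<in> measurable M config_space \<longleftrightarrow> (\<forall>x. (\<lambda>\<omega>. f \<omega> x) \<in> measurable M (count_space UNIV))"
proof
  assume f: "f \<in> measurable M config_space"
  show "\<forall>x. (\<lambda>\<omega>. f \<omega> x) \<in> measurable M (count_space UNIV)"
    using measurable_compose[OF f coordinate_measurable] by blast
next
  assume f: "\<forall>x. (\<lambda>\<omega>. f \<omega> x) \<in> measurable M (count_space UNIV)"
  have "(\<lambda>\<omega>. \<lambda>x\<in>UNIV. f \<omega> x) \<in> measurable M config_space"
    unfolding config_space_def by (rule measurable_restrict) (use f in auto)
  then show "f \<in> measurable M config_space" by (simp add: restrict_def)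
qed

definition cylinder :: "'g vertex set \<Rightarrow> ('g vertex \<Rightarrow> 's) \<Rightarrow> ('g vertex \<Rightarrow> 's) set" where
  "cylinder B \<zeta> = {\<omega>. \<forall>x\<in>B. \<omega> x = \<zeta> x}"

lemma sets_cylinder [measurable]:
  assumes "finite B"
  shows "cylinder B \<zeta> \<in> sets config_space"
proof -
  have "{\<omega> \<in> space config_space. \<forall>x\<in>B. \<omega> x = \<zeta> x} \<in> sets config_space"
    using assms by measurable
  then show ?thesis by (simp add: cylinder_def)
qed

text \<open>Such an \<open>f\<close> factors through the restriction to \<open>B\<close>, whose
  values form a countable discrete space. This gives measurability of conditional probabilities,
  weights and partition functions from locality alone.\<close>

lemma measurable_finitely_determined:
  fixes f :: "('g::finite vertex \<Rightarrow> 's::countable) \<Rightarrow> 'b"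
  assumes "finite B" "\<And>\<omega> \<omega>'. (\<And>x. x \<in> B \<Longrightarrow> \<omega> x = \<omega>' x) \<Longrightarrow> f \<omega> = f \<omega>'" "\<And>\<omega>. f \<omega> \<in> space N"
  shows "f \<in> measurable config_space N"
proof -
  have "(\<lambda>\<omega>. restrict \<omega> B) \<in> measurable config_space (count_space (B \<rightarrow>\<^sub>E (UNIV :: 's set)))"
  proof (subst measurable_count_space_eq_countable)
    show "countable (B \<rightarrow>\<^sub>E (UNIV :: 's set))" using assms(1) by (intro countable_PiE) auto
    have "(\<lambda>\<omega>. restrict \<omega> B) -` {a} \<inter> space config_space = cylinder B a" if "a \<in> B \<rightarrow>\<^sub>E (UNIV :: 's set)" for a
      using that by (auto simp: cylinder_def fun_eq_iff restrict_def PiE_def extensional_def)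
    then show "(\<lambda>\<omega>. restrict \<omega> B) \<in> space config_space \<rightarrow> B \<rightarrow>\<^sub>E (UNIV :: 's set) \<and>
       (\<forall>a\<in>B \<rightarrow>\<^sub>E (UNIV :: 's set). (\<lambda>\<omega>. restrict \<omega> B) -` {a} \<inter> space config_space \<in> sets config_space)"
      using sets_cylinder[OF assms(1)] by auto
  qed
  then have "(\<lambda>\<omega>. f (restrict \<omega> B)) \<in> measurable config_space N"
    by (rule measurable_compose) (use assms(3) in simp)
  moreover have "f (restrict \<omega> B) = f \<omega>" for \<omega> by (rule assms(2)) simp
  ultimately show ?thesis by simp
qed

section \<open>The gradient measure as a mixture\<close>

definition spin_diff :: "('g vertex \<Rightarrow> bit) \<Rightarrow> 'g vertex \<times> 'g vertex \<Rightarrow> bit" where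
  "spin_diff \<sigma> e = \<sigma> (snd e) - \<sigma> (fst e)"

abbreviation outward_space :: "('g vertex \<times> 'g vertex \<Rightarrow> int) measure" where
  "outward_space \<equiv> PiM outward_edges (\<lambda>_. count_space UNIV)"

lemma antisym_extension_outward: "e \<in> outward_edges \<Longrightarrow> antisym_extension \<xi> e = \<xi> e"
  by (cases e) (simp add: antisym_extension_def edges_orient)

lemma antisym_extension_measurable [measurable]: "antisym_extension \<in> measurable (outward_space :: ('g vertex \<times> 'g vertex \<Rightarrow> int) measure) gradient_space"
  unfolding gradient_space_def
proof (rule measurable_restrict_space2)
  show "antisym_extension \<in> space (outward_space :: ('g vertex \<times> 'g vertex \<Rightarrow> int) measure) \<rightarrow> {\<zeta>. \<forall>(u, v)\<in>edges. \<zeta> (u, v) = - \<zeta> (v, u)}"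
    by (auto simp: antisym_extension_def edges_orient dest: outward_edges_antisym)
  have "(\<lambda>\<xi>. \<lambda>e\<in>edges. (\<lambda>(u, v). if (u, v) \<in> outward_edges then \<xi> (u, v) else - \<xi> (v, u)) e)
      \<in> measurable (outward_space :: ('g vertex \<times> 'g vertex \<Rightarrow> int) measure) (\<Pi>\<^sub>M b\<in>edges. count_space UNIV)"
  proof (rule measurable_restrict)
    fix e :: "'g vertex \<times> 'g vertex" assume "e \<in> edges"
    obtain u v where e: "e = (u, v)" by (cases e)
    show "(\<lambda>\<xi>. (\<lambda>(u, v). if (u, v) \<in> outward_edges then \<xi> (u, v) else - \<xi> (v, u)) e) \<in> measurable outward_space (count_space UNIV)"
    proof (cases "(u, v) \<in> outward_edges")
      case True then show ?thesis unfolding e by simp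
    next
      case False
      then have "(v, u) \<in> outward_edges" using \<open>e \<in> edges\<close> by (simp add: e edges_orient)
      then have "(\<lambda>\<xi>. - \<xi> (v, u)) \<in> measurable outward_space (count_space (UNIV :: int set))"
        by (intro measurable_compose[OF measurable_component_singleton[of "(v, u)"]]) auto
      then show ?thesis using False unfolding e by simp
    qed
  qed
  moreover have "antisym_extension = (\<lambda>\<xi> :: 'g vertex \<times> 'g vertex \<Rightarrow> int. \<lambda>e\<in>edges. (\<lambda>(u, v). if (u, v) \<in> outward_edges then \<xi> (u, v) else - \<xi> (v, u)) e)"
    by (auto simp: antisym_extension_def fun_eq_iff restrict_def)
  ultimately show "antisym_extension \<in> measurable (outward_space :: ('g vertex \<times> 'g vertex \<Rightarrow> int) measure) (\<Pi>\<^sub>M b\<in>edges. count_space UNIV)"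
    by (simp only:)
qed

lemma pinned_height_cong:
  assumes "\<And>e. e \<in> outward_edges \<Longrightarrow> \<zeta> e = \<zeta>' e"
  shows "pinned_height 1 s \<zeta> = pinned_height 1 s \<zeta>'"
proof
  fix v show "pinned_height 1 s \<zeta> v = pinned_height 1 s \<zeta>' v"
    by (induction v rule: vertex_induct) (auto simp: pinned_height_parent assms outward_edges_iff)
qed

text \<open>Heights pinned at the root read only outward increments. This is why statements about
  the gradient measure reduce to statements about the law of the outward increments.\<close>

lemma pinned_height_antisym_extension: "pinned_height 1 s (antisym_extension \<xi>) = pinned_height 1 s \<xi>"
  by (rule pinned_height_cong) (rule antisym_extension_outward)

lemma gradient_coordinate_measurable [measurable]:
  assumes "e \<in> edges"
  shows "(\<lambda>\<zeta>. \<zeta> e) \<in> measurable gradient_space (count_space UNIV)"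
  unfolding gradient_space_def using assms
  by (intro measurable_restrict_space1 measurable_component_singleton)

lemma pinned_height_coordinate_measurable:
  assumes "\<And>v. v \<noteq> 1 \<Longrightarrow> (\<lambda>\<zeta>. \<zeta> (parent v, v)) \<in> measurable M (count_space UNIV)"
  shows "(\<lambda>\<zeta>. pinned_height 1 s \<zeta> v) \<in> measurable M (count_space UNIV)"
proof (induction v rule: vertex_induct)
  case (step v)
  show ?case
    unfolding pinned_height_parent[OF step(1)]
    by (rule measurable_compose_countable'[where I=UNIV and f="\<lambda>a \<zeta>. a + \<zeta> (parent v, v)", OF _ step(2)])
       (auto intro!: measurable_compose[OF assms[OF step(1)]])
qed simp

lemma pinned_height_measurable [measurable]:
  "pinned_height 1 s \<in> measurable gradient_space config_space"
  unfolding measurable_config_space_iff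
  by (intro allI pinned_height_coordinate_measurable gradient_coordinate_measurable parent_edge)

lemma pinned_height_measurable_outward [measurable]:
  "pinned_height 1 s \<in> measurable outward_space config_space"
  unfolding measurable_config_space_iff
  by (intro allI pinned_height_coordinate_measurable measurable_component_singleton)
     (auto simp: outward_edges_iff)

lemma avg_height_measurable [measurable]:
  "(avg_height r :: ('g::finite vertex \<Rightarrow> int) \<Rightarrow> real) \<in> borel_measurable config_space"
  unfolding avg_height_def by measurable

lemma pinned_avg_limit_antisym_extension:
  assumes "CARD('g::finite) > 1"
  shows "pinned_avg_limit (antisym_extension \<xi>) = average_sum (\<xi> :: 'g vertex \<times> 'g vertex \<Rightarrow> int)"
  unfolding pinned_avg_limit_def pinned_height_antisym_extension avg_height_pinned[OF assms] average_sum_def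
  by (simp add: suminf_eq_lim)

section \<open>The gradient measure as a mixture of product measures over the hidden spins\<close>

locale hidden_ising = height_weight Q for Q +
  fixes \<mu> :: "('g::finite vertex \<Rightarrow> bit) measure"
  assumes card: "CARD('g) \<ge> 3" and gibbs: "gibbs_measure (fuzzy Q) \<mu>"
begin

lemma sets_\<mu> [measurable_cong]: "sets \<mu> = sets config_space"
  using gibbs by (simp add: gibbs_measure_def)

lemma space_\<mu> [simp]: "space \<mu> = UNIV"
  using sets_eq_imp_space_eq[OF sets_\<mu>] by simp

sublocale spin: prob_space \<mu>
  using gibbs by (simp add: gibbs_measure_def)

abbreviation step_kernel :: "('g vertex \<Rightarrow> bit) \<Rightarrow> ('g vertex \<times> 'g vertex \<Rightarrow> int) measure" where
  "step_kernel \<sigma> \<equiv> step_product (spin_diff \<sigma>)"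

text \<open>Measurability is checked on finite-dimensional rectangles, whose probability is a finite
  product of factors reading two spins each.\<close>

lemma step_kernel_measurable_prob [measurable]: "step_kernel \<in> measurable \<mu> (prob_algebra outward_space)"
proof (rule measurable_prob_algebra_generated[OF sets_PiM Int_stable_prod_algebra prod_algebra_sets_into_space])
  fix \<sigma> show "prob_space (step_kernel \<sigma>)" by (rule prob_space_step_product)
  show "sets (step_kernel \<sigma>) = sets outward_space" by (rule sets_step_product)
next
  fix A :: "('g vertex \<times> 'g vertex \<Rightarrow> int) set"
  assume "A \<in> prod_algebra outward_edges (\<lambda>_. count_space UNIV)"
  then obtain J E where A: "A = prod_emb outward_edges (\<lambda>_. count_space UNIV) J (\<Pi>\<^sub>E j\<in>J. E j)"
    and J: "finite J" "J \<subseteq> outward_edges"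
    by (elim prod_algebraE)
  have "emeasure (step_kernel \<sigma>) A = (\<Prod>e\<in>J. emeasure (step_law Q (spin_diff \<sigma> e)) (E e))" for \<sigma>
  proof -
    have "A = prod_emb outward_edges (\<lambda>e. step_law Q (spin_diff \<sigma> e)) J (\<Pi>\<^sub>E j\<in>J. E j)"
      unfolding A by (simp add: prod_emb_def)
    then show ?thesis
      unfolding step_product_def using J prob_space_step_law by (simp add: emeasure_PiM_emb)
  qed
  moreover have "(\<lambda>\<sigma>. \<Prod>e\<in>J. emeasure (step_law Q (spin_diff \<sigma> e)) (E e)) \<in> borel_measurable \<mu>"
  proof (intro borel_measurable_prod_ennreal)
    fix e
    have "(\<lambda>\<sigma>. emeasure (step_law Q (spin_diff \<sigma> e)) (E e)) \<in> borel_measurable (config_space :: ('g vertex \<Rightarrow> bit) measure)"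
      by (rule measurable_finitely_determined[of "{fst e, snd e}"]) (auto simp: spin_diff_def)
    then show "(\<lambda>\<sigma>. emeasure (step_law Q (spin_diff \<sigma> e)) (E e)) \<in> borel_measurable \<mu>" by measurable
  qed
  ultimately show "(\<lambda>\<sigma>. emeasure (step_kernel \<sigma>) A) \<in> borel_measurable \<mu>" by simp
qed

lemma step_kernel_measurable [measurable]: "step_kernel \<in> measurable \<mu> (subprob_algebra outward_space)"
  by (rule measurable_prob_algebraD[OF step_kernel_measurable_prob])

definition step_measure :: "('g vertex \<times> 'g vertex \<Rightarrow> int) measure" where
  "step_measure = \<mu> \<bind> step_kernel"

lemma sets_step_measure [measurable_cong]: "sets step_measure = sets outward_space"
  unfolding step_measure_def by (rule sets_bind) (auto simp: sets_step_product)

sublocale mix: prob_space step_measure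
  unfolding step_measure_def
  by (rule spin.prob_space_bind[where S=outward_space]) (auto intro: prob_space_step_product)

abbreviation grad :: "('g vertex \<times> 'g vertex \<Rightarrow> int) measure" where
  "grad \<equiv> gradient_measure Q \<mu>"

lemma gradient_kernel_eq: "gradient_kernel Q \<sigma> = distr (step_kernel \<sigma>) gradient_space antisym_extension"
  unfolding gradient_kernel_def step_product_def
  by (rule arg_cong[where f="\<lambda>M. distr M _ _"]) (auto intro!: PiM_cong simp: spin_diff_def)

text \<open>Only the second marginal of the joint law matters, so the hidden spins can be integrated
  out: \<open>step_measure\<close> carries all the randomness of the increments.\<close>

lemma gradient_measure_eq: "grad = distr step_measure gradient_space antisym_extension"
proof -
  have gk[measurable]: "gradient_kernel Q \<in> measurable \<mu> (subprob_algebra gradient_space)"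
  proof -
    have "(\<lambda>\<sigma>. distr (step_kernel \<sigma>) gradient_space antisym_extension) \<in> measurable \<mu> (subprob_algebra gradient_space)"
      by (rule measurable_distr2[where M=outward_space]) measurable
    then show ?thesis unfolding gradient_kernel_eq[abs_def] .
  qed
  have pk: "(\<lambda>\<sigma>. distr (gradient_kernel Q \<sigma>) (config_space \<Otimes>\<^sub>M gradient_space) (Pair \<sigma>))
      \<in> measurable \<mu> (subprob_algebra (config_space \<Otimes>\<^sub>M gradient_space))"
    by (rule measurable_distr2[OF _ gk]) (simp add: measurable_ident_sets sets_pair_measure_cong[OF sets_\<mu> refl] split_def)
  have sk: "sets (gradient_kernel Q \<sigma>) = sets gradient_space" for \<sigma> :: "'g vertex \<Rightarrow> bit"
    by (simp add: gradient_kernel_eq)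
  have "grad = \<mu> \<bind> (\<lambda>\<sigma>. distr (distr (gradient_kernel Q \<sigma>) (config_space \<Otimes>\<^sub>M gradient_space) (Pair \<sigma>)) gradient_space snd)"
    unfolding gradient_measure_def joint_measure_def by (rule distr_bind[OF pk]) auto
  also have "\<dots> = \<mu> \<bind> gradient_kernel Q"
  proof (intro bind_cong refl)
    fix \<sigma> :: "'g vertex \<Rightarrow> bit"
    have [measurable_cong]: "sets (gradient_kernel Q \<sigma>) = sets gradient_space" by (rule sk)
    show "distr (distr (gradient_kernel Q \<sigma>) (config_space \<Otimes>\<^sub>M gradient_space) (Pair \<sigma>)) gradient_space snd = gradient_kernel Q \<sigma>"
      by (subst distr_distr) (auto simp: comp_def distr_id2[OF sk[symmetric]])
  qed
  also have "\<dots> = distr step_measure gradient_space antisym_extension"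
    unfolding step_measure_def gradient_kernel_eq[abs_def]
    by (rule distr_bind[OF step_kernel_measurable _ antisym_extension_measurable, symmetric]) simp
  finally show ?thesis .
qed

sublocale grad: prob_space grad
  unfolding gradient_measure_eq by (rule mix.prob_space_distr) measurable

lemma sets_grad [measurable_cong]: "sets grad = sets gradient_space"
  by (simp add: gradient_measure_eq)

lemma average_sum_measurable_outward [measurable]: "average_sum \<in> borel_measurable (outward_space :: ('g vertex \<times> 'g vertex \<Rightarrow> int) measure)"
  using average_sum_measurable unfolding measurable_cong_sets[OF sets_step_product refl] .

lemma edge_average_measurable_outward [measurable]: "edge_average k \<in> borel_measurable (outward_space :: ('g vertex \<times> 'g vertex \<Rightarrow> int) measure)"
  using edge_average_measurable unfolding measurable_cong_sets[OF sets_step_product refl] .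

lemma nn_integral_step_measure:
  assumes "f \<in> borel_measurable outward_space"
  shows "(\<integral>\<^sup>+\<xi>. f \<xi> \<partial>step_measure) = (\<integral>\<^sup>+\<sigma>. \<integral>\<^sup>+\<xi>. f \<xi> \<partial>step_kernel \<sigma> \<partial>\<mu>)"
  unfolding step_measure_def by (rule nn_integral_bind[OF assms step_kernel_measurable])

lemma emeasure_step_measure:
  assumes "A \<in> sets outward_space"
  shows "emeasure step_measure A = (\<integral>\<^sup>+\<sigma>. emeasure (step_kernel \<sigma>) A \<partial>\<mu>)"
  unfolding step_measure_def by (rule emeasure_bind[OF _ step_kernel_measurable assms]) simp

lemma AE_grad:
  assumes "{\<zeta> \<in> space gradient_space. P \<zeta>} \<in> sets gradient_space"
  shows "(AE \<zeta> in grad. P \<zeta>) \<longleftrightarrow> (AE \<xi> in step_measure. P (antisym_extension \<xi>))"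
  unfolding gradient_measure_eq by (rule AE_distr_iff[OF _ assms]) measurable

lemma edge_average_second_moment_step_measure:
  "(\<integral>\<^sup>+\<xi>. ennreal ((edge_average (Suc k) \<xi>)\<^sup>2) \<partial>step_measure) \<le> ennreal (step_variance * (1/2)^k)"
proof -
  have "(\<integral>\<^sup>+\<xi>. ennreal ((edge_average (Suc k) \<xi>)\<^sup>2) \<partial>step_measure) =
      (\<integral>\<^sup>+\<sigma>. \<integral>\<^sup>+\<xi>. ennreal ((edge_average (Suc k) \<xi>)\<^sup>2) \<partial>step_kernel \<sigma> \<partial>\<mu>)"
    by (rule nn_integral_step_measure) measurable
  also have "\<dots> \<le> (\<integral>\<^sup>+\<sigma>. ennreal (step_variance * (1/2)^k) \<partial>\<mu>)"
    by (intro nn_integral_mono edge_average_second_moment card)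
  finally show ?thesis by (simp add: spin.emeasure_space_1[simplified])
qed

lemma step_measure_L2:
  obtains Y where "integrable step_measure Y"
    "AE \<xi> in step_measure. summable (\<lambda>k. edge_average (Suc k) \<xi>) \<and>
      (\<forall>r. (\<Sum>k<r. edge_average (Suc k) \<xi>)\<^sup>2 \<le> 4 * Y \<xi> \<and>
        (average_sum \<xi> - (\<Sum>k<r. edge_average (Suc k) \<xi>))\<^sup>2 \<le> 4 * (3/4)^r * Y \<xi>)"
  unfolding average_sum_def
  by (rule series_L2_convergence[of "\<lambda>k. edge_average (Suc k)" step_measure step_variance])
     (use edge_average_second_moment_step_measure step_variance_nonneg in auto)

section \<open>The law of the average under the mixture\<close>

definition total_law :: "real measure" where
  "total_law = distr step_measure borel average_sum"

lemma real_distribution_total_law: "real_distribution total_law"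
  unfolding total_law_def by (intro mix.real_distribution_distr) measurable

sublocale total: real_distribution total_law
  by (rule real_distribution_total_law)

text \<open>The mixture formula \<open>nn_integral_step_measure\<close> concerns nonnegative
  integrands, so \<open>1 + h\<close> is integrated in place of \<open>h\<close>; taking
  \<open>g\<close> and \<open>- g\<close> for \<open>h\<close> gives both sides.\<close>

lemma integral_step_measure_bound:
  fixes g :: "('g vertex \<times> 'g vertex \<Rightarrow> int) \<Rightarrow> real"
  assumes g[measurable]: "g \<in> borel_measurable outward_space" and "\<And>\<xi>. \<bar>g \<xi>\<bar> \<le> 1" "e \<le> 1"
    and bound: "\<And>\<sigma>. \<bar>\<integral>\<xi>. g \<xi> \<partial>step_kernel \<sigma>\<bar> \<le> e"
  shows "\<bar>\<integral>\<xi>. g \<xi> \<partial>step_measure\<bar> \<le> e"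
proof -
  have upper: "(\<integral>\<xi>. h \<xi> \<partial>step_measure) \<le> e"
    if [measurable]: "h \<in> borel_measurable outward_space" and h1: "\<And>\<xi>. \<bar>h \<xi>\<bar> \<le> 1"
      and hb: "\<And>\<sigma>. (\<integral>\<xi>. h \<xi> \<partial>step_kernel \<sigma>) \<le> e" and e: "e \<ge> 0" for h
  proof -
    have pos: "0 \<le> 1 + h \<xi>" for \<xi> using h1[of \<xi>] by linarith
    have int: "integrable step_measure h" using h1 by (intro mix.integrable_const_bound[where B=1]) auto
    have intk: "integrable (step_kernel \<sigma>) h" for \<sigma>
    proof (rule product.integrable_const_bound[where B=1])
      show "h \<in> borel_measurable (step_kernel \<sigma>)" using that(1) measurable_cong_sets[OF sets_step_product refl] by blast
    qed (use h1 in auto)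
    have "ennreal (1 + (\<integral>\<xi>. h \<xi> \<partial>step_measure)) = ennreal (\<integral>\<xi>. 1 + h \<xi> \<partial>step_measure)"
      using int by (simp add: mix.prob_space)
    also have "\<dots> = (\<integral>\<^sup>+\<xi>. ennreal (1 + h \<xi>) \<partial>step_measure)"
      using pos int by (intro nn_integral_eq_integral[symmetric]) auto
    also have "\<dots> = (\<integral>\<^sup>+\<sigma>. \<integral>\<^sup>+\<xi>. ennreal (1 + h \<xi>) \<partial>step_kernel \<sigma> \<partial>\<mu>)"
      by (rule nn_integral_step_measure) measurable
    also have "\<dots> = (\<integral>\<^sup>+\<sigma>. ennreal (1 + (\<integral>\<xi>. h \<xi> \<partial>step_kernel \<sigma>)) \<partial>\<mu>)"
      using pos intk by (intro nn_integral_cong) (subst nn_integral_eq_integral, auto simp: product.prob_space)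
    also have "\<dots> \<le> (\<integral>\<^sup>+\<sigma>. ennreal (1 + e) \<partial>\<mu>)"
      using hb by (intro nn_integral_mono ennreal_leI) auto
    also have "\<dots> = ennreal (1 + e)" by (simp add: spin.emeasure_space_1[simplified])
    finally show ?thesis using e by (subst (asm) ennreal_le_iff) auto
  qed
  have e: "0 \<le> e" using bound[of undefined] by linarith
  have "(\<integral>\<xi>. g \<xi> \<partial>step_measure) \<le> e" "(\<integral>\<xi>. - g \<xi> \<partial>step_measure) \<le> e"
    using bound assms(2) e by (intro upper; simp add: abs_le_iff)+
  then show ?thesis by (simp add: abs_le_iff)
qed

lemma total_law_rapid: "rapidly_decreasing (char total_law)"
  unfolding rapidly_decreasing_def
proof (intro conjI allI total.char_measurable)
  fix m
  obtain K where K: "\<And>a :: 'g vertex \<times> 'g vertex \<Rightarrow> bit. \<And>t. \<bar>t\<bar> ^ m * cmod (char (average_law a) t) \<le> K"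
    using average_law_char_decay[OF card, of m] by blast
  show "\<exists>K. \<forall>t. \<bar>t\<bar> ^ m * cmod (char total_law t) \<le> K"
  \<comment> \<open>The factor 2 arises because real and imaginary parts are bounded
    separately.\<close>
  proof (intro exI[of _ "2 * K + 1"] allI)
    fix t :: real
    have K0: "K \<ge> 0" using K[of 1 undefined] norm_ge_zero by (metis abs_one mult_1 order_trans power_one)
    have char_k: "char (average_law a) t = (\<integral>\<xi>. iexp (t * average_sum \<xi>) \<partial>step_product a)" for a :: "'g vertex \<times> 'g vertex \<Rightarrow> bit"
      unfolding char_def average_law_def by (subst integral_distr) auto
    have char_t: "char total_law t = (\<integral>\<xi>. iexp (t * average_sum \<xi>) \<partial>step_measure)"
      unfolding char_def total_law_def by (subst integral_distr) auto
    show "\<bar>t\<bar> ^ m * cmod (char total_law t) \<le> 2 * K + 1"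
    proof (cases "\<bar>t\<bar> ^ m = 0")
      case False
      then have tm: "\<bar>t\<bar> ^ m > 0" by simp
      \<comment> \<open>The minimum with 1 meets the hypothesis \<open>e \<le> 1\<close> of
        \<open>integral_step_measure_bound\<close>.\<close>
      define e where "e = min 1 (K / \<bar>t\<bar> ^ m)"
      have ce: "cmod (char (average_law a) t) \<le> e" for a :: "'g vertex \<times> 'g vertex \<Rightarrow> bit"
        using K[of t a] tm average.cmod_char_le_1[of a t] by (simp add: e_def pos_le_divide_eq mult.commute)
      have e1: "e \<le> 1" by (simp add: e_def)
      have int: "integrable (step_product a) (\<lambda>\<xi>. iexp (t * average_sum \<xi>))" for a :: "'g vertex \<times> 'g vertex \<Rightarrow> bit"
        by (intro product.integrable_const_bound[where B=1]) auto
      have intm: "integrable step_measure (\<lambda>\<xi>. iexp (t * average_sum \<xi>))"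
        by (intro mix.integrable_const_bound[where B=1]) auto
      have "\<bar>\<integral>\<xi>. Re (iexp (t * average_sum \<xi>)) \<partial>step_measure\<bar> \<le> e"
      proof (rule integral_step_measure_bound[OF _ _ e1])
        fix \<sigma> :: "'g vertex \<Rightarrow> bit"
        show "\<bar>\<integral>\<xi>. Re (iexp (t * average_sum \<xi>)) \<partial>step_kernel \<sigma>\<bar> \<le> e"
          unfolding integral_Re[OF int] char_k[symmetric] using abs_Re_le_cmod ce order_trans by blast
        show "\<bar>Re (iexp (t * average_sum \<xi>))\<bar> \<le> 1" for \<xi> :: "'g vertex \<times> 'g vertex \<Rightarrow> int"
          by (rule order_trans[OF abs_Re_le_cmod]) simp
      qed measurable
      moreover have "\<bar>\<integral>\<xi>. Im (iexp (t * average_sum \<xi>)) \<partial>step_measure\<bar> \<le> e"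
      proof (rule integral_step_measure_bound[OF _ _ e1])
        fix \<sigma> :: "'g vertex \<Rightarrow> bit"
        show "\<bar>\<integral>\<xi>. Im (iexp (t * average_sum \<xi>)) \<partial>step_kernel \<sigma>\<bar> \<le> e"
          unfolding integral_Im[OF int] char_k[symmetric] using abs_Im_le_cmod ce order_trans by blast
        show "\<bar>Im (iexp (t * average_sum \<xi>))\<bar> \<le> 1" for \<xi> :: "'g vertex \<times> 'g vertex \<Rightarrow> int"
          by (rule order_trans[OF abs_Im_le_cmod]) simp
      qed measurable
      ultimately have "cmod (char total_law t) \<le> 2 * e"
        unfolding integral_Re[OF intm] integral_Im[OF intm] char_t[symmetric]
        using cmod_le[of "char total_law t"] by linarith
      also have "\<dots> \<le> 2 * (K / \<bar>t\<bar> ^ m)" by (simp add: e_def)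
      finally have "\<bar>t\<bar> ^ m * cmod (char total_law t) \<le> 2 * K"
        using tm by (simp add: field_simps)
      then show ?thesis by simp
    next
      case True
      show ?thesis unfolding True using K0 by simp
    qed
  qed
qed

definition total_density :: "real \<Rightarrow> real" where
  "total_density = inv_fourier (char total_law)"

lemma total_law_eq_density: "total_law = density lborel (\<lambda>x. ennreal (total_density x))"
  unfolding total_density_def by (rule total.rapid_char_density[OF total_law_rapid])

text \<open>Fatou's lemma for the rescaled masses of the intervals to the right of \<open>x\<close>
  bounds the integral of \<open>average_density (spin_diff \<sigma>) x\<close> over \<sigma> by
  \<open>total_density x\<close>. A zero of the latter would force the former to vanish for almost
  every \<sigma>, although it is positive for all.\<close>

lemma total_density_pos: "total_density x > 0"
proof (rule ccontr)
  assume "\<not> total_density x > 0"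
  then have zero: "total_density x \<le> 0" by simp
  let ?I = "\<lambda>n. {x<..x + 1 / real (Suc n)}"
  define u where "u n \<sigma> = ennreal (real (Suc n)) * emeasure (average_law (spin_diff \<sigma>)) (?I n)" for n and \<sigma> :: "'g vertex \<Rightarrow> bit"
  have pre: "average_sum -` ?I n \<inter> space outward_space \<in> sets (outward_space :: ('g vertex \<times> 'g vertex \<Rightarrow> int) measure)" for n
    by (rule measurable_sets[OF average_sum_measurable_outward]) simp
  have space_eq: "space (step_product a) = space outward_space" for a :: "'g vertex \<times> 'g vertex \<Rightarrow> bit"
    by (rule sets_eq_imp_space_eq[OF sets_step_product])
  have u_eq: "u n \<sigma> = ennreal (real (Suc n)) * emeasure (step_kernel \<sigma>) (average_sum -` ?I n \<inter> space outward_space)" for n \<sigma>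
    unfolding u_def average_law_def by (subst emeasure_distr) (auto simp: space_eq)
  have [measurable]: "u n \<in> borel_measurable \<mu>" for n
    unfolding u_eq[abs_def] using pre measurable_emeasure_kernel[OF step_kernel_measurable] by measurable
  have u_lim: "(\<lambda>n. u n \<sigma>) \<longlonglongrightarrow> ennreal (average_density (spin_diff \<sigma>) x)" for \<sigma>
  proof -
    have "(\<lambda>n. ennreal (real (Suc n) * measure (average_law (spin_diff \<sigma>)) (?I n))) \<longlonglongrightarrow> ennreal (average_density (spin_diff \<sigma>) x)"
      unfolding average_density_def
      by (intro tendsto_ennrealI average.rapid_char_density_limit average_law_rapid card)
    then show ?thesis by (simp add: u_def average.emeasure_eq_measure ennreal_mult)
  qed
  then have u_liminf: "liminf (\<lambda>n. u n \<sigma>) = ennreal (average_density (spin_diff \<sigma>) x)" for \<sigma>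
    by (intro lim_imp_Liminf) auto
  have int_u: "(\<integral>\<^sup>+\<sigma>. u n \<sigma> \<partial>\<mu>) = ennreal (real (Suc n) * measure total_law (?I n))" for n
  proof -
    have "(\<integral>\<^sup>+\<sigma>. u n \<sigma> \<partial>\<mu>) = ennreal (real (Suc n)) * emeasure step_measure (average_sum -` ?I n \<inter> space outward_space)"
      unfolding u_eq emeasure_step_measure[OF pre] using pre measurable_emeasure_kernel[OF step_kernel_measurable]
      by (intro nn_integral_cmult) measurable
    also have "emeasure step_measure (average_sum -` ?I n \<inter> space outward_space) = emeasure total_law (?I n)"
      unfolding total_law_def by (subst emeasure_distr) (auto simp: sets_eq_imp_space_eq[OF sets_step_measure])
    finally show ?thesis by (simp add: total.emeasure_eq_measure ennreal_mult)
  qed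
  have "(\<integral>\<^sup>+\<sigma>. liminf (\<lambda>n. u n \<sigma>) \<partial>\<mu>) \<le> liminf (\<lambda>n. \<integral>\<^sup>+\<sigma>. u n \<sigma> \<partial>\<mu>)"
    by (rule nn_integral_liminf) measurable
  also have "\<dots> = liminf (\<lambda>n. ennreal (real (Suc n) * measure total_law (?I n)))"
    unfolding int_u ..
  also have "liminf (\<lambda>n. ennreal (real (Suc n) * measure total_law (?I n))) = ennreal (total_density x)"
    unfolding total_density_def
    by (intro lim_imp_Liminf tendsto_ennrealI total.rapid_char_density_limit total_law_rapid) simp
  also have "\<dots> = 0" using zero by (simp add: ennreal_neg)
  finally have "(\<integral>\<^sup>+\<sigma>. liminf (\<lambda>n. u n \<sigma>) \<partial>\<mu>) = 0" by simp
  then have "AE \<sigma> in \<mu>. liminf (\<lambda>n. u n \<sigma>) = 0"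
    by (subst (asm) nn_integral_0_iff_AE) measurable
  then have "AE \<sigma> in \<mu>. False"
    unfolding u_liminf using average_density_pos[OF card] by (auto elim!: eventually_mono simp: ennreal_eq_0_iff not_le[symmetric])
  then show False by simp
qed

lemma total_mgf_bound:
  assumes t: "t > 0" "(\<lambda>j. exp (t * real_of_int j) * Q j) summable_on UNIV"
    and l: "\<bar>l\<bar> \<le> real CARD('g) * t"
  obtains B where "B \<ge> 0" "(\<integral>\<^sup>+\<xi>. ennreal (exp (l * average_sum \<xi>)) \<partial>step_measure) \<le> ennreal B"
proof -
  obtain B where B: "B \<ge> 0" "\<And>a :: 'g vertex \<times> 'g vertex \<Rightarrow> bit.
     (\<integral>\<^sup>+\<xi>. ennreal (exp (l * average_sum \<xi>)) \<partial>step_product a) \<le> ennreal B"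
    using average_mgf_bound[OF card t l] by blast
  have "(\<integral>\<^sup>+\<xi>. ennreal (exp (l * average_sum \<xi>)) \<partial>step_measure) =
      (\<integral>\<^sup>+\<sigma>. \<integral>\<^sup>+\<xi>. ennreal (exp (l * average_sum \<xi>)) \<partial>step_kernel \<sigma> \<partial>\<mu>)"
    by (rule nn_integral_step_measure) measurable
  also have "\<dots> \<le> (\<integral>\<^sup>+\<sigma>. ennreal B \<partial>\<mu>)" by (intro nn_integral_mono B)
  also have "\<dots> = ennreal B" by (simp add: spin.emeasure_space_1[simplified])
  finally show ?thesis using that B(1) by blast
qed

end

section \<open>Gibbs kernels\<close>

definition touching :: "'g vertex set \<Rightarrow> ('g vertex \<times> 'g vertex) set" where
  "touching \<Lambda> = {(x, y) \<in> outward_edges. x \<in> \<Lambda> \<or> y \<in> \<Lambda>}"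

definition edge_product ::
  "('s::ab_group_add \<Rightarrow> real) \<Rightarrow> ('g vertex \<times> 'g vertex) set \<Rightarrow> ('g vertex \<Rightarrow> 's) \<Rightarrow> real" where
  "edge_product Q E \<omega> = (\<Prod>e\<in>E. Q (\<omega> (snd e) - \<omega> (fst e)))"

definition ball_at :: "nat \<Rightarrow> 'g vertex set" where
  "ball_at n = {v. depth v \<le> n}"

lemma finite_ball_at [simp]: "finite (ball_at n :: 'g::finite vertex set)"
  by (simp add: ball_at_def finite_depth_le)

lemma touching_subset_ball:
  assumes "\<Lambda> \<subseteq> ball_at n" "(x, y) \<in> touching \<Lambda>"
  shows "x \<in> ball_at (Suc n)" "y \<in> ball_at (Suc n)"
proof -
  have "y \<noteq> 1" "x = parent y" "x \<in> \<Lambda> \<or> y \<in> \<Lambda>"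
    using assms(2) by (auto simp: touching_def outward_edges_iff)
  then show "x \<in> ball_at (Suc n)" "y \<in> ball_at (Suc n)"
    using assms(1) depth_parent[of y] by (auto simp: ball_at_def subset_eq)
qed

lemma finite_touching:
  assumes "finite (\<Lambda> :: 'g::finite vertex set)"
  shows "finite (touching \<Lambda>)"
proof -
  obtain n where "\<Lambda> \<subseteq> ball_at n" using finite_subset_ball[OF assms] unfolding ball_at_def by blast
  then have "touching \<Lambda> \<subseteq> ball_at (Suc n) \<times> ball_at (Suc n)"
    using touching_subset_ball[of \<Lambda> n] by (intro subrelI SigmaI) blast+
  then show ?thesis by (rule finite_subset) simp
qed

text \<open>Interior and boundary edges are merged into one product over
  \<open>touching \<Lambda>\<close>. The boundary edges, which \<open>gibbs_weight\<close> lists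
  from outside to inside, are turned away from the root by symmetry of \<open>Q\<close>.\<close>

lemma gibbs_weight_eq:
  fixes \<Lambda> :: "'g::finite vertex set"
  assumes sym: "\<And>a. Q (- a) = Q a" and fin: "finite \<Lambda>"
  shows "gibbs_weight Q \<Lambda> \<omega> \<omega>' = edge_product Q (touching \<Lambda>) (override_on \<omega> \<omega>' \<Lambda>)"
proof -
  let ?w = "override_on \<omega> \<omega>' \<Lambda>"
  let ?g = "\<lambda>e. Q (?w (snd e) - ?w (fst e))"
  have Qs: "Q (a - b) = Q (b - a)" for a b using sym[of "a - b"] by simp
  define I where "I = {(x, y) \<in> outward_edges. x \<in> \<Lambda> \<and> y \<in> \<Lambda>}"
  define J where "J = {(x, y) \<in> outward_edges. (x \<in> \<Lambda>) \<noteq> (y \<in> \<Lambda>)}"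
  have IJ: "touching \<Lambda> = I \<union> J" "I \<inter> J = {}" by (auto simp: touching_def I_def J_def)
  have "(\<Prod>(x, y)\<in>I. Q (\<omega>' x - \<omega>' y)) = (\<Prod>e\<in>I. ?g e)"
    by (intro prod.cong) (auto simp: I_def intro: Qs)
  moreover have "(\<Prod>(x, y)\<in>{(x, y) \<in> edges. x \<in> boundary \<Lambda> \<and> y \<in> \<Lambda>}. Q (\<omega> x - \<omega>' y)) = (\<Prod>e\<in>J. ?g e)"
  proof (rule prod.reindex_bij_witness[where i="\<lambda>(x, y). if y \<in> \<Lambda> then (x, y) else (y, x)"
        and j="\<lambda>(x, y). if (x, y) \<in> outward_edges then (x, y) else (y, x)"])
    fix e assume "e \<in> {(x, y) \<in> edges. x \<in> boundary \<Lambda> \<and> y \<in> \<Lambda>}"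
    then obtain x y where e: "e = (x, y)" "x \<notin> \<Lambda>" "y \<in> \<Lambda>" "(x, y) \<in> outward_edges \<or> (y, x) \<in> outward_edges"
      by (auto simp: boundary_def edges_orient)
    show "(\<lambda>(x, y). if (x, y) \<in> outward_edges then (x, y) else (y, x)) e \<in> J"
      using e by (cases "(x, y) \<in> outward_edges") (simp_all add: J_def)
    show "?g ((\<lambda>(x, y). if (x, y) \<in> outward_edges then (x, y) else (y, x)) e) = (case e of (x, y) \<Rightarrow> Q (\<omega> x - \<omega>' y))"
      using e Qs[of "\<omega>' y" "\<omega> x"] by simp
    show "(\<lambda>(x, y). if y \<in> \<Lambda> then (x, y) else (y, x)) ((\<lambda>(x, y). if (x, y) \<in> outward_edges then (x, y) else (y, x)) e) = e"
      using e by simp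
  next
    fix e assume "e \<in> J"
    then obtain x y where e: "e = (x, y)" "(x, y) \<in> outward_edges" "(x \<in> \<Lambda>) \<noteq> (y \<in> \<Lambda>)"
      by (auto simp: J_def)
    have "(y, x) \<notin> outward_edges" using e(2) by (rule outward_edges_antisym)
    then show "(\<lambda>(x, y). if (x, y) \<in> outward_edges then (x, y) else (y, x)) ((\<lambda>(x, y). if y \<in> \<Lambda> then (x, y) else (y, x)) e) = e"
      using e by simp
    have "(x, y) \<in> edges" "(y, x) \<in> edges" using e(2) by (simp_all add: edges_orient)
    then show "(\<lambda>(x, y). if y \<in> \<Lambda> then (x, y) else (y, x)) e \<in> {(x, y) \<in> edges. x \<in> boundary \<Lambda> \<and> y \<in> \<Lambda>}"
      using e by (auto simp: boundary_def)
  qed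
  moreover have "finite I" "finite J" using finite_touching[OF fin] unfolding IJ by auto
  ultimately show ?thesis
    unfolding gibbs_weight_def edge_product_def IJ(1)
    using IJ(2) by (simp add: prod.union_disjoint I_def[symmetric])
qed

lemma edge_product_cong:
  "(\<And>x y. (x, y) \<in> E \<Longrightarrow> \<omega> x = \<omega>' x \<and> \<omega> y = \<omega>' y) \<Longrightarrow> edge_product Q E \<omega> = edge_product Q E \<omega>'"
  unfolding edge_product_def by (intro prod.cong refl) (metis prod.collapse)

lemma edge_product_pos: "(\<And>a. Q a > 0) \<Longrightarrow> edge_product Q E \<omega> > 0"
  unfolding edge_product_def by (intro prod_pos) simp

lemma cylinder_disjoint:
  "x \<in> B \<Longrightarrow> \<zeta> x \<noteq> \<zeta>' x \<Longrightarrow> cylinder B \<zeta> \<inter> cylinder B \<zeta>' = {}"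
  by (auto simp: cylinder_def)

lemma override_measurable [measurable]: "(\<lambda>\<omega>. override_on \<omega> \<omega>' \<Lambda>) \<in> measurable config_space config_space"
  unfolding measurable_config_space_iff
proof
  fix x show "(\<lambda>\<omega>. override_on \<omega> \<omega>' \<Lambda> x) \<in> measurable config_space (count_space UNIV)"
    by (cases "x \<in> \<Lambda>") auto
qed

lemma cylinder_decompose:
  assumes "\<Lambda> \<subseteq> B"
  shows "cylinder (B - \<Lambda>) \<zeta> = (\<Union>\<omega>'\<in>\<Lambda> \<rightarrow>\<^sub>E UNIV. cylinder B (override_on \<zeta> \<omega>' \<Lambda>))"
proof (intro equalityI subsetI)
  fix \<omega> assume "\<omega> \<in> cylinder (B - \<Lambda>) \<zeta>"
  then have "\<omega> \<in> cylinder B (override_on \<zeta> (restrict \<omega> \<Lambda>) \<Lambda>)"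
    by (auto simp: cylinder_def override_on_def)
  then show "\<omega> \<in> (\<Union>\<omega>'\<in>\<Lambda> \<rightarrow>\<^sub>E UNIV. cylinder B (override_on \<zeta> \<omega>' \<Lambda>))" by auto
qed (use assms in \<open>auto simp: cylinder_def override_on_def\<close>)

lemma emeasure_cylinder_decompose:
  fixes M :: "('g::finite vertex \<Rightarrow> 's::countable) measure"
  assumes "sets M = sets config_space" "finite B" "\<Lambda> \<subseteq> B"
  shows "emeasure M (cylinder (B - \<Lambda>) \<zeta>) =
    (\<integral>\<^sup>+\<omega>'. emeasure M (cylinder B (override_on \<zeta> \<omega>' \<Lambda>)) \<partial>count_space (\<Lambda> \<rightarrow>\<^sub>E UNIV))"
  unfolding cylinder_decompose[OF assms(3)]
proof (rule emeasure_UN_countable)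
  have "finite \<Lambda>" using assms finite_subset by blast
  then show "countable (\<Lambda> \<rightarrow>\<^sub>E (UNIV :: 's set))" by (intro countable_PiE) auto
  show "cylinder B (override_on \<zeta> \<omega>' \<Lambda>) \<in> sets M" for \<omega>'
    using assms by (simp add: sets_cylinder)
  show "disjoint_family_on (\<lambda>\<omega>'. cylinder B (override_on \<zeta> \<omega>' \<Lambda>)) (\<Lambda> \<rightarrow>\<^sub>E UNIV)"
    unfolding disjoint_family_on_def
  proof (intro ballI impI)
    fix m n assume mn: "m \<in> \<Lambda> \<rightarrow>\<^sub>E (UNIV :: 's set)" "n \<in> \<Lambda> \<rightarrow>\<^sub>E (UNIV :: 's set)" "m \<noteq> n"
    then obtain x where "x \<in> \<Lambda>" "m x \<noteq> n x" by (metis PiE_ext)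
    then show "cylinder B (override_on \<zeta> m \<Lambda>) \<inter> cylinder B (override_on \<zeta> n \<Lambda>) = {}"
      using assms(3) by (intro cylinder_disjoint[of x]) auto
  qed
qed

text \<open>Serves both the hidden spins and the heights. \<open>Z_finite\<close> is immediate for
  the finite type of spins; for heights it is obtained in \<open>height_region\<close>.\<close>

locale gibbs_region =
  fixes Q :: "'s::{ab_group_add, countable} \<Rightarrow> real" and \<Lambda> :: "'g::finite vertex set"
  assumes Q_pos: "\<And>a. Q a > 0" and Q_sym: "\<And>a. Q (- a) = Q a" and finite_\<Lambda>: "finite \<Lambda>"
    and Z_finite: "\<And>\<omega>. (\<integral>\<^sup>+\<omega>'. ennreal (edge_product Q (touching \<Lambda>) (override_on \<omega> \<omega>' \<Lambda>)) \<partial>count_space (\<Lambda> \<rightarrow>\<^sub>E UNIV)) < \<infinity>"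
begin

abbreviation "wt \<equiv> edge_product Q (touching \<Lambda>)"
abbreviation "Z \<equiv> partition_function Q \<Lambda>"

lemma wt_pos: "wt \<omega> > 0"
  by (intro edge_product_pos Q_pos)

lemma countable_local: "countable (\<Lambda> \<rightarrow>\<^sub>E (UNIV :: 's set))"
  using finite_\<Lambda> by (intro countable_PiE) auto

lemma gibbs_weight_eq_wt: "gibbs_weight Q \<Lambda> \<omega> \<omega>' = wt (override_on \<omega> \<omega>' \<Lambda>)"
  by (rule gibbs_weight_eq) (use Q_sym finite_\<Lambda> in auto)

lemma partition_function_eq: "Z \<omega> = (\<Sum>\<^sub>\<infinity>\<omega>'\<in>\<Lambda> \<rightarrow>\<^sub>E UNIV. wt (override_on \<omega> \<omega>' \<Lambda>))"
  unfolding partition_function_def by (intro infsum_cong gibbs_weight_eq_wt)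

lemma nn_integral_wt:
  "(\<integral>\<^sup>+\<omega>'. ennreal (wt (override_on \<omega> \<omega>' \<Lambda>)) \<partial>count_space (\<Lambda> \<rightarrow>\<^sub>E UNIV)) = ennreal (Z \<omega>)"
  unfolding partition_function_eq using wt_pos less_imp_le
  by (intro nn_integral_count_space_infsum summable_on_if_nn_integral_finite Z_finite) auto

lemma Z_pos: "Z \<omega> > 0"
proof -
  have "0 < ennreal (wt (override_on \<omega> (\<lambda>_\<in>\<Lambda>. 0 :: 's) \<Lambda>))"
    using wt_pos by (simp add: ennreal_less_zero_iff)
  also have "\<dots> = (\<integral>\<^sup>+\<omega>'. ennreal (wt (override_on \<omega> (\<lambda>_\<in>\<Lambda>. 0 :: 's) \<Lambda>)) * indicator {\<lambda>_\<in>\<Lambda>. 0 :: 's} \<omega>' \<partial>count_space (\<Lambda> \<rightarrow>\<^sub>E UNIV))"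
    by (subst nn_integral_cmult_indicator) (auto simp: emeasure_count_space)
  also have "\<dots> \<le> (\<integral>\<^sup>+\<omega>'. ennreal (wt (override_on \<omega> \<omega>' \<Lambda>)) \<partial>count_space (\<Lambda> \<rightarrow>\<^sub>E UNIV))"
    by (intro nn_integral_mono) (auto simp: indicator_def)
  finally show ?thesis unfolding nn_integral_wt by simp
qed

lemma wt_cong:
  assumes "\<And>x. x \<in> fst ` touching \<Lambda> \<union> snd ` touching \<Lambda> \<Longrightarrow> \<omega> x = \<omega>' x"
  shows "wt \<omega> = wt \<omega>'"
  using assms by (intro edge_product_cong) force

lemma Z_cong:
  assumes "\<And>x. x \<in> fst ` touching \<Lambda> \<union> snd ` touching \<Lambda> \<Longrightarrow> x \<notin> \<Lambda> \<Longrightarrow> \<omega> x = \<omega>' x"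
  shows "Z \<omega> = Z \<omega>'"
  unfolding partition_function_eq using assms
  by (intro infsum_cong wt_cong) (auto simp: override_on_def)

lemma finite_nb: "finite (fst ` touching \<Lambda> \<union> snd ` touching \<Lambda>)"
  using finite_touching[OF finite_\<Lambda>] by simp

lemma emeasure_gibbs_kernel:
  assumes [measurable]: "A \<in> sets config_space"
  shows "emeasure (gibbs_kernel Q \<Lambda> \<omega>) A =
    (\<integral>\<^sup>+\<omega>'. ennreal (wt (override_on \<omega> \<omega>' \<Lambda>) / Z \<omega>) * indicator A (override_on \<omega> \<omega>' \<Lambda>) \<partial>count_space (\<Lambda> \<rightarrow>\<^sub>E UNIV))"
proof -
  let ?C = "count_space (\<Lambda> \<rightarrow>\<^sub>E (UNIV :: 's set))"
  have m: "(\<lambda>\<omega>'. override_on \<omega> \<omega>' \<Lambda>) \<in> measurable (density ?C f) config_space" for f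
    by simp
  have "emeasure (gibbs_kernel Q \<Lambda> \<omega>) A = (\<integral>\<^sup>+\<omega>'. indicator A \<omega>' \<partial>gibbs_kernel Q \<Lambda> \<omega>)"
    by (simp add: gibbs_kernel_def)
  also have "\<dots> = (\<integral>\<^sup>+\<omega>'. ennreal (wt (override_on \<omega> \<omega>' \<Lambda>) / Z \<omega>) * indicator A (override_on \<omega> \<omega>' \<Lambda>) \<partial>?C)"
    unfolding gibbs_kernel_def gibbs_weight_eq_wt
    by (subst nn_integral_distr[OF m]) (auto simp: nn_integral_density)
  finally show ?thesis .
qed

lemma sets_gibbs_kernel [simp]: "sets (gibbs_kernel Q \<Lambda> \<omega>) = sets config_space"
  by (simp add: gibbs_kernel_def)

lemma space_gibbs_kernel [simp]: "space (gibbs_kernel Q \<Lambda> \<omega>) = UNIV"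
  by (simp add: gibbs_kernel_def)

lemma prob_space_gibbs_kernel: "prob_space (gibbs_kernel Q \<Lambda> \<omega>)"
proof (rule prob_spaceI)
  have "emeasure (gibbs_kernel Q \<Lambda> \<omega>) (space (gibbs_kernel Q \<Lambda> \<omega>)) =
    (\<integral>\<^sup>+\<omega>'. ennreal (1 / Z \<omega>) * ennreal (wt (override_on \<omega> \<omega>' \<Lambda>)) \<partial>count_space (\<Lambda> \<rightarrow>\<^sub>E UNIV))"
    unfolding space_gibbs_kernel emeasure_gibbs_kernel[OF sets.top[of config_space, simplified]]
    using Z_pos[of \<omega>] wt_pos[THEN less_imp_le]
    by (intro nn_integral_cong) (subst ennreal_mult[symmetric], simp_all)
  also have "\<dots> = ennreal (1 / Z \<omega>) * ennreal (Z \<omega>)"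
    by (subst nn_integral_cmult) (auto simp: nn_integral_wt)
  also have "\<dots> = 1" using Z_pos[of \<omega>] by (simp add: ennreal_mult[symmetric])
  finally show "emeasure (gibbs_kernel Q \<Lambda> \<omega>) (space (gibbs_kernel Q \<Lambda> \<omega>)) = 1" .
qed

lemma gibbs_kernel_measurable [measurable]: "gibbs_kernel Q \<Lambda> \<in> measurable config_space (subprob_algebra config_space)"
proof (rule measurable_subprob_algebra)
  fix \<omega> :: "'g vertex \<Rightarrow> 's"
  show "subprob_space (gibbs_kernel Q \<Lambda> \<omega>)" by (rule prob_space_imp_subprob_space[OF prob_space_gibbs_kernel])
next
  fix A :: "('g vertex \<Rightarrow> 's) set" assume A[measurable]: "A \<in> sets config_space"
  let ?C = "count_space (\<Lambda> \<rightarrow>\<^sub>E (UNIV :: 's set))"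
  interpret C: sigma_finite_measure ?C
    by (rule sigma_finite_measure_count_space_countable[OF countable_local])
  let ?f = "\<lambda>\<omega> \<omega>'. ennreal (wt (override_on \<omega> \<omega>' \<Lambda>) / Z \<omega>) * indicator A (override_on \<omega> \<omega>' \<Lambda>)"
  have 1: "(\<lambda>\<omega>. ?f \<omega> \<omega>') \<in> borel_measurable config_space" for \<omega>'
  proof -
    have [measurable]: "(\<lambda>\<omega>. wt (override_on \<omega> \<omega>' \<Lambda>)) \<in> borel_measurable config_space"
      by (rule measurable_finitely_determined[OF finite_nb], rule wt_cong) (auto simp: override_on_def)
    have [measurable]: "Z \<in> borel_measurable config_space"
      by (rule measurable_finitely_determined[OF finite_nb], rule Z_cong) auto
    show ?thesis by measurable
  qed
  have "(\<lambda>(\<omega>', \<omega>). ?f \<omega> \<omega>') \<in> borel_measurable (?C \<Otimes>\<^sub>M config_space)"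
    by (rule measurable_pair_measure_countable1[OF countable_local]) (simp add: 1)
  then have "case_prod ?f \<in> borel_measurable (config_space \<Otimes>\<^sub>M ?C)"
    by (subst measurable_pair_swap_iff) (simp add: split_def)
  then have "(\<lambda>\<omega>. \<integral>\<^sup>+\<omega>'. ?f \<omega> \<omega>' \<partial>?C) \<in> borel_measurable config_space"
    by (rule C.borel_measurable_nn_integral)
  then show "(\<lambda>\<omega>. emeasure (gibbs_kernel Q \<Lambda> \<omega>) A) \<in> borel_measurable config_space"
    unfolding emeasure_gibbs_kernel[OF A] .
qed simp

text \<open>Among all fillings of \<Lambda> only \<open>restrict \<zeta> \<Lambda>\<close> lands in
  the cylinder.\<close>

lemma gibbs_kernel_cylinder:
  assumes B: "finite B" "\<Lambda> \<subseteq> B"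
  shows "emeasure (gibbs_kernel Q \<Lambda> \<omega>) (cylinder B \<zeta>) =
     indicator (cylinder (B - \<Lambda>) \<zeta>) \<omega> * ennreal (wt (override_on \<omega> \<zeta> \<Lambda>) / Z \<omega>)"
proof -
  have "emeasure (gibbs_kernel Q \<Lambda> \<omega>) (cylinder B \<zeta>) =
    (\<integral>\<^sup>+\<omega>'. (indicator (cylinder (B - \<Lambda>) \<zeta>) \<omega> * ennreal (wt (override_on \<omega> \<zeta> \<Lambda>) / Z \<omega>)) * indicator {restrict \<zeta> \<Lambda>} \<omega>' \<partial>count_space (\<Lambda> \<rightarrow>\<^sub>E UNIV))"
    unfolding emeasure_gibbs_kernel[OF sets_cylinder[OF B(1)]]
  proof (intro nn_integral_cong)
    fix \<omega>' assume "\<omega>' \<in> space (count_space (\<Lambda> \<rightarrow>\<^sub>E (UNIV :: 's set)))"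
    then have \<omega>': "\<omega>' \<in> \<Lambda> \<rightarrow>\<^sub>E UNIV" by simp
    have iff: "override_on \<omega> \<omega>' \<Lambda> \<in> cylinder B \<zeta> \<longleftrightarrow> \<omega> \<in> cylinder (B - \<Lambda>) \<zeta> \<and> \<omega>' = restrict \<zeta> \<Lambda>"
    proof
      assume a: "override_on \<omega> \<omega>' \<Lambda> \<in> cylinder B \<zeta>"
      have "\<omega>' x = \<zeta> x" if "x \<in> \<Lambda>" for x
      proof -
        have "override_on \<omega> \<omega>' \<Lambda> x = \<zeta> x" using a that B(2) by (auto simp: cylinder_def simp del: override_on_apply_in)
        then show ?thesis using that by simp
      qed
      then have "\<omega>' = restrict \<zeta> \<Lambda>" using \<omega>' by (intro PiE_ext[of _ \<Lambda> "\<lambda>_. UNIV"]) auto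
      with a show "\<omega> \<in> cylinder (B - \<Lambda>) \<zeta> \<and> \<omega>' = restrict \<zeta> \<Lambda>" by (auto simp: cylinder_def)
    next
      assume "\<omega> \<in> cylinder (B - \<Lambda>) \<zeta> \<and> \<omega>' = restrict \<zeta> \<Lambda>"
      then show "override_on \<omega> \<omega>' \<Lambda> \<in> cylinder B \<zeta>" by (auto simp: cylinder_def override_on_def)
    qed
    have "override_on \<omega> (restrict \<zeta> \<Lambda>) \<Lambda> = override_on \<omega> \<zeta> \<Lambda>" by (auto simp: override_on_def)
    then show "ennreal (wt (override_on \<omega> \<omega>' \<Lambda>) / Z \<omega>) * indicator (cylinder B \<zeta>) (override_on \<omega> \<omega>' \<Lambda>) =
      (indicator (cylinder (B - \<Lambda>) \<zeta>) \<omega> * ennreal (wt (override_on \<omega> \<zeta> \<Lambda>) / Z \<omega>)) * indicator {restrict \<zeta> \<Lambda>} \<omega>'"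
      using iff by (auto simp: indicator_def)
  qed
  also have "\<dots> = indicator (cylinder (B - \<Lambda>) \<zeta>) \<omega> * ennreal (wt (override_on \<omega> \<zeta> \<Lambda>) / Z \<omega>)"
    by (subst nn_integral_cmult_indicator) (auto simp: emeasure_count_space)
  finally show ?thesis .
qed

text \<open>Once \<open>B\<close> contains every end of an edge touching \<Lambda>, weight and
  normalisation are those of \<zeta>. The kernel then depends on \<omega> only through an indicator
  and is easily integrated.\<close>

lemma gibbs_kernel_cylinder_nb:
  assumes B: "finite B" "\<Lambda> \<subseteq> B" "fst ` touching \<Lambda> \<union> snd ` touching \<Lambda> \<subseteq> B"
  shows "emeasure (gibbs_kernel Q \<Lambda> \<omega>) (cylinder B \<zeta>) =
     ennreal (wt \<zeta> / Z \<zeta>) * indicator (cylinder (B - \<Lambda>) \<zeta>) \<omega>"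
proof (cases "\<omega> \<in> cylinder (B - \<Lambda>) \<zeta>")
  case True
  then have agree: "\<omega> x = \<zeta> x" if "x \<in> fst ` touching \<Lambda> \<union> snd ` touching \<Lambda>" "x \<notin> \<Lambda>" for x
    using that B(3) by (auto simp: cylinder_def)
  then have "wt (override_on \<omega> \<zeta> \<Lambda>) = wt \<zeta>" by (intro wt_cong) (auto simp: override_on_def)
  moreover have "Z \<omega> = Z \<zeta>" using agree by (rule Z_cong)
  ultimately show ?thesis using True by (simp add: gibbs_kernel_cylinder[OF B(1,2)])
qed (simp add: gibbs_kernel_cylinder[OF B(1,2)])

text \<open>The kernel resamples only inside \<Lambda>, so an event that does not read \<Lambda>
  factors out. This is what makes conditioning on tail events compatible with the DLR
  equations.\<close>

lemma gibbs_kernel_tail: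
  assumes T: "T \<in> sets config_space" "\<And>\<omega> \<omega>'. override_on \<omega> \<omega>' \<Lambda> \<in> T \<longleftrightarrow> \<omega> \<in> T" and A: "A \<in> sets config_space"
  shows "emeasure (gibbs_kernel Q \<Lambda> \<omega>) (A \<inter> T) = emeasure (gibbs_kernel Q \<Lambda> \<omega>) A * indicator T \<omega>"
proof -
  have "emeasure (gibbs_kernel Q \<Lambda> \<omega>) (A \<inter> T) =
    (\<integral>\<^sup>+\<omega>'. ennreal (wt (override_on \<omega> \<omega>' \<Lambda>) / Z \<omega>) * indicator A (override_on \<omega> \<omega>' \<Lambda>) * indicator T \<omega> \<partial>count_space (\<Lambda> \<rightarrow>\<^sub>E UNIV))"
    using T(2) unfolding emeasure_gibbs_kernel[OF sets.Int[OF A T(1)]]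
    by (intro nn_integral_cong) (auto simp: indicator_def)
  also have "\<dots> = emeasure (gibbs_kernel Q \<Lambda> \<omega>) A * indicator T \<omega>"
    unfolding emeasure_gibbs_kernel[OF A] by (rule nn_integral_multc) simp
  finally show ?thesis .
qed

end

text \<open>Admitting only radii from \<open>n0\<close> on still generates everything, and lets
  every generator see all edges touching a given \<Lambda>.\<close>

lemma sigma_sets_cylinders:
  "sets (config_space :: ('g::finite vertex \<Rightarrow> 's::countable) measure) =
     sigma_sets UNIV (insert {} {cylinder (ball_at n) \<zeta> | n \<zeta>. n0 \<le> n})" (is "_ = sigma_sets UNIV ?E")
proof (intro equalityI)
  interpret S: sigma_algebra UNIV "sigma_sets UNIV ?E" by (rule sigma_algebra_sigma_sets) simp
  show "sigma_sets UNIV ?E \<subseteq> sets config_space"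
  proof -
    have "?E \<subseteq> sets config_space" by (auto intro: sets_cylinder)
    from sets.sigma_sets_subset[OF this] show ?thesis by simp
  qed
  have "{\<omega>. \<omega> x \<in> A} \<in> sigma_sets UNIV ?E" for x and A :: "'s set"
  proof -
    let ?n = "max n0 (depth x)"
    let ?B = "ball_at ?n :: 'g vertex set"
    have x: "x \<in> ?B" by (simp add: ball_at_def)
    have "{\<omega>. \<omega> x \<in> A} = (\<Union>\<zeta>\<in>{\<zeta> \<in> ?B \<rightarrow>\<^sub>E UNIV. \<zeta> x \<in> A}. cylinder ?B \<zeta>)"
    proof (intro equalityI subsetI)
      fix \<omega> assume "\<omega> \<in> {\<omega>. \<omega> x \<in> A}"
      then have "restrict \<omega> ?B \<in> {\<zeta> \<in> ?B \<rightarrow>\<^sub>E UNIV. \<zeta> x \<in> A}" "\<omega> \<in> cylinder ?B (restrict \<omega> ?B)"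
        using x by (auto simp: cylinder_def)
      then show "\<omega> \<in> (\<Union>\<zeta>\<in>{\<zeta> \<in> ?B \<rightarrow>\<^sub>E UNIV. \<zeta> x \<in> A}. cylinder ?B \<zeta>)" by blast
    qed (use x in \<open>auto simp: cylinder_def\<close>)
    moreover have "countable {\<zeta> \<in> ?B \<rightarrow>\<^sub>E (UNIV :: 's set). \<zeta> x \<in> A}"
      by (rule countable_subset[of _ "?B \<rightarrow>\<^sub>E (UNIV :: 's set)"]) (auto intro: countable_PiE)
    moreover have "cylinder ?B \<zeta> \<in> sigma_sets UNIV ?E" for \<zeta> :: "'g vertex \<Rightarrow> 's"
      by (rule sigma_sets.Basic) (auto intro!: exI[of _ ?n])
    ultimately show ?thesis
      by (simp only:) (rule S.countable_UN'')
  qed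
  then show "sets (config_space :: ('g::finite vertex \<Rightarrow> 's::countable) measure) \<subseteq> sigma_sets UNIV ?E"
    unfolding config_space_def sets_PiM_single space_count_space PiE_UNIV_domain
    by (simp, intro sigma_sets_mono) blast
qed

text \<open>Cylinders over concentric balls are nested or disjoint; the empty set was added for the
  second case.\<close>

lemma Int_stable_cylinders:
  "Int_stable (insert {} {cylinder (ball_at n) \<zeta> | n \<zeta>. n0 \<le> n})"
proof -
  have *: "cylinder (ball_at m) \<zeta> \<inter> cylinder (ball_at n) \<zeta>' \<in> insert {} {cylinder (ball_at n) \<zeta> | n \<zeta>. n0 \<le> n}"
    if "n0 \<le> n" "m \<le> n" for m n and \<zeta> \<zeta>' :: "'a vertex \<Rightarrow> 'b"
  proof (cases "\<forall>x\<in>ball_at m. \<zeta> x = \<zeta>' x")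
    case True
    have "ball_at m \<subseteq> (ball_at n :: 'a vertex set)" using that by (auto simp: ball_at_def)
    then have "cylinder (ball_at m) \<zeta> \<inter> cylinder (ball_at n) \<zeta>' = cylinder (ball_at n) \<zeta>'"
      using True by (auto simp: cylinder_def)
    then show ?thesis using that by blast
  next
    case False
    then obtain x where "x \<in> ball_at m" "\<zeta> x \<noteq> \<zeta>' x" by blast
    moreover then have "x \<in> ball_at n" using that by (auto simp: ball_at_def)
    ultimately have "cylinder (ball_at m) \<zeta> \<inter> cylinder (ball_at n) \<zeta>' = {}"
      by (auto simp: cylinder_def)
    then show ?thesis by simp
  qed
  show ?thesis
    unfolding Int_stable_def
  proof (intro ballI)
    fix a b :: "('a vertex \<Rightarrow> 'b) set"
    assume ab: "a \<in> insert {} {cylinder (ball_at n) \<zeta> | n \<zeta>. n0 \<le> n}" "b \<in> insert {} {cylinder (ball_at n) \<zeta> | n \<zeta>. n0 \<le> n}"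
    show "a \<inter> b \<in> insert {} {cylinder (ball_at n) \<zeta> | n \<zeta>. n0 \<le> n}"
    proof (cases "a = {} \<or> b = {}")
      case False
      then obtain m \<zeta> n \<zeta>' where ab: "a = cylinder (ball_at m) \<zeta>" "b = cylinder (ball_at n) \<zeta>'" "n0 \<le> m" "n0 \<le> n"
        using ab by auto
      show ?thesis
      proof (cases "m \<le> n")
        case True then show ?thesis unfolding ab by (intro * ab)
      next
        case False
        then have "n \<le> m" by simp
        then show ?thesis unfolding ab by (subst Int_commute) (intro * ab)
      qed
    qed auto
  qed
qed

text \<open>
  \<open>M\<close> may have infinite total mass: below it is the gradient measure with the root height drawn from
  counting measure.
\<close>

lemma (in gibbs_region) gibbs_kernel_invariant:
  assumes sets_M: "sets M = sets config_space"
    and nb: "\<Lambda> \<subseteq> ball_at n0" "fst ` touching \<Lambda> \<union> snd ` touching \<Lambda> \<subseteq> ball_at n0"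
    and fin: "\<And>n \<zeta>. n0 \<le> n \<Longrightarrow> emeasure M (cylinder (ball_at n) \<zeta>) < \<infinity>"
    and factor: "\<And>n \<zeta>. n0 \<le> n \<Longrightarrow> emeasure M (cylinder (ball_at n) \<zeta>) = C n \<zeta> * ennreal (wt \<zeta>)"
    and C: "\<And>n \<zeta> \<omega>'. n0 \<le> n \<Longrightarrow> C n (override_on \<zeta> \<omega>' \<Lambda>) = C n \<zeta>"
  shows "M \<bind> gibbs_kernel Q \<Lambda> = M"
proof (rule measure_eqI_generator_eq_countable[OF Int_stable_cylinders[of n0], where \<Omega>=UNIV, symmetric])
  have kM: "gibbs_kernel Q \<Lambda> \<in> measurable M (subprob_algebra config_space)"
    using gibbs_kernel_measurable measurable_cong_sets[OF sets_M refl] by blast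
  have space_M: "space M = UNIV" using sets_eq_imp_space_eq[OF sets_M] by simp
  show "insert {} {cylinder (ball_at n) \<zeta> |n \<zeta>. n0 \<le> n} \<subseteq> Pow UNIV" by simp
  show "sets M = sigma_sets UNIV (insert {} {cylinder (ball_at n) \<zeta> |n \<zeta>. n0 \<le> n})"
    unfolding sets_M by (rule sigma_sets_cylinders)
  have "sets (M \<bind> gibbs_kernel Q \<Lambda>) = sets config_space"
    by (rule sets_bind) (auto simp: space_M)
  then show "sets (M \<bind> gibbs_kernel Q \<Lambda>) = sigma_sets UNIV (insert {} {cylinder (ball_at n) \<zeta> |n \<zeta>. n0 \<le> n})"
    using sigma_sets_cylinders by blast
  show "emeasure M X = emeasure (M \<bind> gibbs_kernel Q \<Lambda>) X"
    if "X \<in> insert {} {cylinder (ball_at n) \<zeta> |n \<zeta>. n0 \<le> n}" for X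
  proof (cases "X = {}")
    case False
    with that obtain n \<zeta> where X: "X = cylinder (ball_at n) \<zeta>" and n: "n0 \<le> n" by auto
    let ?B = "ball_at n :: 'g vertex set"
    have B: "\<Lambda> \<subseteq> ?B" "fst ` touching \<Lambda> \<union> snd ` touching \<Lambda> \<subseteq> ?B"
    proof -
      have "ball_at n0 \<subseteq> ?B" using n by (auto simp: ball_at_def)
      with nb show "\<Lambda> \<subseteq> ?B" "fst ` touching \<Lambda> \<union> snd ` touching \<Lambda> \<subseteq> ?B" by blast+
    qed
    have "emeasure (M \<bind> gibbs_kernel Q \<Lambda>) X = (\<integral>\<^sup>+\<omega>. ennreal (wt \<zeta> / Z \<zeta>) * indicator (cylinder (?B - \<Lambda>) \<zeta>) \<omega> \<partial>M)"
      unfolding X using sets_cylinder[of ?B \<zeta>]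
      by (subst emeasure_bind[OF _ kM]) (auto simp: space_M gibbs_kernel_cylinder_nb[OF finite_ball_at B])
    also have "\<dots> = ennreal (wt \<zeta> / Z \<zeta>) * emeasure M (cylinder (?B - \<Lambda>) \<zeta>)"
      by (rule nn_integral_cmult_indicator) (simp add: sets_M sets_cylinder)
    also have "emeasure M (cylinder (?B - \<Lambda>) \<zeta>) = (\<integral>\<^sup>+\<omega>'. C n \<zeta> * ennreal (wt (override_on \<zeta> \<omega>' \<Lambda>)) \<partial>count_space (\<Lambda> \<rightarrow>\<^sub>E UNIV))"
      unfolding emeasure_cylinder_decompose[OF sets_M finite_ball_at B(1)] factor[OF n] C[OF n] ..
    also have "\<dots> = C n \<zeta> * ennreal (Z \<zeta>)"
      by (subst nn_integral_cmult) (auto simp: nn_integral_wt)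
    also have "ennreal (wt \<zeta> / Z \<zeta>) * (C n \<zeta> * ennreal (Z \<zeta>)) = C n \<zeta> * (ennreal (wt \<zeta> / Z \<zeta>) * ennreal (Z \<zeta>))"
      by (simp add: mult.left_commute)
    also have "ennreal (wt \<zeta> / Z \<zeta>) * ennreal (Z \<zeta>) = ennreal (wt \<zeta>)"
      using Z_pos[of \<zeta>] wt_pos[of \<zeta>] by (subst ennreal_mult[symmetric]) (auto simp: less_imp_le)
    finally show ?thesis unfolding X factor[OF n] ..
  qed simp
  let ?A = "(\<lambda>\<zeta>. cylinder (ball_at n0) \<zeta>) ` ((ball_at n0 :: 'g vertex set) \<rightarrow>\<^sub>E (UNIV :: 's set))"
  show "countable ?A" by (intro countable_image countable_PiE) auto
  show "?A \<subseteq> insert {} {cylinder (ball_at n) \<zeta> |n \<zeta>. n0 \<le> n}" by auto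
  show "\<Union>?A = UNIV"
  proof (intro equalityI subsetI UNIV_I)
    fix \<omega> :: "'g vertex \<Rightarrow> 's"
    have "\<omega> \<in> cylinder (ball_at n0) (restrict \<omega> (ball_at n0))" by (simp add: cylinder_def)
    then show "\<omega> \<in> \<Union>?A" by auto
  qed
  show "emeasure M a \<noteq> \<infinity>" if "a \<in> ?A" for a
    using that fin[of n0] by (auto simp: less_top)
qed

section \<open>The infinite height measure\<close>

context hidden_ising
begin

lemma fuzzy_region:
  assumes "finite \<Lambda>"
  shows "gibbs_region (fuzzy Q) (\<Lambda> :: 'g vertex set)"
proof
  show "fuzzy Q (- a) = fuzzy Q a" for a by (cases a) simp_all
  have "finite (\<Lambda> \<rightarrow>\<^sub>E (UNIV :: bit set))" using assms by (intro finite_PiE) auto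
  then show "(\<integral>\<^sup>+\<omega>'. ennreal (edge_product (fuzzy Q) (touching \<Lambda>) (override_on \<omega> \<omega>' \<Lambda>)) \<partial>count_space (\<Lambda> \<rightarrow>\<^sub>E UNIV)) < \<infinity>" for \<omega>
    by (simp add: nn_integral_count_space_finite)
qed (use assms fuzzy_pos in auto)

lemma spin_DLR:
  assumes "finite \<Lambda>" "A \<in> sets config_space"
  shows "(\<integral>\<^sup>+\<sigma>. emeasure (gibbs_kernel (fuzzy Q) \<Lambda> \<sigma>) A \<partial>\<mu>) = emeasure \<mu> A"
  using gibbs assms unfolding gibbs_measure_def by blast

text \<open>Resampling inside \<open>B\<close> gives the cylinder positive probability under every
  boundary condition, and the DLR equation transfers this to \<mu>.\<close>

lemma spin_cylinder_pos:
  assumes B: "finite B"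
  shows "emeasure \<mu> (cylinder B \<xi>) > 0"
proof -
  interpret G: gibbs_region "fuzzy Q" B by (rule fuzzy_region[OF B])
  have pos: "emeasure (gibbs_kernel (fuzzy Q) B \<sigma>) (cylinder B \<xi>) > 0" for \<sigma>
    using G.wt_pos G.Z_pos by (subst G.gibbs_kernel_cylinder[OF B]) (auto simp: cylinder_def)
  have [measurable]: "(\<lambda>\<sigma>. emeasure (gibbs_kernel (fuzzy Q) B \<sigma>) (cylinder B \<xi>)) \<in> borel_measurable \<mu>"
    using measurable_emeasure_kernel[OF G.gibbs_kernel_measurable sets_cylinder[OF B]] by measurable
  have "emeasure \<mu> (cylinder B \<xi>) \<noteq> 0"
  proof
    assume "emeasure \<mu> (cylinder B \<xi>) = 0"
    then have "(\<integral>\<^sup>+\<sigma>. emeasure (gibbs_kernel (fuzzy Q) B \<sigma>) (cylinder B \<xi>) \<partial>\<mu>) = 0"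
      unfolding spin_DLR[OF B sets_cylinder[OF B]] .
    then have "AE \<sigma> in \<mu>. emeasure (gibbs_kernel (fuzzy Q) B \<sigma>) (cylinder B \<xi>) = 0"
      by (subst (asm) nn_integral_0_iff_AE) measurable
    then have "AE \<sigma> in \<mu>. False"
    proof eventually_elim
      fix \<sigma> assume "emeasure (gibbs_kernel (fuzzy Q) B \<sigma>) (cylinder B \<xi>) = 0"
      with pos[of \<sigma>] show False by simp
    qed
    then show False by simp
  qed
  then show ?thesis by (simp add: zero_less_iff_neq_zero)
qed

lemma spin_cylinder_factor:
  assumes "finite \<Lambda>" "finite B" "\<Lambda> \<subseteq> B" "fst ` touching \<Lambda> \<union> snd ` touching \<Lambda> \<subseteq> B"
  shows "emeasure \<mu> (cylinder B \<xi>) =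
    ennreal (edge_product (fuzzy Q) (touching \<Lambda>) \<xi> / partition_function (fuzzy Q) \<Lambda> \<xi>) * emeasure \<mu> (cylinder (B - \<Lambda>) \<xi>)"
proof -
  interpret G: gibbs_region "fuzzy Q" \<Lambda> by (rule fuzzy_region) fact
  have "emeasure \<mu> (cylinder B \<xi>) = (\<integral>\<^sup>+\<sigma>. ennreal (G.wt \<xi> / G.Z \<xi>) * indicator (cylinder (B - \<Lambda>) \<xi>) \<sigma> \<partial>\<mu>)"
    unfolding spin_DLR[OF assms(1) sets_cylinder[OF assms(2)], symmetric] G.gibbs_kernel_cylinder_nb[OF assms(2-4)] ..
  also have "\<dots> = ennreal (G.wt \<xi> / G.Z \<xi>) * emeasure \<mu> (cylinder (B - \<Lambda>) \<xi>)"
    using assms(2) by (intro nn_integral_cmult_indicator) (simp add: sets_\<mu> sets_cylinder)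
  finally show ?thesis .
qed

definition height_measure :: "('g vertex \<Rightarrow> int) measure" where
  "height_measure = distr (count_space UNIV \<Otimes>\<^sub>M step_measure) config_space (\<lambda>(s, \<xi>). pinned_height 1 s \<xi>)"

lemma sets_height_measure [measurable_cong, simp]: "sets height_measure = sets config_space"
  by (simp add: height_measure_def)

lemma space_height_measure [simp]: "space height_measure = UNIV"
  by (simp add: height_measure_def)

lemma space_step_measure: "space step_measure = space outward_space"
  by (rule sets_eq_imp_space_eq[OF sets_step_measure])

lemma pinned_height_pair_measurable [measurable]:
  "(\<lambda>(s, \<xi>). pinned_height 1 s \<xi>) \<in> measurable (count_space UNIV \<Otimes>\<^sub>M step_measure) config_space"
  by (rule measurable_pair_measure_countable1) simp_all

text \<open>The first order of integration computes cylinder masses; the second, with the increments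
  fixed, identifies the offset measure.\<close>

lemma nn_integral_height_measure:
  assumes [measurable]: "f \<in> borel_measurable config_space"
  shows "(\<integral>\<^sup>+\<omega>. f \<omega> \<partial>height_measure) = (\<integral>\<^sup>+s. \<integral>\<^sup>+\<xi>. f (pinned_height 1 s \<xi>) \<partial>step_measure \<partial>count_space UNIV)"
    and "(\<integral>\<^sup>+\<omega>. f \<omega> \<partial>height_measure) = (\<integral>\<^sup>+\<xi>. \<integral>\<^sup>+s. f (pinned_height 1 s \<xi>) \<partial>count_space UNIV \<partial>step_measure)"
proof -
  interpret C: sigma_finite_measure "count_space (UNIV :: int set)"
    by (rule sigma_finite_measure_count_space_countable) simp
  interpret P: pair_sigma_finite "count_space (UNIV :: int set)" step_measure ..
  have *: "(\<integral>\<^sup>+\<omega>. f \<omega> \<partial>height_measure) = (\<integral>\<^sup>+p. f (pinned_height 1 (fst p) (snd p)) \<partial>(count_space UNIV \<Otimes>\<^sub>M step_measure))"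
    unfolding height_measure_def by (subst nn_integral_distr) (auto simp: split_def)
  have [measurable]: "(\<lambda>p. f (pinned_height 1 (fst p) (snd p))) \<in> borel_measurable (count_space UNIV \<Otimes>\<^sub>M step_measure)"
    using measurable_compose[OF pinned_height_pair_measurable assms] by (simp add: split_def)
  show "(\<integral>\<^sup>+\<omega>. f \<omega> \<partial>height_measure) = (\<integral>\<^sup>+s. \<integral>\<^sup>+\<xi>. f (pinned_height 1 s \<xi>) \<partial>step_measure \<partial>count_space UNIV)"
    unfolding * by (subst mix.nn_integral_fst[symmetric]) auto
  show "(\<integral>\<^sup>+\<omega>. f \<omega> \<partial>height_measure) = (\<integral>\<^sup>+\<xi>. \<integral>\<^sup>+s. f (pinned_height 1 s \<xi>) \<partial>count_space UNIV \<partial>step_measure)"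
    unfolding * by (subst P.nn_integral_snd[symmetric]) auto
qed

lemma emeasure_height_measure:
  assumes [measurable]: "A \<in> sets config_space"
  shows "emeasure height_measure A =
    (\<integral>\<^sup>+s. emeasure step_measure {\<xi> \<in> space outward_space. pinned_height 1 s \<xi> \<in> A} \<partial>count_space UNIV)"
proof -
  have "emeasure height_measure A = (\<integral>\<^sup>+\<omega>. indicator A \<omega> \<partial>height_measure)" by simp
  also have "\<dots> = (\<integral>\<^sup>+s. \<integral>\<^sup>+\<xi>. indicator A (pinned_height 1 s \<xi>) \<partial>step_measure \<partial>count_space UNIV)"
    by (rule nn_integral_height_measure(1)) measurable
  also have "\<dots> = (\<integral>\<^sup>+s. emeasure step_measure {\<xi> \<in> space outward_space. pinned_height 1 s \<xi> \<in> A} \<partial>count_space UNIV)"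
  proof (intro nn_integral_cong)
    fix s :: int
    have m: "{\<xi> \<in> space outward_space. pinned_height 1 s \<xi> \<in> A} \<in> sets step_measure"
      unfolding space_step_measure[symmetric] by measurable
    have "(\<integral>\<^sup>+\<xi>. indicator A (pinned_height 1 s \<xi>) \<partial>step_measure) =
        (\<integral>\<^sup>+\<xi>. indicator {\<xi> \<in> space outward_space. pinned_height 1 s \<xi> \<in> A} \<xi> \<partial>step_measure)"
      by (intro nn_integral_cong) (auto simp: indicator_def space_step_measure)
    also have "\<dots> = emeasure step_measure {\<xi> \<in> space outward_space. pinned_height 1 s \<xi> \<in> A}"
      using m by simp
    finally show "(\<integral>\<^sup>+\<xi>. indicator A (pinned_height 1 s \<xi>) \<partial>step_measure) = emeasure step_measure {\<xi> \<in> space outward_space. pinned_height 1 s \<xi> \<in> A}" .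
  qed
  finally show ?thesis .
qed

text \<open>For fixed increments exactly one root height produces the value \<open>\<zeta> v\<close>
  at \<open>v\<close>, so every one-site marginal is counting measure. Every cylinder over a set
  with at least one site therefore has mass at most 1.\<close>

lemma height_measure_single_site: "emeasure height_measure (cylinder {v} \<zeta>) = 1"
proof -
  let ?X = "\<lambda>s. {\<xi> \<in> space outward_space. pinned_height 1 s \<xi> \<in> cylinder {v} \<zeta>}"
  have "(\<integral>\<^sup>+s. emeasure step_measure (?X s) \<partial>count_space UNIV) = emeasure step_measure (\<Union>s. ?X s)"
  proof (rule emeasure_UN_countable[symmetric])
    show "?X s \<in> sets step_measure" for s
      using sets_cylinder[of "{v}" \<zeta>] unfolding space_step_measure[symmetric] by measurable
    show "disjoint_family_on ?X UNIV"
      unfolding disjoint_family_on_def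
    proof (intro ballI impI)
      fix m n :: int assume "m \<noteq> n"
      then show "?X m \<inter> ?X n = {}"
        using pinned_height_shift[of m _ v] pinned_height_shift[of n _ v] by (auto simp: cylinder_def)
    qed
  qed auto
  also have "(\<Union>s. ?X s) = space step_measure"
  proof (intro equalityI subsetI)
    fix \<xi> :: "'g vertex \<times> 'g vertex \<Rightarrow> int" assume \<xi>: "\<xi> \<in> space step_measure"
    have "pinned_height 1 (\<zeta> v - pinned_height 1 0 \<xi> v) \<xi> v = \<zeta> v"
      by (subst pinned_height_shift) simp
    then show "\<xi> \<in> (\<Union>s. ?X s)" using \<xi> by (auto simp: cylinder_def space_step_measure)
  qed (auto simp: space_step_measure)
  finally show ?thesis
    by (simp add: emeasure_height_measure sets_cylinder mix.emeasure_space_1)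
qed

section \<open>Cylinder masses of the height measure\<close>

definition ball_edges :: "nat \<Rightarrow> ('g vertex \<times> 'g vertex) set" where
  "ball_edges n = (\<lambda>y. (parent y, y)) ` (ball_at n - {1})"

lemma finite_ball_edges [simp]: "finite (ball_edges n)"
  by (simp add: ball_edges_def)

lemma ball_edges_outward: "ball_edges n \<subseteq> outward_edges"
  by (auto simp: ball_edges_def outward_edges_iff)

lemma ball_edges_fst: "e \<in> ball_edges n \<Longrightarrow> fst e \<in> ball_at n \<and> snd e \<in> ball_at n"
  using depth_parent by (fastforce simp: ball_edges_def ball_at_def)

text \<open>Stated over abelian groups because it is applied both to integer heights and to hidden
  spins.\<close>

lemma ball_increments:
  fixes f h :: "'g vertex \<Rightarrow> 'a::ab_group_add"
  assumes "f 1 = h 1" "\<And>e. e \<in> ball_edges n \<Longrightarrow> f (snd e) - f (fst e) = h (snd e) - h (fst e)" "x \<in> ball_at n"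
  shows "f x = h x"
  using assms(3)
proof (induction x rule: vertex_induct)
  case (step v)
  have "(parent v, v) \<in> ball_edges n" using step by (auto simp: ball_edges_def)
  from assms(2)[OF this] have "f v - f (parent v) = h v - h (parent v)" by simp
  moreover have "f (parent v) = h (parent v)"
    using step depth_parent[of v] by (auto simp: ball_at_def)
  ultimately show ?case by simp
qed (use assms(1) in simp)

lemma pinned_height_cylinder_iff:
  "pinned_height 1 s \<xi> \<in> cylinder (ball_at n) \<zeta> \<longleftrightarrow>
    s = \<zeta> 1 \<and> (\<forall>e\<in>ball_edges n. \<xi> e = \<zeta> (snd e) - \<zeta> (fst e))"
proof
  assume c: "pinned_height 1 s \<xi> \<in> cylinder (ball_at n) \<zeta>"
  then have h: "pinned_height 1 s \<xi> x = \<zeta> x" if "x \<in> ball_at n" for x using that by (simp add: cylinder_def)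
  have "s = \<zeta> 1" using h[of 1] by (simp add: ball_at_def)
  moreover have "\<xi> e = \<zeta> (snd e) - \<zeta> (fst e)" if "e \<in> ball_edges n" for e
  proof -
    obtain y where y: "e = (parent y, y)" "y \<noteq> 1" using \<open>e \<in> ball_edges n\<close> by (auto simp: ball_edges_def)
    show ?thesis
      using ball_edges_fst[OF that] h[of y] h[of "parent y"] pinned_height_parent[OF y(2), of s \<xi>] y by simp
  qed
  ultimately show "s = \<zeta> 1 \<and> (\<forall>e\<in>ball_edges n. \<xi> e = \<zeta> (snd e) - \<zeta> (fst e))" by blast
next
  assume a: "s = \<zeta> 1 \<and> (\<forall>e\<in>ball_edges n. \<xi> e = \<zeta> (snd e) - \<zeta> (fst e))"
  have "pinned_height 1 s \<xi> (snd e) - pinned_height 1 s \<xi> (fst e) = \<zeta> (snd e) - \<zeta> (fst e)"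
    if "e \<in> ball_edges n" for e
  proof -
    obtain y where "e = (parent y, y)" "y \<noteq> 1" using \<open>e \<in> ball_edges n\<close> by (auto simp: ball_edges_def)
    then show ?thesis using a that pinned_height_parent[of y s \<xi>] by auto
  qed
  then show "pinned_height 1 s \<xi> \<in> cylinder (ball_at n) \<zeta>"
    using ball_increments[of "pinned_height 1 s \<xi>" \<zeta> n] a by (auto simp: cylinder_def)
qed

definition reduce :: "('g vertex \<Rightarrow> int) \<Rightarrow> 'g vertex \<Rightarrow> bit" where
  "reduce \<zeta> x = of_int (\<zeta> x)"

text \<open>The conditional probability of the increments of \<zeta> along \<open>E\<close>, given
  hidden spins compatible with them; see \<open>emeasure_step_kernel_increments\<close>.\<close>

definition ratio :: "('g vertex \<times> 'g vertex) set \<Rightarrow> ('g vertex \<Rightarrow> int) \<Rightarrow> real" where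
  "ratio E \<zeta> = edge_product Q E \<zeta> / edge_product (fuzzy Q) E (reduce \<zeta>)"

lemma ratio_pos: "ratio E \<zeta> > 0"
  unfolding ratio_def by (intro divide_pos_pos edge_product_pos Q_pos fuzzy_pos)

text \<open>Differences determine the spins on a ball up to the spin at the root, that is, up to a
  global flip.\<close>

lemma spin_diff_cylinder:
  "{\<sigma>. \<forall>e\<in>ball_edges n. spin_diff \<sigma> e = of_int (\<zeta> (snd e) - \<zeta> (fst e))} =
    cylinder (ball_at n) (reduce \<zeta>) \<union> cylinder (ball_at n) (\<lambda>x. reduce \<zeta> x + 1)" (is "?L = ?R")
proof (intro equalityI subsetI)
  fix \<sigma> assume "\<sigma> \<in> ?L"
  then have inc: "\<sigma> (snd e) - \<sigma> (fst e) = reduce \<zeta> (snd e) - reduce \<zeta> (fst e)" if "e \<in> ball_edges n" for e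
    using that by (auto simp: spin_diff_def reduce_def)
  show "\<sigma> \<in> ?R"
  proof (cases "\<sigma> 1 = reduce \<zeta> 1")
    case True
    have "\<sigma> x = reduce \<zeta> x" if "x \<in> ball_at n" for x
      by (rule ball_increments[OF True inc that])
    then show ?thesis by (simp add: cylinder_def)
  next
    case False
    have "b = c + 1" if "b \<noteq> c" for b c :: bit using that by (cases b; cases c) simp_all
    with False have "\<sigma> 1 = reduce \<zeta> 1 + 1" by blast
    have "\<sigma> x = reduce \<zeta> x + 1" if "x \<in> ball_at n" for x
    proof (rule ball_increments[of \<sigma> "\<lambda>x. reduce \<zeta> x + 1" n x])
      show "\<sigma> (snd e) - \<sigma> (fst e) = (reduce \<zeta> (snd e) + 1) - (reduce \<zeta> (fst e) + 1)" if "e \<in> ball_edges n" for e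
        unfolding add_diff_cancel_right by (rule inc[OF that])
    qed fact+
    then show ?thesis by (simp add: cylinder_def)
  qed
next
  fix \<sigma> assume \<sigma>: "\<sigma> \<in> ?R"
  have "spin_diff \<sigma> e = of_int (\<zeta> (snd e) - \<zeta> (fst e))" if "e \<in> ball_edges n" for e
  proof -
    have e: "fst e \<in> ball_at n" "snd e \<in> ball_at n" using ball_edges_fst[OF that] by auto
    from \<sigma> show ?thesis
    proof
      assume "\<sigma> \<in> cylinder (ball_at n) (reduce \<zeta>)"
      then show ?thesis using e unfolding cylinder_def spin_diff_def reduce_def by simp
    next
      assume "\<sigma> \<in> cylinder (ball_at n) (\<lambda>x. reduce \<zeta> x + 1)"
      then have "\<sigma> (fst e) = of_int (\<zeta> (fst e)) + 1" "\<sigma> (snd e) = of_int (\<zeta> (snd e)) + 1"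
        using e unfolding cylinder_def reduce_def by blast+
      then show ?thesis unfolding spin_diff_def by (simp only: add_diff_cancel_right of_int_diff)
    qed
  qed
  then show "\<sigma> \<in> ?L" by simp
qed

lemma emeasure_step_kernel_increments:
  assumes E: "finite E" "E \<subseteq> outward_edges"
  shows "emeasure (step_kernel \<sigma>) {\<xi> \<in> space outward_space. \<forall>e\<in>E. \<xi> e = \<zeta> (snd e) - \<zeta> (fst e)} =
    ennreal (ratio E \<zeta>) * indicator {\<sigma>. \<forall>e\<in>E. spin_diff \<sigma> e = of_int (\<zeta> (snd e) - \<zeta> (fst e))} \<sigma>"
proof -
  let ?d = "\<lambda>e. \<zeta> (snd e) - \<zeta> (fst e)"
  have "{\<xi> \<in> space outward_space. \<forall>e\<in>E. \<xi> e = ?d e} =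
      prod_emb outward_edges (\<lambda>e. step_law Q (spin_diff \<sigma> e)) E (\<Pi>\<^sub>E e\<in>E. {?d e})"
    using E(2) by (auto simp: prod_emb_def space_PiM PiE_iff restrict_def extensional_def)
  then have "emeasure (step_kernel \<sigma>) {\<xi> \<in> space outward_space. \<forall>e\<in>E. \<xi> e = ?d e} =
      (\<Prod>e\<in>E. emeasure (step_law Q (spin_diff \<sigma> e)) {?d e})"
    unfolding step_product_def using E prob_space_step_law by (simp add: emeasure_PiM_emb)
  also have "\<dots> = ennreal (\<Prod>e\<in>E. step_weight (spin_diff \<sigma> e) (?d e))"
    by (simp add: emeasure_step_law_singleton prod_ennreal step_weight_nonneg)
  also have "(\<Prod>e\<in>E. step_weight (spin_diff \<sigma> e) (?d e)) =
      ratio E \<zeta> * indicator {\<sigma>. \<forall>e\<in>E. spin_diff \<sigma> e = of_int (?d e)} \<sigma>"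
  proof (cases "\<forall>e\<in>E. spin_diff \<sigma> e = of_int (?d e)")
    case True
    then have "(\<Prod>e\<in>E. step_weight (spin_diff \<sigma> e) (?d e)) = (\<Prod>e\<in>E. Q (?d e) / fuzzy Q (of_int (?d e)))"
      by (intro prod.cong) (auto simp: step_weight_def)
    also have "\<dots> = ratio E \<zeta>"
      by (simp add: ratio_def edge_product_def prod_dividef reduce_def)
    finally show ?thesis using True by simp
  next
    case False
    then obtain e where "e \<in> E" "spin_diff \<sigma> e \<noteq> of_int (?d e)" by blast
    then have "step_weight (spin_diff \<sigma> e) (?d e) = 0" by (auto simp: step_weight_def)
    then show ?thesis using False \<open>e \<in> E\<close> E(1) by (auto intro!: prod_zero)
  qed
  finally show ?thesis by (simp add: indicator_def)
qed

lemma emeasure_height_cylinder: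
  "emeasure height_measure (cylinder (ball_at n) \<zeta>) =
    ennreal (ratio (ball_edges n) \<zeta>) *
      (emeasure \<mu> (cylinder (ball_at n) (reduce \<zeta>)) + emeasure \<mu> (cylinder (ball_at n) (\<lambda>x. reduce \<zeta> x + 1)))"
proof -
  let ?S = "{\<xi> \<in> space outward_space. \<forall>e\<in>ball_edges n. \<xi> e = \<zeta> (snd e) - \<zeta> (fst e)}"
  have S: "?S \<in> sets outward_space"
  proof -
    have "{\<xi> \<in> space outward_space. \<xi> e = c} \<in> sets outward_space" if "e \<in> ball_edges n" for e and c :: int
    proof -
      have "(\<lambda>\<xi>. \<xi> e) \<in> measurable outward_space (count_space (UNIV :: int set))"
        using that ball_edges_outward by (intro measurable_component_singleton) blast
      from measurable_sets[OF this, of "{c}"] show ?thesis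
        by (simp add: vimage_def Int_def conj_commute)
    qed
    then show ?thesis by (intro sets.sets_Collect_finite_All finite_ball_edges)
  qed
  have "emeasure height_measure (cylinder (ball_at n) \<zeta>) =
     (\<integral>\<^sup>+s. emeasure step_measure ?S * indicator {\<zeta> 1} s \<partial>count_space UNIV)"
    unfolding emeasure_height_measure[OF sets_cylinder[OF finite_ball_at]] pinned_height_cylinder_iff
    by (intro nn_integral_cong) (auto simp: indicator_def)
  also have "\<dots> = emeasure step_measure ?S"
    by (subst nn_integral_cmult_indicator) auto
  also have "\<dots> = (\<integral>\<^sup>+\<sigma>. ennreal (ratio (ball_edges n) \<zeta>) *
      indicator (cylinder (ball_at n) (reduce \<zeta>) \<union> cylinder (ball_at n) (\<lambda>x. reduce \<zeta> x + 1)) \<sigma> \<partial>\<mu>)"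
    unfolding emeasure_step_measure[OF S] emeasure_step_kernel_increments[OF finite_ball_edges ball_edges_outward] spin_diff_cylinder ..
  also have "\<dots> = ennreal (ratio (ball_edges n) \<zeta>) *
      emeasure \<mu> (cylinder (ball_at n) (reduce \<zeta>) \<union> cylinder (ball_at n) (\<lambda>x. reduce \<zeta> x + 1))"
    by (rule nn_integral_cmult_indicator) (simp add: sets_\<mu> sets_cylinder sets.Un)
  also have "emeasure \<mu> (cylinder (ball_at n) (reduce \<zeta>) \<union> cylinder (ball_at n) (\<lambda>x. reduce \<zeta> x + 1)) =
      emeasure \<mu> (cylinder (ball_at n) (reduce \<zeta>)) + emeasure \<mu> (cylinder (ball_at n) (\<lambda>x. reduce \<zeta> x + 1))"
  proof (rule plus_emeasure[symmetric])
    show "cylinder (ball_at n) (reduce \<zeta>) \<inter> cylinder (ball_at n) (\<lambda>x. reduce \<zeta> x + 1) = {}"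
      by (rule cylinder_disjoint[of 1]) (simp_all add: ball_at_def)
  qed (simp_all only: sets_\<mu> sets_cylinder[OF finite_ball_at])
  finally show ?thesis .
qed

lemma touching_ball_edges: "\<Lambda> \<subseteq> ball_at n \<Longrightarrow> touching \<Lambda> \<subseteq> ball_edges (Suc n)"
proof (intro subrelI)
  fix x y assume "\<Lambda> \<subseteq> ball_at n" "(x, y) \<in> touching \<Lambda>"
  then show "(x, y) \<in> ball_edges (Suc n)"
    using touching_subset_ball[of \<Lambda> n x y] by (auto simp: ball_edges_def touching_def outward_edges_iff)
qed

lemma ball_edges_mono: "m \<le> n \<Longrightarrow> ball_edges m \<subseteq> ball_edges n"
  by (auto simp: ball_edges_def ball_at_def)

text \<open>
  The two summands come from the two hidden spin configurations compatible with the increments of \<open>\<zeta>\<close>.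
  The spin measure enters only through \<open>ball_at n - \<Lambda>\<close>, by its own DLR equation.
\<close>

definition outer_factor :: "'g vertex set \<Rightarrow> nat \<Rightarrow> ('g vertex \<Rightarrow> int) \<Rightarrow> ennreal" where
  "outer_factor \<Lambda> n \<zeta> = ennreal (ratio (ball_edges n - touching \<Lambda>) \<zeta>) *
     (ennreal (1 / partition_function (fuzzy Q) \<Lambda> (reduce \<zeta>)) * emeasure \<mu> (cylinder (ball_at n - \<Lambda>) (reduce \<zeta>)) +
      ennreal (1 / partition_function (fuzzy Q) \<Lambda> (\<lambda>x. reduce \<zeta> x + 1)) *
        emeasure \<mu> (cylinder (ball_at n - \<Lambda>) (\<lambda>x. reduce \<zeta> x + 1)))"

text \<open>The \<open>fuzzy Q\<close> weights on the edges touching \<Lambda> cancel: they stand in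
  the denominator of \<open>ratio\<close> and reappear as the DLR weight of the hidden spins. What
  remains on these edges is the product of \<open>Q\<close>, the Gibbs weight of the
  heights.\<close>

lemma height_cylinder_factor:
  assumes \<Lambda>: "finite \<Lambda>" "\<Lambda> \<subseteq> ball_at m" and n: "Suc m \<le> n"
  shows "emeasure height_measure (cylinder (ball_at n) \<zeta>) =
    outer_factor \<Lambda> n \<zeta> * ennreal (edge_product Q (touching \<Lambda>) \<zeta>)"
proof -
  interpret G: gibbs_region "fuzzy Q" \<Lambda> by (rule fuzzy_region) fact
  let ?B = "ball_at n :: 'g vertex set" and ?\<zeta>' = "\<lambda>x. reduce \<zeta> x + 1"
  have sub: "touching \<Lambda> \<subseteq> ball_edges n"
    using touching_ball_edges[OF \<Lambda>(2)] ball_edges_mono[OF n] by blast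
  then have nb: "fst ` touching \<Lambda> \<union> snd ` touching \<Lambda> \<subseteq> ?B" using ball_edges_fst by blast
  have B: "\<Lambda> \<subseteq> ?B" using \<Lambda>(2) n by (auto simp: ball_at_def subset_eq)
  have split: "edge_product q (ball_edges n) \<omega> = edge_product q (touching \<Lambda>) \<omega> * edge_product q (ball_edges n - touching \<Lambda>) \<omega>"
    for q :: "'b::ab_group_add \<Rightarrow> real" and \<omega>
    unfolding edge_product_def by (subst mult.commute, rule prod.subset_diff[OF sub finite_ball_edges])
  \<comment> \<open>A global flip preserves all spin differences, so both summands share this
    factor.\<close>
  have wt': "G.wt ?\<zeta>' = G.wt (reduce \<zeta>)" unfolding edge_product_def add_diff_cancel_right ..
  have ratio: "ratio (ball_edges n) \<zeta> * G.wt (reduce \<zeta>) = ratio (ball_edges n - touching \<Lambda>) \<zeta> * edge_product Q (touching \<Lambda>) \<zeta>"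
    using G.wt_pos[of "reduce \<zeta>"] by (simp add: ratio_def split)
  have fac: "emeasure \<mu> (cylinder ?B \<xi>) = ennreal (G.wt \<xi>) * (ennreal (1 / G.Z \<xi>) * emeasure \<mu> (cylinder (?B - \<Lambda>) \<xi>))" for \<xi>
    unfolding spin_cylinder_factor[OF \<Lambda>(1) finite_ball_at B nb] using G.wt_pos[of \<xi>] G.Z_pos[of \<xi>]
    by (simp add: ennreal_mult[symmetric] mult.assoc[symmetric])
  have "emeasure height_measure (cylinder ?B \<zeta>) =
     ennreal (ratio (ball_edges n) \<zeta>) * (ennreal (G.wt (reduce \<zeta>)) *
       (ennreal (1 / G.Z (reduce \<zeta>)) * emeasure \<mu> (cylinder (?B - \<Lambda>) (reduce \<zeta>)) +
        ennreal (1 / G.Z ?\<zeta>') * emeasure \<mu> (cylinder (?B - \<Lambda>) ?\<zeta>')))"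
    unfolding emeasure_height_cylinder fac wt' by (simp only: distrib_left)
  also have "\<dots> = (ennreal (ratio (ball_edges n) \<zeta>) * ennreal (G.wt (reduce \<zeta>))) *
       (ennreal (1 / G.Z (reduce \<zeta>)) * emeasure \<mu> (cylinder (?B - \<Lambda>) (reduce \<zeta>)) +
        ennreal (1 / G.Z ?\<zeta>') * emeasure \<mu> (cylinder (?B - \<Lambda>) ?\<zeta>'))"
    by (simp only: mult.assoc)
  also have "ennreal (ratio (ball_edges n) \<zeta>) * ennreal (G.wt (reduce \<zeta>)) =
      ennreal (ratio (ball_edges n - touching \<Lambda>) \<zeta>) * ennreal (edge_product Q (touching \<Lambda>) \<zeta>)"
    by (simp only: ennreal_mult[symmetric] ratio_pos[THEN less_imp_le] G.wt_pos[THEN less_imp_le]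
        edge_product_pos[of Q, OF Q_pos, THEN less_imp_le] ratio)
  finally show ?thesis
    unfolding outer_factor_def by (simp only: mult_ac)
qed

lemma outer_factor_override:
  assumes \<Lambda>: "finite \<Lambda>"
  shows "outer_factor \<Lambda> n (override_on \<zeta> \<omega>' \<Lambda>) = outer_factor \<Lambda> n \<zeta>"
proof -
  interpret G: gibbs_region "fuzzy Q" \<Lambda> by (rule fuzzy_region) fact
  let ?w = "override_on \<zeta> \<omega>' \<Lambda>"
  have off: "x \<notin> \<Lambda> \<and> y \<notin> \<Lambda>" if "(x, y) \<in> ball_edges n - touching \<Lambda>" for x y
    using that ball_edges_outward by (auto simp: touching_def)
  have "ratio (ball_edges n - touching \<Lambda>) ?w = ratio (ball_edges n - touching \<Lambda>) \<zeta>"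
    unfolding ratio_def
    by (intro arg_cong2[where f="(/)"] edge_product_cong) (use off in \<open>auto simp: reduce_def\<close>)
  moreover have "G.Z (reduce ?w) = G.Z (reduce \<zeta>)" "G.Z (\<lambda>x. reduce ?w x + 1) = G.Z (\<lambda>x. reduce \<zeta> x + 1)"
    by (intro G.Z_cong; simp add: reduce_def)+
  moreover have "cylinder (ball_at n - \<Lambda>) (reduce ?w) = cylinder (ball_at n - \<Lambda>) (reduce \<zeta>)"
    "cylinder (ball_at n - \<Lambda>) (\<lambda>x. reduce ?w x + 1) = cylinder (ball_at n - \<Lambda>) (\<lambda>x. reduce \<zeta> x + 1)"
    by (auto simp: cylinder_def reduce_def)
  ultimately show ?thesis unfolding outer_factor_def by simp
qed

lemma outer_factor_pos:
  assumes \<Lambda>: "finite \<Lambda>"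
  shows "outer_factor \<Lambda> n \<zeta> > 0"
proof -
  interpret G: gibbs_region "fuzzy Q" \<Lambda> by (rule fuzzy_region) fact
  have "0 < ennreal (1 / G.Z (reduce \<zeta>)) * emeasure \<mu> (cylinder (ball_at n - \<Lambda>) (reduce \<zeta>))"
    using G.Z_pos spin_cylinder_pos[of "ball_at n - \<Lambda>"] by (simp add: ennreal_zero_less_mult_iff)
  then show ?thesis
    unfolding outer_factor_def using ratio_pos by (simp add: ennreal_zero_less_mult_iff add_pos_nonneg)
qed

text \<open>Finiteness of the partition function is read off the infinite measure: multiplied by the
  positive \<open>outer_factor\<close>, it is the mass of a cylinder over
  \<open>ball_at (Suc m) - \<Lambda>\<close>, hence at most 1.\<close>

lemma height_region:
  assumes \<Lambda>: "finite \<Lambda>"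
  shows "gibbs_region Q (\<Lambda> :: 'g vertex set)"
proof
  fix \<zeta> :: "'g vertex \<Rightarrow> int"
  obtain m where m: "\<Lambda> \<subseteq> ball_at m" using finite_subset_ball[OF \<Lambda>] unfolding ball_at_def by blast
  let ?B = "ball_at (Suc m) :: 'g vertex set"
  have B: "\<Lambda> \<subseteq> ?B" using m by (auto simp: ball_at_def subset_eq)
  \<comment> \<open>The radius \<open>Suc m\<close> guarantees a site of the ball outside \<Lambda>,
    so that the one-site bound applies.\<close>
  have "sphere_at (Suc m) \<noteq> ({} :: 'g vertex set)" using card_sphere_at_pos[OF card, of "Suc m"] by auto
  then obtain v :: "'g vertex" where "depth v = Suc m" by (auto simp: sphere_at_eq)
  then have v: "v \<in> ?B - \<Lambda>" using m by (auto simp: ball_at_def subset_eq)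
  have "outer_factor \<Lambda> (Suc m) \<zeta> * (\<integral>\<^sup>+\<omega>'. ennreal (edge_product Q (touching \<Lambda>) (override_on \<zeta> \<omega>' \<Lambda>)) \<partial>count_space (\<Lambda> \<rightarrow>\<^sub>E UNIV)) =
      (\<integral>\<^sup>+\<omega>'. emeasure height_measure (cylinder ?B (override_on \<zeta> \<omega>' \<Lambda>)) \<partial>count_space (\<Lambda> \<rightarrow>\<^sub>E UNIV))"
    by (simp add: height_cylinder_factor[OF \<Lambda> m] outer_factor_override[OF \<Lambda>] nn_integral_cmult)
  also have "\<dots> = emeasure height_measure (cylinder (?B - \<Lambda>) \<zeta>)"
    by (rule emeasure_cylinder_decompose[symmetric]) (use B in auto)
  also have "\<dots> \<le> emeasure height_measure (cylinder {v} \<zeta>)"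
  proof (rule emeasure_mono)
    show "cylinder (?B - \<Lambda>) \<zeta> \<subseteq> cylinder {v} \<zeta>" using v by (auto simp: cylinder_def)
  qed (simp add: sets_cylinder)
  also have "\<dots> = 1" by (rule height_measure_single_site)
  finally have le: "outer_factor \<Lambda> (Suc m) \<zeta> * (\<integral>\<^sup>+\<omega>'. ennreal (edge_product Q (touching \<Lambda>) (override_on \<zeta> \<omega>' \<Lambda>)) \<partial>count_space (\<Lambda> \<rightarrow>\<^sub>E UNIV)) \<le> 1" .
  show "(\<integral>\<^sup>+\<omega>'. ennreal (edge_product Q (touching \<Lambda>) (override_on \<zeta> \<omega>' \<Lambda>)) \<partial>count_space (\<Lambda> \<rightarrow>\<^sub>E UNIV)) < \<infinity>"
  proof (rule ccontr)
    assume "\<not> ?thesis"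
    then have "(\<integral>\<^sup>+\<omega>'. ennreal (edge_product Q (touching \<Lambda>) (override_on \<zeta> \<omega>' \<Lambda>)) \<partial>count_space (\<Lambda> \<rightarrow>\<^sub>E UNIV)) = \<infinity>"
      by (simp add: not_less top_unique)
    with le outer_factor_pos[OF \<Lambda>, of "Suc m" \<zeta>] show False by (auto simp: ennreal_mult_top top_unique split: if_splits)
  qed
qed (use \<Lambda> Q_pos Q_sym in auto)

lemma height_measure_invariant:
  assumes \<Lambda>: "finite \<Lambda>"
  shows "height_measure \<bind> gibbs_kernel Q \<Lambda> = height_measure"
proof -
  interpret G: gibbs_region Q \<Lambda> by (rule height_region[OF \<Lambda>])
  obtain m where m: "\<Lambda> \<subseteq> ball_at m" using finite_subset_ball[OF \<Lambda>] unfolding ball_at_def by blast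
  show ?thesis
  proof (rule G.gibbs_kernel_invariant[where ?n0.0="Suc m" and C="outer_factor \<Lambda>"])
    show "\<Lambda> \<subseteq> ball_at (Suc m)" using m by (auto simp: ball_at_def subset_eq)
    show "fst ` touching \<Lambda> \<union> snd ` touching \<Lambda> \<subseteq> ball_at (Suc m)"
      using touching_ball_edges[OF m] ball_edges_fst by blast
    show "emeasure height_measure (cylinder (ball_at n) \<zeta>) < \<infinity>" for n \<zeta>
    proof -
      have "emeasure height_measure (cylinder (ball_at n) \<zeta>) \<le> emeasure height_measure (cylinder {1} \<zeta>)"
      proof (rule emeasure_mono)
        show "cylinder (ball_at n) \<zeta> \<subseteq> cylinder {1} \<zeta>" by (auto simp: cylinder_def ball_at_def)
      qed (simp add: sets_cylinder)
      then show ?thesis unfolding height_measure_single_site by (rule order.strict_trans1) simp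
    qed
  qed (simp_all add: height_cylinder_factor[OF \<Lambda> m] outer_factor_override[OF \<Lambda>])
qed

end

section \<open>Tail events\<close>

lemma sets_coord_algebra: "sets (coord_algebra \<Lambda>) = sigma_sets UNIV {{\<omega>. \<omega> x \<in> A} | x A. x \<in> \<Lambda>}"
  unfolding coord_algebra_def by (rule sets_measure_of) simp

lemma space_coord_algebra [simp]: "space (coord_algebra \<Lambda>) = UNIV"
  unfolding coord_algebra_def by (rule space_measure_of) simp

lemma coord_algebra_subset:
  "sets (coord_algebra \<Lambda> :: ('g vertex \<Rightarrow> 's) measure) \<subseteq> sets config_space"
proof -
  have "{\<omega>. \<omega> x \<in> A} \<in> sets config_space" for x :: "'g vertex" and A :: "'s set"
    using measurable_sets[OF coordinate_measurable[of x], of A] by (simp add: vimage_def)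
  then have "{{\<omega> :: 'g vertex \<Rightarrow> 's. \<omega> x \<in> A} | x A. x \<in> \<Lambda>} \<subseteq> sets config_space" by auto
  from sets.sigma_sets_subset[OF this] show ?thesis by (simp add: sets_coord_algebra)
qed

lemma tail_sets_config: "T \<in> tail_sets \<Longrightarrow> T \<in> sets config_space"
proof -
  assume "T \<in> tail_sets"
  then have "T \<in> sets (coord_algebra (- {}))" unfolding tail_sets_def by blast
  then show ?thesis using coord_algebra_subset by blast
qed

lemma coord_algebra_override:
  assumes "T \<in> sets (coord_algebra (- \<Lambda>))"
  shows "override_on \<omega> \<omega>' \<Lambda> \<in> T \<longleftrightarrow> \<omega> \<in> T"
  using assms unfolding sets_coord_algebra
  by (induction arbitrary: rule: sigma_sets.induct) auto

lemma tail_sets_override: "T \<in> tail_sets \<Longrightarrow> finite \<Lambda> \<Longrightarrow> override_on \<omega> \<omega>' \<Lambda> \<in> T \<longleftrightarrow> \<omega> \<in> T"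
  by (rule coord_algebra_override) (auto simp: tail_sets_def)

lemma sigma_algebra_tail_sets: "sigma_algebra UNIV (tail_sets :: ('g vertex \<Rightarrow> 's) set set)"
proof -
  have s: "sigma_algebra UNIV (sets (coord_algebra \<Lambda> :: ('g vertex \<Rightarrow> 's) measure))" for \<Lambda>
    using sets.sigma_algebra_axioms[of "coord_algebra \<Lambda> :: ('g vertex \<Rightarrow> 's) measure"] by simp
  show ?thesis
    unfolding sigma_algebra_iff2 tail_sets_def
    using s[unfolded sigma_algebra_iff2] by (auto simp: subset_eq)
qed

lemma sets_sigma_tail_sets [simp]: "sets (sigma UNIV tail_sets) = tail_sets"
  using sigma_algebra.sets_measure_of_eq[OF sigma_algebra_tail_sets] by simp

context hidden_ising
begin

definition height_cond :: "('g vertex \<Rightarrow> int) set \<Rightarrow> ('g vertex \<Rightarrow> int) measure" where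
  "height_cond T = density height_measure (\<lambda>\<omega>. ennreal (1 / measure height_measure T) * indicator T \<omega>)"

lemma emeasure_height_cond:
  assumes "T \<in> sets config_space" "A \<in> sets config_space"
  shows "emeasure (height_cond T) A = ennreal (1 / measure height_measure T) * emeasure height_measure (A \<inter> T)"
proof -
  have "emeasure (height_cond T) A = (\<integral>\<^sup>+\<omega>. ennreal (1 / measure height_measure T) * indicator (A \<inter> T) \<omega> \<partial>height_measure)"
    unfolding height_cond_def using assms
    by (subst emeasure_density) (auto intro!: nn_integral_cong simp: indicator_def)
  also have "\<dots> = ennreal (1 / measure height_measure T) * emeasure height_measure (A \<inter> T)"
    using assms by (intro nn_integral_cmult_indicator) auto
  finally show ?thesis .
qed

text \<open>The density is tail measurable and so passes through every kernel by
  \<open>gibbs_kernel_tail\<close>; invariance of the infinite measure carries over. This serves the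
  offset measure and both components of the mixture in
  \<open>offset_law_not_extreme\<close>.\<close>

lemma height_cond_gibbs:
  assumes T: "T \<in> tail_sets" and pos: "0 < emeasure height_measure T" "emeasure height_measure T < \<infinity>"
  shows "gibbs_measure Q (height_cond T)"
  unfolding gibbs_measure_def
proof (intro conjI allI impI ballI)
  have Tc: "T \<in> sets config_space" using T by (rule tail_sets_config)
  define c where "c = ennreal (1 / measure height_measure T)"
  show "sets (height_cond T) = sets config_space" by (simp add: height_cond_def)
  have sp: "space (height_cond T) = UNIV" by (simp add: height_cond_def)
  show "prob_space (height_cond T)"
  proof (rule prob_spaceI)
    have em: "emeasure height_measure T = ennreal (measure height_measure T)"
      using pos(2) by (intro emeasure_eq_ennreal_measure) auto
    have mp: "measure height_measure T > 0" using pos(1) em by (metis ennreal_less_zero_iff)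
    show "emeasure (height_cond T) (space (height_cond T)) = 1"
      unfolding sp using mp by (subst emeasure_height_cond[OF Tc])
        (auto simp: em ennreal_mult[symmetric] sets.top[of config_space, simplified])
  qed
  fix \<Lambda> :: "'g vertex set" and A :: "('g vertex \<Rightarrow> int) set"
  assume \<Lambda>: "finite \<Lambda>" and A: "A \<in> sets config_space"
  interpret G: gibbs_region Q \<Lambda> by (rule height_region[OF \<Lambda>])
  have km: "(\<lambda>\<omega>. emeasure (gibbs_kernel Q \<Lambda> \<omega>) B) \<in> borel_measurable height_measure" if "B \<in> sets config_space" for B
    using measurable_emeasure_kernel[OF G.gibbs_kernel_measurable that] by measurable
  have Tm: "(\<lambda>\<omega>. c * indicator T \<omega>) \<in> borel_measurable height_measure"
    using Tc by (intro borel_measurable_times_ennreal borel_measurable_const borel_measurable_indicator) simp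
  have "(\<integral>\<^sup>+\<omega>. emeasure (gibbs_kernel Q \<Lambda> \<omega>) A \<partial>height_cond T) =
      (\<integral>\<^sup>+\<omega>. c * indicator T \<omega> * emeasure (gibbs_kernel Q \<Lambda> \<omega>) A \<partial>height_measure)"
    unfolding height_cond_def c_def[symmetric] by (rule nn_integral_density[OF Tm km[OF A]])
  also have "\<dots> = (\<integral>\<^sup>+\<omega>. c * emeasure (gibbs_kernel Q \<Lambda> \<omega>) (A \<inter> T) \<partial>height_measure)"
    by (intro nn_integral_cong)
       (simp add: G.gibbs_kernel_tail[OF Tc tail_sets_override[OF T \<Lambda>] A] mult_ac)
  also have "\<dots> = c * (\<integral>\<^sup>+\<omega>. emeasure (gibbs_kernel Q \<Lambda> \<omega>) (A \<inter> T) \<partial>height_measure)"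
    using km[OF sets.Int[OF A Tc]] by (rule nn_integral_cmult)
  also have "(\<integral>\<^sup>+\<omega>. emeasure (gibbs_kernel Q \<Lambda> \<omega>) (A \<inter> T) \<partial>height_measure) = emeasure (height_measure \<bind> gibbs_kernel Q \<Lambda>) (A \<inter> T)"
  proof (rule emeasure_bind[symmetric])
    show "gibbs_kernel Q \<Lambda> \<in> measurable height_measure (subprob_algebra config_space)"
      unfolding measurable_cong_sets[OF sets_height_measure refl] by (rule G.gibbs_kernel_measurable)
  qed (use A Tc in auto)
  also have "c * emeasure (height_measure \<bind> gibbs_kernel Q \<Lambda>) (A \<inter> T) = emeasure (height_cond T) A"
    unfolding height_measure_invariant[OF \<Lambda>] c_def by (rule emeasure_height_cond[OF Tc A, symmetric])
  finally show "(\<integral>\<^sup>+\<omega>. emeasure (gibbs_kernel Q \<Lambda> \<omega>) A \<partial>height_cond T) = emeasure (height_cond T) A" .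
qed

end

section \<open>The average height as a height-offset variable\<close>

text \<open>An existing limit is the upper limit, so the case distinction in
  \<open>avg_offset\<close> collapses.\<close>

lemma avg_offset_limsup: "avg_offset \<omega> = limsup (\<lambda>r. ereal (avg_height r \<omega>))"
  by (simp add: avg_offset_def convergent_limsup_cl)

lemma avg_height_add:
  fixes \<omega> :: "'g::finite vertex \<Rightarrow> int"
  assumes "CARD('g) \<ge> 3"
  shows "avg_height r (\<lambda>x. \<omega> x + a) = avg_height r \<omega> + real_of_int a"
  using card_sphere_at_pos[OF assms, of r]
  by (auto simp: avg_height_def sum.distrib add_divide_distrib card_gt_0_iff)

text \<open>Level 0 is exempt because moving a branch changes the averages by a constant only from
  level 1 on.\<close>

lemma avg_offset_eventually_add:
  assumes "\<And>r. r \<ge> 1 \<Longrightarrow> avg_height r \<omega>' = avg_height r \<omega> + c"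
  shows "avg_offset \<omega>' = avg_offset \<omega> + ereal c"
proof -
  have "limsup (\<lambda>r. ereal (avg_height r \<omega>')) = limsup (\<lambda>r. ereal (avg_height r \<omega>) + ereal c)"
    by (rule Limsup_eq, rule eventually_sequentiallyI[of 1]) (simp add: assms)
  also have "\<dots> = limsup (\<lambda>r. ereal (avg_height r \<omega>)) + ereal c"
    by (rule Limsup_add_ereal_right) auto
  finally show ?thesis by (simp add: avg_offset_limsup)
qed

lemma avg_offset_add:
  fixes \<omega> :: "'g::finite vertex \<Rightarrow> int"
  assumes "CARD('g) \<ge> 3"
  shows "avg_offset (\<lambda>x. \<omega> x + a) = avg_offset \<omega> + ereal (real_of_int a)"
  by (rule avg_offset_eventually_add) (rule avg_height_add[OF assms])

text \<open>The upper limit does not change when the finitely many levels meeting \<Lambda> are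
  dropped, and the later averages read only coordinates outside \<Lambda>.\<close>

lemma avg_offset_tail_measurable:
  "(avg_offset :: ('g::finite vertex \<Rightarrow> int) \<Rightarrow> ereal) \<in> borel_measurable (sigma UNIV tail_sets)"
proof (rule measurableI)
  fix S :: "ereal set" assume S: "S \<in> sets borel"
  have "avg_offset -` S \<in> sets (coord_algebra (- \<Lambda>) :: ('g vertex \<Rightarrow> int) measure)" if \<Lambda>: "finite \<Lambda>" for \<Lambda> :: "'g vertex set"
  proof -
    obtain m where m: "\<Lambda> \<subseteq> {v. depth v \<le> m}" using finite_subset_ball[OF \<Lambda>] .
    let ?M = "coord_algebra (- \<Lambda>) :: ('g vertex \<Rightarrow> int) measure"
    have coord: "(\<lambda>\<omega>. \<omega> v) \<in> measurable ?M (count_space UNIV)" if "v \<notin> \<Lambda>" for v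
    proof (rule measurableI)
      fix A :: "int set"
      have "{\<omega>. \<omega> v \<in> A} \<in> sets ?M"
        unfolding sets_coord_algebra using that by (intro sigma_sets.Basic) blast
      then show "(\<lambda>\<omega>. \<omega> v) -` A \<inter> space ?M \<in> sets ?M" by (simp add: vimage_def)
    qed simp
    have "avg_height (r + Suc m) \<in> borel_measurable ?M" for r
      unfolding avg_height_def
    proof (intro borel_measurable_divide borel_measurable_sum borel_measurable_const)
      fix v :: "'g vertex" assume "v \<in> sphere_at (r + Suc m)"
      then have "v \<notin> \<Lambda>" using m by (auto simp: sphere_at_eq subset_eq)
      show "(\<lambda>\<omega>. real_of_int (\<omega> v)) \<in> borel_measurable ?M"
        by (rule measurable_compose[OF coord[OF \<open>v \<notin> \<Lambda>\<close>]]) simp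
    qed
    then have "(\<lambda>\<omega>. limsup (\<lambda>r. ereal (avg_height (r + Suc m) \<omega>))) \<in> borel_measurable ?M"
      by (intro borel_measurable_limsup borel_measurable_ereal)
    then have "(avg_offset :: ('g vertex \<Rightarrow> int) \<Rightarrow> ereal) \<in> borel_measurable ?M"
      unfolding avg_offset_limsup[abs_def] by (subst (asm) limsup_shift_k)
    from measurable_sets[OF this S] show ?thesis by simp
  qed
  then have "avg_offset -` S \<in> (tail_sets :: ('g vertex \<Rightarrow> int) set set)" by (simp add: tail_sets_def)
  then show "avg_offset -` S \<inter> space (sigma UNIV tail_sets) \<in> sets (sigma UNIV (tail_sets :: ('g vertex \<Rightarrow> int) set set))"
    by simp
qed simp

lemma avg_offset_measurable [measurable]:
  "(avg_offset :: ('g::finite vertex \<Rightarrow> int) \<Rightarrow> ereal) \<in> borel_measurable config_space"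
  unfolding avg_offset_limsup[abs_def] by measurable

lemma avg_offset_tail_event:
  assumes "S \<in> sets borel"
  shows "avg_offset -` S \<in> (tail_sets :: ('g::finite vertex \<Rightarrow> int) set set)"
  using measurable_sets[OF avg_offset_tail_measurable assms] by simp

section \<open>Moving one subtree\<close>

definition subtree :: "'g \<Rightarrow> 'g vertex set" where
  "subtree i = {u. u \<noteq> 1 \<and> hd (Rep_vertex u) = i}"

lemma Rep_vertex_generator [simp]: "Rep_vertex (generator i) = [i]"
  by (simp add: generator.rep_eq)

lemma generator_neq_1 [simp]: "generator i \<noteq> 1"
  by (simp flip: Rep_vertex_eq_Nil_iff)

lemma parent_generator [simp]: "parent (generator i) = 1"
  by (simp add: Rep_vertex_parent flip: Rep_vertex_eq_Nil_iff)

lemma depth_generator [simp]: "depth (generator i) = 1"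
  by (simp add: depth_def)

lemma inverse_generator [simp]: "inverse (generator i) = generator i"
  by transfer simp

lemma subtree_parent:
  assumes "u \<noteq> 1" "u \<noteq> generator i"
  shows "u \<in> subtree i \<longleftrightarrow> parent u \<in> subtree i"
proof -
  obtain a w where w: "Rep_vertex u = a # w" using assms(1) by (metis Rep_vertex_eq_Nil_iff neq_Nil_conv)
  show ?thesis
  proof (cases "w = []")
    case True
    then have "parent u = 1" using w by (simp add: Rep_vertex_parent flip: Rep_vertex_eq_Nil_iff)
    moreover have "a \<noteq> i" using assms(2) w True by (metis Rep_vertex_generator Rep_vertex_inject)
    ultimately show ?thesis using w by (simp add: subtree_def)
  next
    case False
    then have "Rep_vertex (parent u) = a # butlast w" using w by (simp add: Rep_vertex_parent)
    then show ?thesis using w by (simp add: subtree_def flip: Rep_vertex_eq_Nil_iff)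
  qed
qed

lemma generator_in_subtree: "generator i \<in> subtree i"
  by (simp add: subtree_def)

lemma card_sphere_subtree:
  fixes i :: "'g::finite"
  shows "card (sphere_at (Suc r) \<inter> subtree i) = (CARD('g) - 1) ^ r"
proof (induction r)
  case 0
  have "sphere_at (Suc 0) \<inter> subtree i = {generator i}"
  proof (intro equalityI subsetI)
    fix u assume u: "u \<in> sphere_at (Suc 0) \<inter> subtree i"
    then obtain a where "Rep_vertex u = [a]" by (auto simp: sphere_at_eq depth_def length_Suc_conv)
    with u have "Rep_vertex u = Rep_vertex (generator i)" by (simp add: subtree_def)
    then show "u \<in> {generator i}" unfolding Rep_vertex_inject by simp
  qed (auto simp: generator_in_subtree sphere_at_eq depth_def)
  then show ?case by simp
next
  case (Suc r)
  let ?S = "sphere_at (Suc r) \<inter> subtree i"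
  have eq: "sphere_at (Suc (Suc r)) \<inter> subtree i = {y. y \<noteq> 1 \<and> parent y \<in> ?S}"
  proof -
    have "u \<in> subtree i \<longleftrightarrow> parent u \<in> subtree i" if "u \<in> sphere_at (Suc (Suc r))" for u
      using that by (intro subtree_parent) (auto simp: sphere_at_eq)
    moreover have "u \<in> sphere_at (Suc (Suc r)) \<longleftrightarrow> u \<noteq> 1 \<and> parent u \<in> sphere_at (Suc r)" for u :: "'g vertex"
      by (simp only: sphere_at_Suc[of "Suc r"] mem_Collect_eq)
    ultimately show ?thesis by (intro set_eqI) (simp only: Int_iff mem_Collect_eq, metis)
  qed
  have "real (card (sphere_at (Suc (Suc r)) \<inter> subtree i)) = (\<Sum>x\<in>?S. real (card (children x)))"
    using sum_over_children[of ?S "\<lambda>_. 1"] by (simp add: eq)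
  also have "\<dots> = (\<Sum>x\<in>?S. real (CARD('g) - 1))"
    by (intro sum.cong) (auto simp: card_children_sphere)
  also have "\<dots> = real ((CARD('g) - 1) ^ Suc r)" by (simp add: Suc.IH)
  finally show ?case using of_nat_eq_iff by blast
qed

text \<open>Left multiplication by \<open>generator i\<close> cancels a leading letter
  \<open>i\<close> or adds one, so it exchanges the branch behind this generator with the rest of
  the tree.\<close>

lemma generator_times_subtree:
  assumes "u \<noteq> 1"
  shows "generator i * u \<in> subtree i \<longleftrightarrow> u \<notin> subtree i"
proof -
  obtain a w where w: "Rep_vertex u = a # w" using assms by (metis Rep_vertex_eq_Nil_iff neq_Nil_conv)
  have da: "distinct_adj (a # w)" using Rep_vertex[of u] w by simp
  have "Rep_vertex (generator i * u) = (if i = a then w else i # a # w)"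
    by (simp add: times_vertex.rep_eq w)
  then show ?thesis
    using w da by (cases w) (auto simp: subtree_def simp flip: Rep_vertex_eq_Nil_iff)
qed

lemma avg_height_move:
  fixes S :: "'g::finite vertex set"
  shows "avg_height r (\<lambda>u. \<omega> u + (if u \<in> S then c else 0)) =
    avg_height r \<omega> + real_of_int c * (real (card (sphere_at r \<inter> S)) / real (card (sphere_at r :: 'g vertex set)))"
proof -
  have "(\<Sum>u\<in>(sphere_at r :: 'g vertex set). real_of_int (if u \<in> S then c else 0)) = (\<Sum>u\<in>sphere_at r \<inter> S. real_of_int c)"
    by (subst sum.inter_restrict) (auto intro!: sum.cong)
  then show ?thesis
    by (simp add: avg_height_def sum.distrib add_divide_distrib mult.commute)
qed

text \<open>Raising by \<open>CARD('g)\<close> turns the shares \<open>1 / CARD('g)\<close> and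
  \<open>1 - 1 / CARD('g)\<close> of the branch in the spheres around the root and around its
  neighbour into the integer shifts 1 and \<open>CARD('g) - 1\<close>.\<close>

lemma avg_offset_move_subtree:
  fixes \<omega> :: "'g::finite vertex \<Rightarrow> int" and i :: 'g
  assumes card: "CARD('g) \<ge> 3"
  defines "\<omega>' \<equiv> (\<lambda>u. \<omega> u + (if u \<in> subtree i then int CARD('g) else 0))"
  shows "avg_offset \<omega>' = avg_offset \<omega> + ereal 1"
    and "avg_offset (translate (generator i) \<omega>') = avg_offset (translate (generator i) \<omega>) + ereal (real CARD('g) - 1)"
proof -
  let ?C = "CARD('g)"
  have frac: "real (card (sphere_at r \<inter> subtree i)) / real (card (sphere_at r :: 'g vertex set)) = 1 / real ?C" if r: "r \<ge> 1" for r
  proof -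
    obtain k where k: "r = Suc k" using r by (cases r) auto
    show ?thesis using card unfolding k card_sphere_subtree card_sphere_at by simp
  qed
  show "avg_offset \<omega>' = avg_offset \<omega> + ereal 1"
    unfolding \<omega>'_def
    by (rule avg_offset_eventually_add, subst avg_height_move) (use card frac in simp)
  have tr: "translate (generator i) \<omega>' = (\<lambda>u. translate (generator i) \<omega> u + (if u \<in> {u. generator i * u \<in> subtree i} then int ?C else 0))"
    by (simp add: translate_def \<omega>'_def fun_eq_iff)
  have frac': "real (card (sphere_at r \<inter> {u. generator i * u \<in> subtree i})) / real (card (sphere_at r :: 'g vertex set)) = 1 - 1 / real ?C"
    if r: "r \<ge> 1" for r
  proof -
    have "sphere_at r \<inter> {u. generator i * u \<in> subtree i} = sphere_at r - sphere_at r \<inter> subtree i"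
    proof -
      have "u \<noteq> 1" if "u \<in> sphere_at r" for u :: "'g vertex" using that r by (auto simp: sphere_at_eq)
      then show ?thesis
        by (intro set_eqI) (simp only: Int_iff Diff_iff mem_Collect_eq, metis generator_times_subtree)
    qed
    then have "real (card (sphere_at r \<inter> {u. generator i * u \<in> subtree i})) =
        real (card (sphere_at r :: 'g vertex set)) - real (card (sphere_at r \<inter> subtree i))"
      by (simp add: card_Diff_subset of_nat_diff card_mono)
    moreover have n0: "real (card (sphere_at r :: 'g vertex set)) \<noteq> 0" using card_sphere_at_pos[OF card, of r] by linarith
    ultimately show ?thesis using frac[OF r] by (simp only: diff_divide_distrib divide_self[OF n0])
  qed
  show "avg_offset (translate (generator i) \<omega>') = avg_offset (translate (generator i) \<omega>) + ereal (real ?C - 1)"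
    unfolding tr
    by (rule avg_offset_eventually_add, subst avg_height_move) (use card frac' in \<open>simp add: field_simps\<close>)
qed

text \<open>The branch is attached through a single edge, so changing one increment realises the
  move. Only then can it be compared under the product law of the increments.\<close>

lemma pinned_height_move_edge:
  "pinned_height 1 s (X((1, generator i) := x + c)) =
    (\<lambda>u. pinned_height 1 s (X((1, generator i) := x)) u + (if u \<in> subtree i then c else 0))"
proof
  fix u show "pinned_height 1 s (X((1, generator i) := x + c)) u =
      pinned_height 1 s (X((1, generator i) := x)) u + (if u \<in> subtree i then c else 0)"
  proof (induction u rule: vertex_induct)
    case root
    then show ?case by (simp add: subtree_def)
  next
    case (step u)
    show ?case
    proof (cases "u = generator i")
      case True
      have "1 \<notin> subtree i" by (simp add: subtree_def)
      then show ?thesis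
        using True step by (simp add: pinned_height_parent[of "generator i"] generator_in_subtree)
    next
      case False
      then show ?thesis
        using step by (simp add: pinned_height_parent[OF step(1)] subtree_parent)
    qed
  qed
qed

lemma translate_measurable [measurable]: "translate v \<in> measurable config_space config_space"
  unfolding measurable_config_space_iff translate_def by simp

section \<open>Pinned averages under the gradient measure\<close>

context hidden_ising
begin

lemma avg_height_pinned_average:
  fixes \<xi> :: "'g vertex \<times> 'g vertex \<Rightarrow> int"
  shows "avg_height r (pinned_height 1 s \<xi>) = real_of_int s + (\<Sum>k<r. edge_average (Suc k) \<xi>)"
  using card by (intro avg_height_pinned) simp

lemma avg_height_pinned_tendsto:
  fixes \<xi> :: "'g vertex \<times> 'g vertex \<Rightarrow> int"
  assumes "summable (\<lambda>k. edge_average (Suc k) \<xi>)"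
  shows "(\<lambda>r. avg_height r (pinned_height 1 s \<xi>)) \<longlonglongrightarrow> real_of_int s + average_sum \<xi>"
  unfolding avg_height_pinned_average average_sum_def
  by (intro tendsto_add tendsto_const summable_LIMSEQ assms)

lemma avg_offset_pinned:
  fixes \<xi> :: "'g vertex \<times> 'g vertex \<Rightarrow> int"
  assumes "summable (\<lambda>k. edge_average (Suc k) \<xi>)"
  shows "avg_offset (pinned_height 1 s \<xi>) = ereal (real_of_int s + average_sum \<xi>)"
  unfolding avg_offset_limsup
  by (intro lim_imp_Limsup tendsto_ereal avg_height_pinned_tendsto assms) simp

lemma AE_summable: "AE \<xi> in step_measure. summable (\<lambda>k. edge_average (Suc k) (\<xi> :: 'g vertex \<times> 'g vertex \<Rightarrow> int))"
  by (rule step_measure_L2) (auto elim!: eventually_mono)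

abbreviation (input) pinned_law :: "('g vertex \<Rightarrow> int) measure" where
  "pinned_law \<equiv> distr grad config_space (pinned_height 1 0)"

lemma pinned_law_eq: "pinned_law = distr step_measure config_space (pinned_height 1 0)"
  unfolding gradient_measure_eq
  by (subst distr_distr) (auto simp: comp_def pinned_height_antisym_extension)

lemma pinned_height_measurable_step [measurable]: "pinned_height 1 s \<in> measurable step_measure config_space"
  using pinned_height_measurable_outward measurable_cong_sets[OF sets_step_measure refl] by blast

lemma pinned_limit:
  "AE \<omega> in pinned_law. \<bar>avg_offset \<omega>\<bar> < \<infinity> \<and> (\<lambda>r. avg_height r \<omega>) \<longlonglongrightarrow> real_of_ereal (avg_offset \<omega>)"
proof -
  let ?lo = "\<lambda>\<omega>::'g vertex \<Rightarrow> int. liminf (\<lambda>r. ereal (avg_height r \<omega>))"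
  \<comment> \<open>Convergence is written as equality of lower and upper limit, which is visibly a
    measurable event and can be transported along the image measure.\<close>
  have "AE \<omega> in pinned_law. \<bar>avg_offset \<omega>\<bar> \<noteq> \<infinity> \<and> ?lo \<omega> = avg_offset \<omega>"
    unfolding pinned_law_eq
  proof (subst AE_distr_iff[OF pinned_height_measurable_step])
    show "{\<omega> \<in> space config_space. \<bar>avg_offset \<omega>\<bar> \<noteq> \<infinity> \<and> ?lo \<omega> = avg_offset \<omega>} \<in> sets config_space"
    proof (intro sets.sets_Collect_conj sets.sets_Collect_neg)
      show "{\<omega> \<in> space config_space. ?lo \<omega> = avg_offset \<omega>} \<in> sets config_space"
        by (intro borel_measurable_eq) measurable
      have [measurable]: "(\<lambda>\<omega> :: 'g vertex \<Rightarrow> int. \<bar>avg_offset \<omega>\<bar>) \<in> borel_measurable config_space"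
        by (intro borel_measurable_ereal_abs avg_offset_measurable)
      show "{\<omega> \<in> space config_space. \<bar>avg_offset (\<omega> :: 'g vertex \<Rightarrow> int)\<bar> = \<infinity>} \<in> sets config_space"
        by (intro borel_measurable_eq) measurable
    qed
    show "AE \<xi> in step_measure. \<bar>avg_offset (pinned_height 1 0 \<xi>)\<bar> \<noteq> \<infinity> \<and> ?lo (pinned_height 1 0 \<xi>) = avg_offset (pinned_height 1 0 \<xi>)"
      using AE_summable
    proof eventually_elim
      fix \<xi> :: "'g vertex \<times> 'g vertex \<Rightarrow> int"
      assume s: "summable (\<lambda>k. edge_average (Suc k) \<xi>)"
      have "?lo (pinned_height 1 0 \<xi>) = ereal (real_of_int 0 + average_sum \<xi>)"
        by (intro lim_imp_Liminf tendsto_ereal avg_height_pinned_tendsto s) simp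
      then show "\<bar>avg_offset (pinned_height 1 0 \<xi>)\<bar> \<noteq> \<infinity> \<and> ?lo (pinned_height 1 0 \<xi>) = avg_offset (pinned_height 1 0 \<xi>)"
        unfolding avg_offset_pinned[OF s] by simp
    qed
  qed
  then show ?thesis
  proof eventually_elim
    fix \<omega> :: "'g vertex \<Rightarrow> int"
    assume a: "\<bar>avg_offset \<omega>\<bar> \<noteq> \<infinity> \<and> ?lo \<omega> = avg_offset \<omega>"
    then have "(\<lambda>r. ereal (avg_height r \<omega>)) \<longlonglongrightarrow> avg_offset \<omega>"
      by (subst tendsto_iff_Liminf_eq_Limsup) (simp_all add: avg_offset_limsup[symmetric])
    also have "avg_offset \<omega> = ereal (real_of_ereal (avg_offset \<omega>))" using a by (simp add: ereal_real)
    finally show "\<bar>avg_offset \<omega>\<bar> < \<infinity> \<and> (\<lambda>r. avg_height r \<omega>) \<longlonglongrightarrow> real_of_ereal (avg_offset \<omega>)"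
      using a by simp
  qed
qed

lemma pinned_L2:
  "integrable pinned_law (\<lambda>\<omega>. (avg_height r \<omega>)\<^sup>2)"
  "integrable pinned_law (\<lambda>\<omega>. (real_of_ereal (avg_offset \<omega>))\<^sup>2)"
  "(\<lambda>r. \<integral>\<^sup>+\<omega>. ennreal ((avg_height r \<omega> - real_of_ereal (avg_offset \<omega>))\<^sup>2) \<partial>pinned_law) \<longlonglongrightarrow> 0"
proof -
  obtain Y where Y: "integrable step_measure Y"
    and AEY: "AE \<xi> in step_measure. summable (\<lambda>k. edge_average (Suc k) \<xi>) \<and>
      (\<forall>r. (\<Sum>k<r. edge_average (Suc k) \<xi>)\<^sup>2 \<le> 4 * Y \<xi> \<and>
        (average_sum \<xi> - (\<Sum>k<r. edge_average (Suc k) \<xi>))\<^sup>2 \<le> 4 * (3/4)^r * Y \<xi>)"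
    by (rule step_measure_L2)
  have Y4: "integrable step_measure (\<lambda>\<xi>. 4 * Y \<xi>)" using Y by simp
  have AE': "AE \<xi> in step_measure. avg_offset (pinned_height 1 0 \<xi>) = ereal (average_sum \<xi>) \<and>
      (\<forall>r. (avg_height r (pinned_height 1 0 \<xi>))\<^sup>2 \<le> 4 * Y \<xi> \<and>
        (avg_height r (pinned_height 1 0 \<xi>) - average_sum \<xi>)\<^sup>2 \<le> 4 * (3/4)^r * Y \<xi>) \<and> (average_sum \<xi>)\<^sup>2 \<le> 4 * Y \<xi>"
    using AEY
  proof eventually_elim
    fix \<xi> :: "'g vertex \<times> 'g vertex \<Rightarrow> int"
    assume a: "summable (\<lambda>k. edge_average (Suc k) \<xi>) \<and>
      (\<forall>r. (\<Sum>k<r. edge_average (Suc k) \<xi>)\<^sup>2 \<le> 4 * Y \<xi> \<and>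
        (average_sum \<xi> - (\<Sum>k<r. edge_average (Suc k) \<xi>))\<^sup>2 \<le> 4 * (3/4)^r * Y \<xi>)"
    then have "(average_sum \<xi> - (\<Sum>k<0. edge_average (Suc k) \<xi>))\<^sup>2 \<le> 4 * (3/4)^0 * Y \<xi>" by blast
    then have "(average_sum \<xi>)\<^sup>2 \<le> 4 * Y \<xi>" by simp
    with a show "avg_offset (pinned_height 1 0 \<xi>) = ereal (average_sum \<xi>) \<and>
      (\<forall>r. (avg_height r (pinned_height 1 0 \<xi>))\<^sup>2 \<le> 4 * Y \<xi> \<and>
        (avg_height r (pinned_height 1 0 \<xi>) - average_sum \<xi>)\<^sup>2 \<le> 4 * (3/4)^r * Y \<xi>) \<and> (average_sum \<xi>)\<^sup>2 \<le> 4 * Y \<xi>"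
      by (simp add: avg_offset_pinned avg_height_pinned_average power2_commute)
  qed
  show "integrable pinned_law (\<lambda>\<omega>. (avg_height r \<omega>)\<^sup>2)"
    unfolding pinned_law_eq
  proof (subst integrable_distr_eq)
    show "integrable step_measure (\<lambda>\<xi>. (avg_height r (pinned_height 1 0 \<xi>))\<^sup>2)"
    proof (rule Bochner_Integration.integrable_bound[OF Y4])
      show "AE \<xi> in step_measure. norm ((avg_height r (pinned_height 1 0 \<xi>))\<^sup>2) \<le> norm (4 * Y \<xi>)"
        using AE'
      proof eventually_elim
        case (elim \<xi>)
        then have "(avg_height r (pinned_height 1 0 \<xi>))\<^sup>2 \<le> 4 * Y \<xi>" by blast
        then show ?case unfolding real_norm_def by (simp add: order_trans[OF _ abs_ge_self])
      qed
    qed measurable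
  qed measurable
  show "integrable pinned_law (\<lambda>\<omega>. (real_of_ereal (avg_offset \<omega>))\<^sup>2)"
    unfolding pinned_law_eq
  proof (subst integrable_distr_eq)
    show "integrable step_measure (\<lambda>\<xi>. (real_of_ereal (avg_offset (pinned_height 1 0 \<xi>)))\<^sup>2)"
    proof (rule Bochner_Integration.integrable_bound[OF Y4])
      show "AE \<xi> in step_measure. norm ((real_of_ereal (avg_offset (pinned_height 1 0 \<xi>)))\<^sup>2) \<le> norm (4 * Y \<xi>)"
        using AE'
      proof eventually_elim
        case (elim \<xi>)
        then have "(real_of_ereal (avg_offset (pinned_height 1 0 \<xi>)))\<^sup>2 \<le> 4 * Y \<xi>" by simp
        then show ?case unfolding real_norm_def by (simp add: order_trans[OF _ abs_ge_self])
      qed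
    qed measurable
  qed measurable
  have upper: "(\<integral>\<^sup>+\<omega>. ennreal ((avg_height r \<omega> - real_of_ereal (avg_offset \<omega>))\<^sup>2) \<partial>pinned_law) \<le>
      ennreal (4 * (3/4)^r) * (\<integral>\<^sup>+\<xi>. ennreal (Y \<xi>) \<partial>step_measure)" for r
  proof -
    have "(\<integral>\<^sup>+\<omega>. ennreal ((avg_height r \<omega> - real_of_ereal (avg_offset \<omega>))\<^sup>2) \<partial>pinned_law) =
        (\<integral>\<^sup>+\<xi>. ennreal ((avg_height r (pinned_height 1 0 \<xi>) - real_of_ereal (avg_offset (pinned_height 1 0 \<xi>)))\<^sup>2) \<partial>step_measure)"
      unfolding pinned_law_eq by (subst nn_integral_distr) measurable
    also have "\<dots> \<le> (\<integral>\<^sup>+\<xi>. ennreal (4 * (3/4)^r) * ennreal (Y \<xi>) \<partial>step_measure)"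
    proof (rule nn_integral_mono_AE)
      show "AE \<xi> in step_measure. ennreal ((avg_height r (pinned_height 1 0 \<xi>) - real_of_ereal (avg_offset (pinned_height 1 0 \<xi>)))\<^sup>2)
          \<le> ennreal (4 * (3/4)^r) * ennreal (Y \<xi>)"
        using AE'
      proof eventually_elim
        case (elim \<xi>)
        then have le: "(avg_height r (pinned_height 1 0 \<xi>) - real_of_ereal (avg_offset (pinned_height 1 0 \<xi>)))\<^sup>2 \<le> 4 * (3/4)^r * Y \<xi>"
          by simp
        show ?case by (subst ennreal_mult'[symmetric]) (use le in \<open>auto intro: ennreal_leI\<close>)
      qed
    qed
    also have "\<dots> = ennreal (4 * (3/4)^r) * (\<integral>\<^sup>+\<xi>. ennreal (Y \<xi>) \<partial>step_measure)"
      using Y by (intro nn_integral_cmult) auto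
    finally show ?thesis .
  qed
  have "(\<integral>\<^sup>+\<xi>. ennreal (Y \<xi>) \<partial>step_measure) < \<infinity>"
  proof -
    have "(\<integral>\<^sup>+\<xi>. ennreal (Y \<xi>) \<partial>step_measure) \<le> (\<integral>\<^sup>+\<xi>. ennreal (norm (Y \<xi>)) \<partial>step_measure)"
      by (intro nn_integral_mono ennreal_leI) simp
    also have "\<dots> < \<infinity>" using Y by (simp add: integrable_iff_bounded)
    finally show ?thesis .
  qed
  then obtain y where y: "(\<integral>\<^sup>+\<xi>. ennreal (Y \<xi>) \<partial>step_measure) = ennreal y" "y \<ge> 0"
    by (cases "\<integral>\<^sup>+\<xi>. ennreal (Y \<xi>) \<partial>step_measure") auto
  show "(\<lambda>r. \<integral>\<^sup>+\<omega>. ennreal ((avg_height r \<omega> - real_of_ereal (avg_offset \<omega>))\<^sup>2) \<partial>pinned_law) \<longlonglongrightarrow> 0"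
  proof (rule tendsto_sandwich[OF _ _ tendsto_const])
    have "(\<lambda>r. 4 * (3/4)^r * y) \<longlonglongrightarrow> 4 * 0 * y"
      by (intro tendsto_intros LIMSEQ_power_zero) simp
    then show "(\<lambda>r. ennreal (4 * (3/4)^r * y)) \<longlonglongrightarrow> 0"
      using tendsto_ennrealI by fastforce
    show "\<forall>\<^sub>F r in sequentially. (\<integral>\<^sup>+\<omega>. ennreal ((avg_height r \<omega> - real_of_ereal (avg_offset \<omega>))\<^sup>2) \<partial>pinned_law) \<le> ennreal (4 * (3/4)^r * y)"
      using upper y by (simp add: ennreal_mult[symmetric])
  qed simp
qed

lemma avg_offset_height_offset: "height_offset_variable grad avg_offset"
  unfolding height_offset_variable_def
proof (intro conjI allI)
  show "avg_offset (shift_height (- a) \<omega>) = avg_offset \<omega> + ereal (real_of_int a)" for a and \<omega> :: "'g vertex \<Rightarrow> int"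
    using avg_offset_add[OF card, of \<omega> a] by (simp add: shift_height_def)
  have "AE \<zeta> in grad. \<bar>avg_offset (pinned_height 1 0 \<zeta>)\<bar> < \<infinity>"
  proof (subst AE_grad)
    show "AE \<xi> in step_measure. \<bar>avg_offset (pinned_height 1 0 (antisym_extension \<xi>))\<bar> < \<infinity>"
      using AE_summable by eventually_elim (simp add: pinned_height_antisym_extension avg_offset_pinned)
  qed measurable
  then show "\<exists>x s. AE \<zeta> in grad. \<bar>avg_offset (pinned_height x s \<zeta>)\<bar> < \<infinity>" by blast
qed (rule avg_offset_tail_measurable)

lemma pinned_avg_limit_measurable [measurable]: "pinned_avg_limit \<in> borel_measurable (gradient_space :: ('g vertex \<times> 'g vertex \<Rightarrow> int) measure)"
  unfolding pinned_avg_limit_def by (intro borel_measurable_lim_metric) measurable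

lemma pinned_avg_limit_average: "pinned_avg_limit (antisym_extension \<xi>) = average_sum (\<xi> :: 'g vertex \<times> 'g vertex \<Rightarrow> int)"
  using card by (intro pinned_avg_limit_antisym_extension) simp

lemma AE_pinned_avg_limit: "AE \<zeta> in grad. ereal (pinned_avg_limit \<zeta>) = avg_offset (pinned_height 1 0 \<zeta>)"
proof (subst AE_grad)
  show "AE \<xi> in step_measure. ereal (pinned_avg_limit (antisym_extension \<xi>)) = avg_offset (pinned_height 1 0 (antisym_extension \<xi>))"
    using AE_summable by eventually_elim (simp add: pinned_height_antisym_extension avg_offset_pinned pinned_avg_limit_average)
qed measurable

lemma distributed_pinned_avg_limit: "distributed grad lborel pinned_avg_limit (\<lambda>x. ennreal (total_density x))"
  unfolding distributed_def
proof (intro conjI)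
  have "distr grad lborel pinned_avg_limit = distr grad borel pinned_avg_limit"
    by (rule distr_cong) simp_all
  also have "\<dots> = total_law"
    unfolding gradient_measure_eq total_law_def
    by (subst distr_distr) (auto simp: comp_def pinned_avg_limit_average)
  finally show "distr grad lborel pinned_avg_limit = density lborel (\<lambda>x. ennreal (total_density x))"
    by (simp add: total_law_eq_density)
  show "(\<lambda>x. ennreal (total_density x)) \<in> borel_measurable lborel"
    using inv_fourier_measurable[OF total_law_rapid] unfolding total_density_def by simp
  show "pinned_avg_limit \<in> measurable grad lborel" by measurable
qed

section \<open>The offset measure\<close>

abbreviation (input) offset_law :: "('g vertex \<Rightarrow> int) measure" where
  "offset_law \<equiv> offset_measure grad avg_offset"

text \<open>The offset map written as pinning at a random integer root height, the form that matches
  \<open>height_measure\<close>.\<close>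

definition offset_height :: "('g vertex \<times> 'g vertex \<Rightarrow> int) \<Rightarrow> 'g vertex \<Rightarrow> int" where
  "offset_height \<xi> = pinned_height 1 (- \<lfloor>real_of_ereal (avg_offset (pinned_height 1 0 \<xi>))\<rfloor>) \<xi>"

lemma offset_height_measurable:
  assumes "\<And>s. pinned_height 1 s \<in> measurable M config_space"
  shows "offset_height \<in> measurable M config_space"
proof -
  have [measurable]: "pinned_height 1 0 \<in> measurable M config_space" by (rule assms)
  show ?thesis
    unfolding offset_height_def[abs_def]
    by (rule measurable_compose_countable'[where I=UNIV and f="\<lambda>s \<xi>. pinned_height 1 s \<xi>", OF assms]) measurable
qed

lemma offset_map_eq: "offset_map avg_offset \<zeta> = offset_height \<zeta>"
proof
  fix v show "offset_map avg_offset \<zeta> v = offset_height \<zeta> v"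
    using pinned_height_shift[of "- \<lfloor>real_of_ereal (avg_offset (pinned_height 1 0 \<zeta>))\<rfloor>" \<zeta> v]
    unfolding offset_map_def offset_height_def by linarith
qed

lemma offset_law_eq: "offset_law = distr step_measure config_space offset_height"
proof -
  have [measurable]: "offset_height \<in> measurable gradient_space config_space"
    by (rule offset_height_measurable) measurable
  have "offset_height (antisym_extension \<xi>) = offset_height \<xi>" for \<xi> :: "'g vertex \<times> 'g vertex \<Rightarrow> int"
    by (simp add: offset_height_def pinned_height_antisym_extension)
  then show ?thesis
    unfolding offset_measure_def offset_map_eq[abs_def] gradient_measure_eq
    by (subst distr_distr) (auto simp: comp_def)
qed

lemma offset_height_measurable_step [measurable]: "offset_height \<in> measurable step_measure config_space"
  by (rule offset_height_measurable) measurable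

lemma offset_height_summable:
  fixes \<xi> :: "'g vertex \<times> 'g vertex \<Rightarrow> int"
  assumes "summable (\<lambda>k. edge_average (Suc k) \<xi>)"
  shows "offset_height \<xi> = pinned_height 1 (- \<lfloor>average_sum \<xi>\<rfloor>) \<xi>"
    and "avg_offset (offset_height \<xi>) = ereal (frac (average_sum \<xi>))"
  by (simp_all add: offset_height_def avg_offset_pinned[OF assms] frac_def)

definition unit_offset :: "('g vertex \<Rightarrow> int) set" where
  "unit_offset = avg_offset -` {0..<1}"

lemma unit_offset_tail: "unit_offset \<in> tail_sets"
  unfolding unit_offset_def by (rule avg_offset_tail_event) simp

lemma sets_unit_offset [measurable]: "unit_offset \<in> sets config_space"
  by (rule tail_sets_config[OF unit_offset_tail])

lemma sets_offset_law: "sets offset_law = sets config_space"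
  by (simp add: offset_measure_def)

text \<open>For almost every increment field exactly one root height,
  \<open>- \<lfloor>average_sum \<xi>\<rfloor>\<close>, puts the average into \<open>[0, 1)\<close>.
  Summing over all root heights therefore selects the offset map.\<close>

lemma emeasure_offset_law:
  assumes A[measurable]: "A \<in> sets config_space"
  shows "emeasure offset_law A = emeasure height_measure (A \<inter> unit_offset)"
proof -
  have "emeasure height_measure (A \<inter> unit_offset) = (\<integral>\<^sup>+\<omega>. indicator (A \<inter> unit_offset) \<omega> \<partial>height_measure)"
    by simp
  also have "\<dots> = (\<integral>\<^sup>+\<xi>. \<integral>\<^sup>+s. indicator (A \<inter> unit_offset) (pinned_height 1 s \<xi>) \<partial>count_space UNIV \<partial>step_measure)"
    by (rule nn_integral_height_measure(2)) measurable
  also have "\<dots> = (\<integral>\<^sup>+\<xi>. indicator A (offset_height \<xi>) \<partial>step_measure)"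
  proof (rule nn_integral_cong_AE)
    show "AE \<xi> in step_measure. (\<integral>\<^sup>+s. indicator (A \<inter> unit_offset) (pinned_height 1 s \<xi>) \<partial>count_space UNIV) = indicator A (offset_height \<xi>)"
      using AE_summable
    proof eventually_elim
      fix \<xi> :: "'g vertex \<times> 'g vertex \<Rightarrow> int" assume s: "summable (\<lambda>k. edge_average (Suc k) \<xi>)"
      have "pinned_height 1 s \<xi> \<in> unit_offset \<longleftrightarrow> s = - \<lfloor>average_sum \<xi>\<rfloor>" for s
        unfolding unit_offset_def vimage_def using floor_eq_iff[of "average_sum \<xi>" "- s"]
        by (auto simp: avg_offset_pinned[OF s])
      then have "(\<integral>\<^sup>+s. indicator (A \<inter> unit_offset) (pinned_height 1 s \<xi>) \<partial>count_space UNIV) =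
         (\<integral>\<^sup>+s. indicator A (offset_height \<xi>) * indicator {- \<lfloor>average_sum \<xi>\<rfloor>} s \<partial>count_space UNIV)"
        unfolding offset_height_summable(1)[OF s] by (intro nn_integral_cong) (auto simp: indicator_def)
      also have "\<dots> = indicator A (offset_height \<xi>)"
        by (subst nn_integral_cmult_indicator) auto
      finally show "(\<integral>\<^sup>+s. indicator (A \<inter> unit_offset) (pinned_height 1 s \<xi>) \<partial>count_space UNIV) = indicator A (offset_height \<xi>)" .
    qed
  qed
  also have "\<dots> = (\<integral>\<^sup>+\<omega>. indicator A \<omega> \<partial>offset_law)"
    unfolding offset_law_eq by (subst nn_integral_distr) auto
  also have "\<dots> = emeasure offset_law A" using A by (simp add: sets_offset_law)
  finally show ?thesis ..
qed

lemma prob_space_offset_law: "prob_space offset_law"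
  unfolding offset_law_eq by (rule mix.prob_space_distr) measurable

lemma emeasure_unit_offset: "emeasure height_measure unit_offset = 1"
proof -
  interpret prob_space offset_law by (rule prob_space_offset_law)
  have "emeasure height_measure unit_offset = emeasure offset_law UNIV"
    by (subst emeasure_offset_law) (simp_all add: sets.top[of config_space, simplified])
  also have "space offset_law = UNIV" by (simp add: offset_measure_def)
  then have "emeasure offset_law UNIV = 1" using emeasure_space_1 by simp
  finally show ?thesis .
qed

lemma offset_law_gibbs: "gibbs_measure Q offset_law"
proof -
  have "offset_law = height_cond unit_offset"
  proof (rule measure_eqI)
    show "sets offset_law = sets (height_cond unit_offset)"
      by (simp add: sets_offset_law height_cond_def)
    fix A assume "A \<in> sets offset_law"
    then have A: "A \<in> sets config_space" by (simp add: sets_offset_law)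
    show "emeasure offset_law A = emeasure (height_cond unit_offset) A"
      by (simp add: emeasure_offset_law[OF A] emeasure_height_cond[OF sets_unit_offset A] measure_def emeasure_unit_offset)
  qed
  moreover have "gibbs_measure Q (height_cond unit_offset)"
    by (rule height_cond_gibbs[OF unit_offset_tail]) (simp_all add: emeasure_unit_offset)
  ultimately show ?thesis by simp
qed

lemma total_law_pos:
  assumes S: "S \<in> sets borel" "emeasure lborel S \<noteq> 0"
  shows "emeasure total_law S > 0"
proof (rule ccontr)
  have meas: "(\<lambda>x. ennreal (total_density x)) \<in> borel_measurable lborel"
    using inv_fourier_measurable[OF total_law_rapid] unfolding total_density_def by simp
  assume "\<not> emeasure total_law S > 0"
  then have "emeasure (density lborel (\<lambda>x. ennreal (total_density x))) S = 0"
    unfolding total_law_eq_density[symmetric] by (simp add: zero_less_iff_neq_zero)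
  then have "(\<integral>\<^sup>+x. ennreal (total_density x) * indicator S x \<partial>lborel) = 0"
    using S(1) meas by (subst (asm) emeasure_density) auto
  moreover have "(\<lambda>x. ennreal (total_density x) * indicator S x) \<in> borel_measurable lborel"
    using S(1) meas by (intro borel_measurable_times_ennreal borel_measurable_indicator) auto
  ultimately have "AE x in lborel. ennreal (total_density x) * indicator S x = 0"
    by (subst (asm) nn_integral_0_iff_AE)
  then have "AE x in lborel. x \<notin> S"
  proof eventually_elim
    fix x assume "ennreal (total_density x) * indicator S x = 0"
    then show "x \<notin> S" using total_density_pos[of x] by (auto simp: ennreal_eq_0_iff)
  qed
  then have "S \<in> null_sets lborel" using S(1) by (subst AE_iff_null_sets) auto
  with S(2) show False by auto
qed

lemma offset_law_not_extreme: "\<not> extreme_gibbs_measure Q offset_law"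
proof
  assume ext: "extreme_gibbs_measure Q offset_law"
  interpret O: prob_space offset_law by (rule prob_space_offset_law)
  define T where "T b = (avg_offset :: ('g vertex \<Rightarrow> int) \<Rightarrow> ereal) -` (if b then {0..<ereal (1/2)} else {ereal (1/2)..<1})" for b :: bool
  have tail: "T b \<in> (tail_sets :: ('g vertex \<Rightarrow> int) set set)" for b
    unfolding T_def by (rule avg_offset_tail_event) simp
  have Tc[measurable]: "T b \<in> sets (config_space :: ('g vertex \<Rightarrow> int) measure)" for b
    by (rule tail_sets_config[OF tail])
  have part: "T True \<union> T False = unit_offset" "T True \<inter> T False = {}"
  proof -
    have lt1: "ereal (1/2) < 1" "0 < ereal (1/2)" by simp_all
    have iff: "x \<in> T True \<longleftrightarrow> 0 \<le> avg_offset x \<and> avg_offset x < ereal (1/2)"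
      "x \<in> T False \<longleftrightarrow> ereal (1/2) \<le> avg_offset x \<and> avg_offset x < 1"
      "x \<in> unit_offset \<longleftrightarrow> 0 \<le> avg_offset x \<and> avg_offset x < 1" for x
      unfolding T_def unit_offset_def by simp_all
    show "T True \<union> T False = unit_offset"
    proof (intro set_eqI)
      fix x show "x \<in> T True \<union> T False \<longleftrightarrow> x \<in> unit_offset"
      proof (cases "avg_offset x < ereal (1/2)")
        case True
        then have "avg_offset x < 1" "\<not> ereal (1/2) \<le> avg_offset x"
          using less_trans[OF _ lt1(1)] by (auto simp only: not_le)
        then show ?thesis unfolding Un_iff iff using True by blast
      next
        case False
        then have "ereal (1/2) \<le> avg_offset x" "0 \<le> avg_offset x"
          using order_trans[OF less_imp_le[OF lt1(2)]] by (auto simp only: not_less)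
        then show ?thesis unfolding Un_iff iff using False by blast
      qed
    qed
    show "T True \<inter> T False = {}"
      by (intro set_eqI) (simp only: Int_iff iff empty_iff, metis not_less)
  qed
  have T_sub: "T b \<inter> unit_offset = T b" for b using part(1) by (cases b) auto
  have MT: "emeasure height_measure (T b) = emeasure offset_law (T b)" for b
    unfolding emeasure_offset_law[OF Tc] T_sub ..
  have pos: "emeasure offset_law (T b) > 0" for b
  proof -
    \<comment> \<open>On \<open>[0, 1)\<close> the fractional part is the average itself, so the
      positive density on half of this interval gives \<open>T b\<close> positive mass.\<close>
    define S where "S = (if b then {0..<1/2} else {1/2..<1 :: real})"
    have S[measurable]: "S \<in> sets borel" by (simp add: S_def)
    have SL: "emeasure lborel S = ennreal (1/2)" by (simp add: S_def)
    have "0 < emeasure total_law S" using SL by (intro total_law_pos S) simp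
    also have "emeasure total_law S = emeasure step_measure (average_sum -` S \<inter> space step_measure)"
      unfolding total_law_def by (rule emeasure_distr) (auto simp: S)
    also have "\<dots> \<le> emeasure step_measure (offset_height -` T b \<inter> space step_measure)"
    proof (rule emeasure_mono_AE)
      show "AE \<xi> in step_measure. \<xi> \<in> average_sum -` S \<inter> space step_measure \<longrightarrow> \<xi> \<in> offset_height -` T b \<inter> space step_measure"
        using AE_summable
      proof eventually_elim
        fix \<xi> :: "'g vertex \<times> 'g vertex \<Rightarrow> int" assume s: "summable (\<lambda>k. edge_average (Suc k) \<xi>)"
        show "\<xi> \<in> average_sum -` S \<inter> space step_measure \<longrightarrow> \<xi> \<in> offset_height -` T b \<inter> space step_measure"
        proof
          assume a: "\<xi> \<in> average_sum -` S \<inter> space step_measure"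
          then have "frac (average_sum \<xi>) = average_sum \<xi>" by (auto simp: S_def frac_eq split: if_splits)
          then have "avg_offset (offset_height \<xi>) = ereal (average_sum \<xi>)"
            using offset_height_summable(2)[OF s] by simp
          then show "\<xi> \<in> offset_height -` T b \<inter> space step_measure"
            using a by (auto simp: T_def S_def split: if_splits)
        qed
      qed
      show "offset_height -` T b \<inter> space step_measure \<in> sets step_measure"
        by (rule measurable_sets[OF offset_height_measurable_step Tc])
    qed
    also have "\<dots> = emeasure offset_law (T b)"
      unfolding offset_law_eq by (rule emeasure_distr[symmetric]) auto
    finally show ?thesis .
  qed
  define t where "t = measure offset_law (T True)"
  have sum1: "measure offset_law (T True) + measure offset_law (T False) = 1"
  proof -
    have "emeasure offset_law (T True \<union> T False) = 1"
      using emeasure_unit_offset by (simp add: part(1) emeasure_offset_law)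
    then have "measure offset_law (T True \<union> T False) = 1" by (simp add: measure_def)
    moreover have "measure offset_law (T True \<union> T False) = measure offset_law (T True) + measure offset_law (T False)"
      using part(2) by (intro O.finite_measure_Union) (auto simp: sets_offset_law)
    ultimately show ?thesis by simp
  qed
  have mpos: "measure offset_law (T b) > 0" for b
    using pos[of b] by (simp add: O.emeasure_eq_measure)
  have hm: "measure height_measure (T b) = measure offset_law (T b)" for b
    by (simp add: measure_def MT)
  have gibbs_T: "gibbs_measure Q (height_cond (T b))" for b
    by (rule height_cond_gibbs[OF tail]) (use pos[of b] in \<open>simp_all add: MT O.emeasure_eq_measure\<close>)
  have cond: "emeasure (height_cond (T b)) A = ennreal (measure offset_law (A \<inter> T b) / measure offset_law (T b))"
    if A: "A \<in> sets config_space" for A b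
  proof -
    have "emeasure height_measure (A \<inter> T b) = emeasure offset_law (A \<inter> T b)"
      using T_sub[of b] by (subst emeasure_offset_law) (auto simp: A Int_assoc)
    then show ?thesis
      unfolding emeasure_height_cond[OF Tc A] hm
      by (simp add: O.emeasure_eq_measure ennreal_mult[symmetric])
  qed
  have mcond: "measure (height_cond (T b)) A = measure offset_law (A \<inter> T b) / measure offset_law (T b)"
    if A: "A \<in> sets config_space" for A b
    using cond[OF A, of b] by (simp add: measure_def)
  have mix: "measure offset_law A = t * measure (height_cond (T True)) A + (1 - t) * measure (height_cond (T False)) A"
    if A: "A \<in> sets config_space" for A
  proof -
    have "emeasure offset_law A = emeasure offset_law (A \<inter> (T True \<union> T False))"
      using A by (simp add: part(1) emeasure_offset_law Int_assoc)
    then have "measure offset_law A = measure offset_law ((A \<inter> T True) \<union> (A \<inter> T False))"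
      by (simp add: measure_def Int_Un_distrib)
    also have "\<dots> = measure offset_law (A \<inter> T True) + measure offset_law (A \<inter> T False)"
      using part(2) A by (intro O.finite_measure_Union) (auto simp: sets_offset_law)
    finally have "measure offset_law A = measure offset_law (A \<inter> T True) + measure offset_law (A \<inter> T False)" .
    moreover have "1 - t = measure offset_law (T False)" using sum1 by (simp add: t_def)
    ultimately show ?thesis
      using mpos[of True] mpos[of False] by (simp add: mcond[OF A]) (simp add: t_def)
  qed
  have "0 < t" "t < 1" using mpos[of True] mpos[of False] sum1 by (simp_all add: t_def)
  with ext gibbs_T mix have "height_cond (T True) = offset_law"
    unfolding extreme_gibbs_measure_def by blast
  \<comment> \<open>The component conditioned on \<open>T True\<close> gives no mass to
    \<open>T False\<close>, unlike the offset law.\<close>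
  then have "measure offset_law (T False) = measure (height_cond (T True)) (T False)" by simp
  also have "\<dots> = 0" using part(2) by (simp add: mcond[OF Tc] Int_commute)
  finally show False using mpos[of False] by simp
qed

section \<open>Exponential tails of the root height\<close>

lemma sets_root_height: "{\<omega> :: 'g vertex \<Rightarrow> int. \<bar>\<omega> 1\<bar> \<ge> k} \<in> sets config_space"
  using measurable_sets[OF coordinate_measurable[of 1], of "{x. \<bar>x\<bar> \<ge> k}"] by (simp add: vimage_def)

text \<open>The root height under the offset measure is minus the floor of the average, so a
  Chernoff bound on both sides of the average suffices.\<close>

lemma offset_law_exponential_tail:
  assumes t: "t > 0" "(\<lambda>j. exp (t * real_of_int j) * Q j) summable_on UNIV"
    and A: "0 < A" "A \<le> real CARD('g) * t"
  shows "\<exists>B>0. \<forall>s::nat. measure offset_law {\<omega>. \<bar>\<omega> 1\<bar> \<ge> int s} \<le> B * exp (- A * real s)"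
proof -
  have abs_le: "\<bar>A\<bar> \<le> real CARD('g) * t" "\<bar>- A\<bar> \<le> real CARD('g) * t" using A by simp_all
  obtain B1 where B1: "B1 \<ge> 0" "(\<integral>\<^sup>+\<xi>. ennreal (exp (A * average_sum \<xi>)) \<partial>step_measure) \<le> ennreal B1"
    using total_mgf_bound[OF t abs_le(1)] by blast
  obtain B2 where B2: "B2 \<ge> 0" "(\<integral>\<^sup>+\<xi>. ennreal (exp (- A * average_sum \<xi>)) \<partial>step_measure) \<le> ennreal B2"
    using total_mgf_bound[OF t abs_le(2)] by blast
  define B where "B = exp A * (B1 + B2) + 1"
  interpret O: prob_space offset_law by (rule prob_space_offset_law)
  have "measure offset_law {\<omega>. \<bar>\<omega> 1\<bar> \<ge> int s} \<le> B * exp (- A * real s)" for s :: nat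
  proof -
    let ?S = "{\<omega> :: 'g vertex \<Rightarrow> int. \<bar>\<omega> 1\<bar> \<ge> int s}"
    have "emeasure offset_law ?S = (\<integral>\<^sup>+\<omega>. indicator ?S \<omega> \<partial>offset_law)"
      using sets_root_height[of "int s"] by (simp add: sets_offset_law)
    also have "\<dots> = (\<integral>\<^sup>+\<xi>. indicator ?S (offset_height \<xi>) \<partial>step_measure)"
      unfolding offset_law_eq using sets_root_height by (subst nn_integral_distr) auto
    also have "\<dots> \<le> (\<integral>\<^sup>+\<xi>. ennreal (exp (A - A * real s)) * (ennreal (exp (A * average_sum \<xi>)) + ennreal (exp (- A * average_sum \<xi>))) \<partial>step_measure)"
    proof (rule nn_integral_mono_AE)
      show "AE \<xi> in step_measure. indicator ?S (offset_height \<xi>) \<le>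
         ennreal (exp (A - A * real s)) * (ennreal (exp (A * average_sum \<xi>)) + ennreal (exp (- A * average_sum \<xi>)))"
        using AE_summable
      proof eventually_elim
        fix \<xi> :: "'g vertex \<times> 'g vertex \<Rightarrow> int" assume sum: "summable (\<lambda>k. edge_average (Suc k) \<xi>)"
        let ?h = "average_sum \<xi>"
        show "indicator ?S (offset_height \<xi>) \<le>
         ennreal (exp (A - A * real s)) * (ennreal (exp (A * ?h)) + ennreal (exp (- A * ?h)))"
        proof (cases "offset_height \<xi> \<in> ?S")
          case True
          then have "int s \<le> \<bar>\<lfloor>?h\<rfloor>\<bar>"
            by (simp add: offset_height_summable(1)[OF sum])
          \<comment> \<open>Rounding down a negative average can enlarge its modulus by up to 1; the
            price is the factor \<open>exp A\<close> in \<open>B\<close>.\<close>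
          then have "real s - 1 \<le> \<bar>?h\<bar>" by linarith
          then have "A * (real s - 1) \<le> A * \<bar>?h\<bar>" using A(1) by (intro mult_left_mono) auto
          then have "1 \<le> exp (A - A * real s + A * \<bar>?h\<bar>)" by (simp add: algebra_simps)
          also have "\<dots> = exp (A - A * real s) * exp (A * \<bar>?h\<bar>)" by (rule exp_add)
          also have "\<dots> \<le> exp (A - A * real s) * (exp (A * ?h) + exp (- A * ?h))"
            by (intro mult_left_mono) (auto simp: abs_if)
          finally have "ennreal 1 \<le> ennreal (exp (A - A * real s) * (exp (A * ?h) + exp (- A * ?h)))"
            by (rule ennreal_leI)
          also have "\<dots> = ennreal (exp (A - A * real s)) * (ennreal (exp (A * ?h)) + ennreal (exp (- A * ?h)))"
            by (subst ennreal_mult) (auto simp: ennreal_plus)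
          finally show ?thesis using True by simp
        qed simp
      qed
    qed
    also have "\<dots> = ennreal (exp (A - A * real s)) *
       ((\<integral>\<^sup>+\<xi>. ennreal (exp (A * average_sum \<xi>)) \<partial>step_measure) + (\<integral>\<^sup>+\<xi>. ennreal (exp (- A * average_sum \<xi>)) \<partial>step_measure))"
      by (subst nn_integral_cmult, measurable, subst nn_integral_add, measurable)
    also have "\<dots> \<le> ennreal (exp (A - A * real s)) * (ennreal B1 + ennreal B2)"
      by (intro mult_left_mono add_mono B1 B2) simp
    also have "\<dots> = ennreal (exp (A - A * real s) * (B1 + B2))"
      using B1(1) B2(1) by (simp add: ennreal_mult ennreal_plus)
    finally have "measure offset_law ?S \<le> exp (A - A * real s) * (B1 + B2)"
      unfolding O.emeasure_eq_measure using B1(1) B2(1) by (subst (asm) ennreal_le_iff) auto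
    also have "\<dots> = exp A * (B1 + B2) * exp (- A * real s)"
      by (simp add: exp_diff exp_minus field_simps)
    also have "\<dots> \<le> B * exp (- A * real s)" unfolding B_def by (intro mult_right_mono) auto
    finally show ?thesis .
  qed
  moreover have "B > 0" using B1(1) B2(1) unfolding B_def by (intro add_nonneg_pos) auto
  ultimately show ?thesis by blast
qed

lemma offset_law_localized:
  assumes R: "R > 0" "\<And>t. - R < t \<Longrightarrow> t < R \<Longrightarrow> (\<lambda>j. exp (t * real_of_int j) * (Q j / (\<Sum>\<^sub>\<infinity>i. Q i))) summable_on UNIV"
    and A: "A < real CARD('g) * R"
  shows "\<exists>B>0. \<forall>s::nat. measure offset_law {\<omega>. \<bar>\<omega> 1\<bar> \<ge> int s} \<le> B * exp (- A * real s)"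
proof (cases "A > 0")
  case True
  \<comment> \<open>The smallest \<open>t\<close> with \<open>A \<le> CARD('g) * t\<close>; the
    strict bound on \<open>A\<close> places it inside the interval of finite exponential moments.
    Nonpositive \<open>A\<close> falls under the trivial bound by 1 below.\<close>
  define t where "t = A / real CARD('g)"
  have C: "real CARD('g) > 0" using card by simp
  have t: "0 < t" "t < R" using True A C by (simp_all add: t_def field_simps)
  define S where "S = (\<Sum>\<^sub>\<infinity>i. Q i)"
  have "Q 0 \<le> S"
    unfolding S_def using infsum_mono_neutral[of Q "{0}" Q UNIV] Q_summable_on Q_pos
    by (auto simp: less_imp_le)
  then have S: "S > 0" using Q_pos[of 0] by linarith
  have "(\<lambda>j. exp (t * real_of_int j) * (Q j / S) * S) summable_on UNIV"
    unfolding S_def using t R(1) by (intro summable_on_cmult_left R(2)) auto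
  then have "(\<lambda>j. exp (t * real_of_int j) * Q j) summable_on UNIV" using S by simp
  then show ?thesis
    using offset_law_exponential_tail[OF t(1) _ True] C by (simp add: t_def)
next
  case False
  interpret O: prob_space offset_law by (rule prob_space_offset_law)
  have "measure offset_law {\<omega>. \<bar>\<omega> 1\<bar> \<ge> int s} \<le> 1 * exp (- A * real s)" for s :: nat
  proof -
    have "measure offset_law {\<omega>. \<bar>\<omega> 1\<bar> \<ge> int s} \<le> 1" by (rule O.prob_le_1)
    also have "1 \<le> exp (- A * real s)" using False by (simp add: mult_nonpos_nonneg)
    finally show ?thesis by simp
  qed
  then show ?thesis by (intro exI[of _ 1]) simp
qed

text \<open>
  Translation by a neighbour of the root exchanges the weights \<open>1/(d+1)\<close> and \<open>d/(d+1)\<close> with which the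
  averages see the subtree behind it, so raising that subtree separates the two averages.
\<close>

lemma offset_law_not_invariant: "\<not> translation_invariant offset_law"
proof
  assume inv: "translation_invariant offset_law"
  fix i :: 'g
  let ?v = "generator i" and ?e = "(1, generator i) :: 'g vertex \<times> 'g vertex"
  \<comment> \<open>Invariance would put the averages around the root and around its neighbour both
    into \<open>[0, 1)\<close>. Their difference does not change when an integer is added to all
    heights, so the condition can be stated for the configuration pinned at 0.\<close>
  let ?close = "\<lambda>\<omega> :: 'g vertex \<Rightarrow> int. \<exists>a b. avg_offset \<omega> = ereal a \<and> avg_offset (translate ?v \<omega>) = ereal b \<and> \<bar>b - a\<bar> < 1"
  have tr_distr: "distr offset_law config_space (translate ?v) = offset_law"
    using inv by (simp add: translation_invariant_def)
  have unit_event: "{\<omega> \<in> space config_space. \<omega> \<in> unit_offset} \<in> sets config_space"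
    using sets_unit_offset by simp
  have unit: "AE \<omega> in offset_law. \<omega> \<in> unit_offset"
    unfolding offset_law_eq
  proof (subst AE_distr_iff[OF offset_height_measurable_step unit_event])
    show "AE \<xi> in step_measure. offset_height \<xi> \<in> unit_offset"
      using AE_summable
      by eventually_elim (simp add: unit_offset_def offset_height_summable(2) frac_lt_1)
  qed
  have tm: "translate ?v \<in> measurable offset_law config_space"
    unfolding measurable_cong_sets[OF sets_offset_law refl] by (rule translate_measurable)
  have "AE \<omega> in distr offset_law config_space (translate ?v). \<omega> \<in> unit_offset"
    unfolding tr_distr by (rule unit)
  then have "AE \<omega> in offset_law. translate ?v \<omega> \<in> unit_offset"
    by (subst (asm) AE_distr_iff[OF tm unit_event])
  with unit have close: "AE \<omega> in offset_law. \<omega> \<in> unit_offset \<and> translate ?v \<omega> \<in> unit_offset"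
    by eventually_elim blast
  have fin: "\<exists>a. x = ereal a \<and> 0 \<le> a \<and> a < 1" if "0 \<le> x" "x < 1" for x :: ereal
    using that by (cases x) auto
  have close_event: "{\<omega> \<in> space config_space. \<omega> \<in> unit_offset \<and> translate ?v \<omega> \<in> unit_offset} \<in> sets config_space"
    using sets.Int[OF sets_unit_offset measurable_sets[OF translate_measurable[of ?v] sets_unit_offset]]
    by (rule back_subst[of "\<lambda>S. S \<in> sets config_space"]) (auto dest: sets.sets_into_space[OF sets_unit_offset, THEN subsetD])
  have "AE \<xi> in step_measure. ?close (pinned_height 1 0 \<xi>)"
  proof -
    have "AE \<xi> in step_measure. offset_height \<xi> \<in> unit_offset \<and> translate ?v (offset_height \<xi>) \<in> unit_offset"
      using close unfolding offset_law_eq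
      by (subst (asm) AE_distr_iff[OF offset_height_measurable_step close_event])
    then show ?thesis
    proof eventually_elim
      fix \<xi> :: "'g vertex \<times> 'g vertex \<Rightarrow> int"
      assume a: "offset_height \<xi> \<in> unit_offset \<and> translate ?v (offset_height \<xi>) \<in> unit_offset"
      define k where "k = - \<lfloor>real_of_ereal (avg_offset (pinned_height 1 0 \<xi>))\<rfloor>"
      have o: "offset_height \<xi> = (\<lambda>x. pinned_height 1 0 \<xi> x + k)"
        unfolding offset_height_def k_def[symmetric]
        by (rule ext) (subst pinned_height_shift, rule add.commute)
      have t: "translate ?v (offset_height \<xi>) = (\<lambda>x. translate ?v (pinned_height 1 0 \<xi>) x + k)"
        unfolding o by (simp add: translate_def)
      obtain a' where a': "avg_offset (offset_height \<xi>) = ereal a'" "0 \<le> a'" "a' < 1"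
        using a fin[of "avg_offset (offset_height \<xi>)"] by (auto simp: unit_offset_def)
      obtain b' where b': "avg_offset (translate ?v (offset_height \<xi>)) = ereal b'" "0 \<le> b'" "b' < 1"
        using a fin[of "avg_offset (translate ?v (offset_height \<xi>))"] by (auto simp: unit_offset_def)
      have "avg_offset (pinned_height 1 0 \<xi>) + ereal (real_of_int k) = ereal a'"
        using a'(1) unfolding o avg_offset_add[OF card] .
      then have A: "avg_offset (pinned_height 1 0 \<xi>) = ereal (a' - real_of_int k)"
        by (cases "avg_offset (pinned_height 1 0 \<xi>)") auto
      have "avg_offset (translate ?v (pinned_height 1 0 \<xi>)) + ereal (real_of_int k) = ereal b'"
        using b'(1) unfolding t avg_offset_add[OF card] .
      then have B: "avg_offset (translate ?v (pinned_height 1 0 \<xi>)) = ereal (b' - real_of_int k)"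
        by (cases "avg_offset (translate ?v (pinned_height 1 0 \<xi>))") auto
      have "\<bar>(b' - real_of_int k) - (a' - real_of_int k)\<bar> < 1" using a' b' by linarith
      with A B show "?close (pinned_height 1 0 \<xi>)" by blast
    qed
  qed
  \<comment> \<open>A measurable null set stands in for the exceptional set when passing to fixed
    spins and splitting off one edge.\<close>
  then obtain N where N: "{\<xi> \<in> space step_measure. \<not> ?close (pinned_height 1 0 \<xi>)} \<subseteq> N"
      "emeasure step_measure N = 0" "N \<in> sets step_measure"
    by (rule AE_E)
  have "AE \<xi> in step_measure. \<xi> \<notin> N" using N(2,3) by (intro AE_not_in null_setsI)
  moreover have N_sets: "N \<in> sets outward_space" using N(3) sets_step_measure by simp
  moreover have "{\<xi> \<in> space outward_space. \<xi> \<notin> N} \<in> sets outward_space"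
    using N_sets by (auto simp: set_diff_eq[symmetric])
  ultimately have "AE \<sigma> in \<mu>. AE \<xi> in step_kernel \<sigma>. \<xi> \<notin> N"
    unfolding step_measure_def by (subst (asm) AE_bind[OF step_kernel_measurable]) (auto simp: pred_def)
  then have "\<exists>\<sigma>. AE \<xi> in step_kernel \<sigma>. \<xi> \<notin> N"
    using spin.AE_False by - (rule ccontr, auto)
  then obtain \<sigma> where \<sigma>: "AE \<xi> in step_kernel \<sigma>. \<xi> \<notin> N" by blast
  \<comment> \<open>For fixed spins the increment on \<open>?e\<close> is independent of all others,
    so two of its values can be combined with the same \<open>X\<close>.\<close>
  let ?I = "outward_edges - {?e}"
  let ?L = "\<lambda>e. step_law Q (spin_diff \<sigma> e)"
  let ?N' = "PiM ?I ?L"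
  interpret N': prob_space ?N' by (intro prob_space_PiM prob_space_step_law)
  interpret P: pair_sigma_finite "?L ?e" ?N' ..
  have e: "?e \<in> outward_edges" by (simp add: outward_edges_iff)
  then have ins: "insert ?e ?I = outward_edges" by blast
  have split: "step_kernel \<sigma> = distr (?L ?e \<Otimes>\<^sub>M ?N') (PiM (insert ?e ?I) ?L) (\<lambda>(x, X). X(?e := x))"
    unfolding step_product_def using distr_pair_PiM_eq_PiM[of ?I ?L ?e] prob_space_step_law by (simp only: ins)
  have "AE p in ?L ?e \<Otimes>\<^sub>M ?N'. (snd p)(?e := fst p) \<notin> N"
  proof -
    have "(\<lambda>(x, X). X(?e := x)) \<in> measurable (?L ?e \<Otimes>\<^sub>M ?N') (PiM (insert ?e ?I) ?L)"
      unfolding split_def by (rule measurable_fun_upd[where J="?I"]) auto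
    moreover have "{\<xi> \<in> space (PiM (insert ?e ?I) ?L). \<xi> \<notin> N} \<in> sets (PiM (insert ?e ?I) ?L)"
      using sets.compl_sets[of N "step_kernel \<sigma>"] N_sets
      unfolding ins step_product_def[symmetric] sets_step_product by (simp only: set_diff_eq)
    ultimately show ?thesis
      using \<sigma> unfolding split by (subst (asm) AE_distr_iff) (auto simp: split_def)
  qed
  then have "AE x in ?L ?e. AE X in ?N'. X(?e := x) \<notin> N"
    using P.AE_pair by fastforce
  then have AE_X: "AE X in ?N'. X(?e := x) \<notin> N" if "of_int x = spin_diff \<sigma> ?e" for x
    using that by (simp add: AE_step_law)
  obtain x where x: "of_int x = spin_diff \<sigma> ?e" using coset_nonempty by blast
  \<comment> \<open>\<open>2 * ?c\<close> is even, so \<open>x + 2 * ?c\<close> lies in the class of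
    \<open>x\<close> and also has positive probability. The branch is raised by \<open>?c\<close>
    twice.\<close>
  let ?c = "int CARD('g)"
  have x2: "of_int (x + 2 * ?c) = spin_diff \<sigma> ?e"
    using x by (simp add: of_int_bit_eq_of_bool)
  have "AE X in ?N'. X \<in> space ?N' \<and> X(?e := x) \<notin> N \<and> X(?e := x + 2 * ?c) \<notin> N"
    using AE_X[OF x] AE_X[OF x2] AE_space by eventually_elim blast
  then have "\<exists>X. X \<in> space ?N' \<and> X(?e := x) \<notin> N \<and> X(?e := x + 2 * ?c) \<notin> N"
    using N'.AE_False by - (rule ccontr, simp only: not_ex simp_thms)
  then obtain X where X: "X \<in> space ?N'" "X(?e := x) \<notin> N" "X(?e := x + 2 * ?c) \<notin> N" by blast
  have in_space: "X(?e := y) \<in> space step_measure" for y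
    using X(1) e by (auto simp: space_step_measure space_PiM PiE_iff extensional_def)
  let ?h = "\<lambda>y. pinned_height 1 0 (X(?e := y))"
  have close_x: "?close (?h x)" and close_x2: "?close (?h (x + 2 * ?c))"
    using N(1) X(2,3) in_space by blast+
  have step1: "?h (y + ?c) = (\<lambda>u. ?h y u + (if u \<in> subtree i then int CARD('g) else 0))" for y
    by (rule pinned_height_move_edge)
  have H: "avg_offset (?h (y + ?c)) = avg_offset (?h y) + ereal 1"
    "avg_offset (translate ?v (?h (y + ?c))) = avg_offset (translate ?v (?h y)) + ereal (real CARD('g) - 1)" for y
    unfolding step1 by (rule avg_offset_move_subtree[OF card])+
  obtain a b where ab: "avg_offset (?h x) = ereal a" "avg_offset (translate ?v (?h x)) = ereal b" "\<bar>b - a\<bar> < 1"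
    using close_x by blast
  have twice: "x + 2 * ?c = x + ?c + ?c" by simp
  have "avg_offset (?h (x + 2 * ?c)) = ereal (a + 2)" unfolding twice H ab by simp
  moreover have "avg_offset (translate ?v (?h (x + 2 * ?c))) = ereal (b + 2 * (real CARD('g) - 1))"
    unfolding twice H ab by (simp add: algebra_simps)
  ultimately have "\<bar>(b + 2 * (real CARD('g) - 1)) - (a + 2)\<bar> < 1" using close_x2 by auto
  \<comment> \<open>The two moves change the difference of the averages by
    \<open>2 * (CARD('g) - 2)\<close>, at least 2, whereas both differences lie strictly between -1
    and 1.\<close>
  moreover have "real CARD('g) \<ge> 3" using card by simp
  ultimately show False using ab(3) unfolding abs_less_iff by argo
qed

end

theorem theorem3:
  fixes d :: nat
    and Q :: "int \<Rightarrow> real"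
    and \<mu>bar :: "('g::finite vertex \<Rightarrow> bit) measure"
  assumes "d \<ge> 2" and "CARD('g) = d + 1"
    and "\<And>j. Q j > 0"
    and "\<And>j. Q (- j) = Q j"
    and "summable (\<lambda>j::nat. (real j)\<^sup>2 * Q (int j))"
    and "gibbs_measure (fuzzy Q) \<mu>bar"
    and "tree_markov_chain \<mu>bar"
  shows
    "let \<nu> = gradient_measure Q \<mu>bar;
         P = distr \<nu> config_space (pinned_height root_vertex 0);
         H = (avg_offset :: ('g vertex \<Rightarrow> int) \<Rightarrow> ereal);
         \<mu>H = offset_measure \<nu> H
     in
      ((AE \<omega> in P. \<bar>H \<omega>\<bar> < \<infinity> \<and> (\<lambda>r. avg_height r \<omega>) \<longlonglongrightarrow> real_of_ereal (H \<omega>)) \<and>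
       (\<forall>r. integrable P (\<lambda>\<omega>. (avg_height r \<omega>)\<^sup>2)) \<and>
       integrable P (\<lambda>\<omega>. (real_of_ereal (H \<omega>))\<^sup>2) \<and>
       (\<lambda>r. \<integral>\<^sup>+\<omega>. ennreal ((avg_height r \<omega> - real_of_ereal (H \<omega>))\<^sup>2) \<partial>P) \<longlonglongrightarrow> 0 \<and>
       height_offset_variable \<nu> H \<and>
       gibbs_measure Q \<mu>H) \<and>
      ((AE \<zeta> in \<nu>. ereal (pinned_avg_limit \<zeta>) = H (pinned_height root_vertex 0 \<zeta>)) \<and>
       (\<exists>f. distributed \<nu> lborel pinned_avg_limit (\<lambda>x. ennreal (f x)) \<and>
            (\<forall>n. (deriv ^^ n) f differentiable_on UNIV) \<and>
            (\<forall>x. f x > 0))) \<and>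
      (\<forall>R>0. (\<forall>t. - R < t \<and> t < R \<longrightarrow>
                 (\<lambda>j. exp (t * real_of_int j) * (Q j / (\<Sum>\<^sub>\<infinity>i. Q i))) summable_on UNIV) \<longrightarrow>
         (\<forall>A < real (d + 1) * R. \<exists>B>0. \<forall>s::nat.
            measure \<mu>H {\<omega>. \<bar>\<omega> root_vertex\<bar> \<ge> int s} \<le> B * exp (- A * real s))) \<and>
      \<not> translation_invariant \<mu>H \<and>
      \<not> extreme_gibbs_measure Q \<mu>H"
proof -
  interpret hidden_ising Q \<mu>bar
    by unfold_locales (use assms in auto)
  have smooth: "(deriv ^^ n) total_density differentiable_on UNIV" for n
    unfolding total_density_def by (rule inv_fourier_smooth[OF total_law_rapid])
  have localized: "\<exists>B>0. \<forall>s::nat. measure offset_law {\<omega>. \<bar>\<omega> 1\<bar> \<ge> int s} \<le> B * exp (- A * real s)"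
    if "R > 0" "\<forall>t. - R < t \<and> t < R \<longrightarrow>
         (\<lambda>j. exp (t * real_of_int j) * (Q j / (\<Sum>\<^sub>\<infinity>i. Q i))) summable_on UNIV"
      "A < real (d + 1) * R" for R A
    by (rule offset_law_localized[of R]) (use that assms(2) in auto)
  show ?thesis
    unfolding Let_def
    using pinned_limit pinned_L2 avg_offset_height_offset offset_law_gibbs AE_pinned_avg_limit
      distributed_pinned_avg_limit smooth total_density_pos localized offset_law_not_invariant offset_law_not_extreme
    by blast
qed

end
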